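(* Let $A$ be the preprojective algebra of type $\mathrm{E}_6$ over a field $\mathbb{F}$. Up to graded commutativity, the non zero Koszul cup products of elements of the basis of $\mathrm{HK}^\bullet(A)$ described in the context are: - $z_0\smile\overline{f}=\overline{f}$ for all $\overline{f}\in\mathrm{HK}^\bullet(A)$; - $z_\ell\smile\overline{\zeta}_0=\overline{\zeta}_\ell$ for $\ell\in\{0,6,8\}$; - if $\mathrm{char}(\mathbb{F})=3$: $z_6\smile\overline{h}_i=\overline{\gamma}_6$ for $i\in\{1,4\}$ and $z_6\smile\overline{h}_i=-\overline{\gamma}_6$ for $i\in\{2,5\}$; - if $\mathrm{char}(\mathbb{F})=2$: $z_6\smile\overline{\rho}_3=\overline{\zeta}_8$ and $\overline{\zeta}_0\smile\overline{\rho}_3=\overline{\gamma}_4$.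
   Context: The algebra. $\overline{Q}$ is the quiver with vertices $0,\ldots,5$ and arrows $a_0:0\to3$, $a_1:1\to2$, $a_2:2\to3$, $a_3:3\to4$, $a_4:4\to5$, together with reversed arrows $a_i^*$; paths are written from right to left. $k=\bigoplus_i\mathbb{F}e_i$, $V=\mathbb{F}\overline{Q}_1$, $k^e=k\otimes_{\mathbb{F}}k$, $A=\mathbb{F}\overline{Q}/(R)$ with $R\subseteq V\otimes_kV$ spanned by $\sigma_0=-a_0^*a_0$, $\sigma_1=-a_1^*a_1$, $\sigma_2=a_1a_1^*-a_2^*a_2$, $\sigma_3=a_0a_0^*+a_2a_2^*-a_3^*a_3$, $\sigma_4=a_3a_3^*-a_4^*a_4$, $\sigma_5=a_4a_4^*$. Put $c_0=a_0a_0^*$, $c_2=a_2a_2^*$, $c_3=a_3^*a_3$. Koszul cohomology. $W_0=k$, $W_1=V$, $W_p=\bigcap_{i+2+j=p}V^{\otimes_k i}\otimes_kR\otimes_kV^{\otimes_k j}$ for $p\geq2$ (so $W_2=R$); elements of $W_p$ are written $x_1\ldots x_p$ (a sum is understood). $\mathrm{HK}^\bullet(A)=H^\bullet(\mathrm{Hom}_{k^e}(W_\bullet,A),b_K)$ with $b_K(f)(x_1\ldots x_{p+1})=f(x_1\ldots x_p)x_{p+1}-(-1)^px_1f(x_2\ldots x_{p+1})$ for $f:W_p\to A$. The Koszul cup product is induced by $(f\smile g)(x_1\ldots x_{p+q})=(-1)^{pq}f(x_1\ldots x_p)g(x_{p+1}\ldots x_{p+q})$. $\mathrm{HK}^0(A)$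 is identified with the centre of $A$. $\overline{f}$ denotes the class of a cocycle $f$; a cochain takes the value $0$ on arrows or relations where no value is specified. Elements. In $A$: $\pi_0=a_0^*c_3^2c_0c_3a_0$, $\pi_3=c_3(c_0c_3)^2$, $z_0=1$, $z_6=a_1^*a_2^*a_3^*a_3a_2a_1+a_2^*c_3^2a_2-c_0c_3c_0+a_3c_2^2a_3^*+a_4a_3a_2a_2^*a_3^*a_4^*$, $z_8=a_2^*c_0c_3c_0a_2+c_0c_3^2c_0+a_3c_0c_3c_0a_3^*$. In $\mathrm{Hom}_{k^e}(V,A)$: $\zeta_\ell(a_i)=a_iz_\ell$ for all $i$ ($\ell\in\{0,6,8\}$); $\rho_3(a_2)=c_0a_2$, $\rho_3(a_3)=a_3c_3$, $\rho_3(a_2^* )=a_2^*c_3$; $\rho_5(a_0)=c_2c_3a_0$, $\rho_5(a_1)=a_2^*c_0a_2a_1$, $\rho_5(a_2)=c_2c_0a_2$, $\rho_5(a_0^* )=-a_0^*c_3^2$, $\rho_5(a_1^* )=-a_1^*a_2^*c_0a_2$, $\rho_5(a_2^* )=a_2^*c_3^2$. In $\mathrm{Hom}_{k^e}(R,A)$: $h_j(\sigma_i)=\delta_{ij}e_j$ ($0\leq j\leq5$); $\gamma_4(\sigma_0)=a_0^*c_3a_0$; $\gamma_6(\sigma_0)=a_0^*c_3^2a_0$. Basis. Degree $0$: $z_0,z_6,z_8,\pi_0,\pi_3$. Degree $1$: $\overline{\zeta}_0,\overline{\zeta}_6,\overline{\zeta}_8$, and $\overline{\rho}_3$ if $\mathrm{char}(\mathbb{F})=2$,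 $\overline{\rho}_5$ if $\mathrm{char}(\mathbb{F})=3$. Degree $2$: $\overline{h}_0,\ldots,\overline{h}_5$, and $\overline{\gamma}_4$ if $\mathrm{char}(\mathbb{F})=2$, $\overline{\gamma}_6$ if $\mathrm{char}(\mathbb{F})=3$. "Up to graded commutativity, the non zero cup products are" means that the cup product is graded commutative and that every cup product of two basis elements which is not listed, possibly after exchanging the factors, is zero.
   Formalization: The middle term of z_8 is taken as −c_0c_3^2c_0 (as printed, z_8 is not central unless char 2); in characteristic 2, z_0⌣ζ_6 and z_6⌣ζ_0, both equal to the class of ζ_6, are not claimed non zero, since ζ_6 is then a coboundary. *)

theory Defs
  imports Complex_Main "HOL-Library.Poly_Mapping"
begin

alias lookup = Poly_Mapping.lookup
alias keys = Poly_Mapping.keys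

section \<open>Paths of the double quiver of type E6\<close>

datatype vertex = V0 | V1 | V2 | V3 | V4 | V5

text \<open>The reversed arrow of \<open>Ai\<close> is \<open>Ais\<close>.\<close>

datatype arrow = A0 | A1 | A2 | A3 | A4 | A0s | A1s | A2s | A3s | A4s

fun arrow_source :: "arrow \<Rightarrow> vertex" where
  "arrow_source A0 = V0" | "arrow_source A1 = V1" | "arrow_source A2 = V2"
| "arrow_source A3 = V3" | "arrow_source A4 = V4"
| "arrow_source A0s = V3" | "arrow_source A1s = V2" | "arrow_source A2s = V3"
| "arrow_source A3s = V4" | "arrow_source A4s = V5"

fun arrow_target :: "arrow \<Rightarrow> vertex" where
  "arrow_target A0 = V3" | "arrow_target A1 = V2" | "arrow_target A2 = V3"
| "arrow_target A3 = V4" | "arrow_target A4 = V5"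
| "arrow_target A0s = V0" | "arrow_target A1s = V1" | "arrow_target A2s = V2"
| "arrow_target A3s = V3" | "arrow_target A4s = V4"

text \<open>A path is a source vertex together with its arrows listed from right to left:
  the head of the list is the arrow that is traversed last.\<close>

fun walk_end :: "vertex \<Rightarrow> arrow list \<Rightarrow> vertex" where
  "walk_end i [] = i"
| "walk_end i (a # as) = arrow_target a"

fun walk :: "vertex \<Rightarrow> arrow list \<Rightarrow> bool" where
  "walk i [] = True"
| "walk i (a # as) = (walk i as \<and> arrow_source a = walk_end i as)"

lemma walk_end_append: "walk_end i (as @ bs) = walk_end (walk_end i bs) as"
  by (cases as) auto

lemma walk_append: "walk i (as @ bs) \<longleftrightarrow> walk i bs \<and> walk (walk_end i bs) as"
  by (induction as) (auto simp: walk_end_append)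

typedef path = "{(i, as). walk i as}"
  by (rule exI[of _ "(V0, [])"]) simp

setup_lifting type_definition_path

lift_definition source :: "path \<Rightarrow> vertex" is fst .
lift_definition target :: "path \<Rightarrow> vertex" is "\<lambda>(i, as). walk_end i as" .
lift_definition path_length :: "path \<Rightarrow> nat" is "\<lambda>(i, as). length as" .
lift_definition trivial_path :: "vertex \<Rightarrow> path" is "\<lambda>i. (i, [])" by simp
lift_definition arrow_path :: "arrow \<Rightarrow> path" is "\<lambda>a. (arrow_source a, [a])" by simp

text \<open>\<open>compose p q\<close> is ``first \<open>q\<close>, then \<open>p\<close>''; it is only used when
  \<open>source p = target q\<close>.\<close>

lift_definition compose :: "path \<Rightarrow> path \<Rightarrow> path" is
  "\<lambda>(i, as) (j, bs). if i = walk_end j bs then (j, as @ bs) else (j, bs)"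
  by (auto simp: walk_append split: if_splits)

lemma source_compose: "source p = target q \<Longrightarrow> source (compose p q) = source q"
  by transfer (auto split: prod.splits)

lemma target_compose: "source p = target q \<Longrightarrow> target (compose p q) = target p"
  by transfer (auto simp: walk_end_append split: prod.splits)

lemma compose_assoc:
  "source p = target q \<Longrightarrow> source q = target r \<Longrightarrow>
    compose (compose p q) r = compose p (compose q r)"
  by transfer (auto simp: walk_end_append split: prod.splits)

lemma path_length_compose:
  "source p = target q \<Longrightarrow> path_length (compose p q) = path_length p + path_length q"
  by transfer (auto split: prod.splits)

lemma source_trivial [simp]: "source (trivial_path i) = i"
  by transfer simp

lemma target_trivial [simp]: "target (trivial_path i) = i"
  by transfer simp

lemma path_length_trivial [simp]: "path_length (trivial_path i) = 0"
  by transfer simp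

lemma path_length_arrow [simp]: "path_length (arrow_path a) = 1"
  by transfer simp

lemma source_arrow [simp]: "source (arrow_path a) = arrow_source a"
  by transfer simp

lemma target_arrow [simp]: "target (arrow_path a) = arrow_target a"
  by transfer simp

lemma compose_trivial_left [simp]: "compose (trivial_path (target p)) p = p"
  by transfer (auto split: prod.splits)

lemma compose_trivial_right [simp]: "compose p (trivial_path (source p)) = p"
  by transfer (auto split: prod.splits)

lemma UNIV_vertex: "UNIV = {V0, V1, V2, V3, V4, V5}"
  using vertex.exhaust by blast

instance vertex :: finite
  by standard (simp add: UNIV_vertex)


section \<open>The path algebra\<close>

definition scale :: "'f::field \<Rightarrow> (path \<Rightarrow>\<^sub>0 'f) \<Rightarrow> (path \<Rightarrow>\<^sub>0 'f)" where
  "scale c x = Poly_Mapping.map ((*) c) x"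

lemma lookup_scale [simp]: "lookup (scale c x) p = c * lookup x p"
  by (simp add: scale_def map.rep_eq when_def)

global_interpretation path_algebra: vector_space scale
  by unfold_locales (auto intro!: poly_mapping_eqI simp: lookup_add algebra_simps)

text \<open>Poly_Mapping's own product requires a monoid of keys and is not the one used here.\<close>

definition path_mult :: "(path \<Rightarrow>\<^sub>0 'f::field) \<Rightarrow> (path \<Rightarrow>\<^sub>0 'f) \<Rightarrow> (path \<Rightarrow>\<^sub>0 'f)"
    (infixl \<open>\<star>\<close> 70) where
  "x \<star> y = (\<Sum>p\<in>keys x. \<Sum>q\<in>keys y.
     if source p = target q
     then Poly_Mapping.single (compose p q) (lookup x p * lookup y q) else 0)"

definition vertex_elem :: "vertex \<Rightarrow> path \<Rightarrow>\<^sub>0 'f::field" where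
  "vertex_elem i = Poly_Mapping.single (trivial_path i) 1"

definition arrow_elem :: "arrow \<Rightarrow> path \<Rightarrow>\<^sub>0 'f::field" where
  "arrow_elem a = Poly_Mapping.single (arrow_path a) 1"

definition path_one :: "path \<Rightarrow>\<^sub>0 'f::field" where
  "path_one = (\<Sum>i\<in>UNIV. vertex_elem i)"

lemma path_mult_superset:
  assumes "finite A" "keys x \<subseteq> A" "finite B" "keys y \<subseteq> B"
  shows "x \<star> y = (\<Sum>p\<in>A. \<Sum>q\<in>B.
     if source p = target q
     then Poly_Mapping.single (compose p q) (lookup x p * lookup y q) else 0)"
    (is "_ = (\<Sum>p\<in>A. \<Sum>q\<in>B. ?g p q)")
proof -
  have "(\<Sum>q\<in>keys y. ?g p q) = (\<Sum>q\<in>B. ?g p q)" for p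
    using assms by (intro sum.mono_neutral_left) (auto simp: in_keys_iff)
  moreover have "(\<Sum>p\<in>keys x. \<Sum>q\<in>B. ?g p q) = (\<Sum>p\<in>A. \<Sum>q\<in>B. ?g p q)"
    using assms by (intro sum.mono_neutral_left) (auto simp: in_keys_iff intro!: sum.neutral)
  ultimately show ?thesis
    by (simp add: path_mult_def)
qed

lemma path_mult_add_left: "(x + x') \<star> y = x \<star> y + x' \<star> y"
proof -
  let ?A = "keys x \<union> keys x'"
  have sub: "keys (x + x') \<subseteq> ?A" by (rule keys_add)
  have "(x + x') \<star> y = (\<Sum>p\<in>?A. \<Sum>q\<in>keys y. if source p = target q
     then Poly_Mapping.single (compose p q) (lookup (x + x') p * lookup y q) else 0)"
    by (rule path_mult_superset) (use sub in auto)
  also have "\<dots> = (\<Sum>p\<in>?A. \<Sum>q\<in>keys y. if source p = target q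
     then Poly_Mapping.single (compose p q) (lookup x p * lookup y q) else 0)
    + (\<Sum>p\<in>?A. \<Sum>q\<in>keys y. if source p = target q
     then Poly_Mapping.single (compose p q) (lookup x' p * lookup y q) else 0)"
    unfolding sum.distrib[symmetric]
    by (intro sum.cong refl) (simp add: lookup_add distrib_right single_add)
  also have "\<dots> = x \<star> y + x' \<star> y"
    by (subst (1 2) path_mult_superset[of ?A _ "keys y"]) auto
  finally show ?thesis .
qed

lemma path_mult_add_right: "x \<star> (y + y') = x \<star> y + x \<star> y'"
proof -
  let ?B = "keys y \<union> keys y'"
  have sub: "keys (y + y') \<subseteq> ?B" by (rule keys_add)
  have "x \<star> (y + y') = (\<Sum>p\<in>keys x. \<Sum>q\<in>?B. if source p = target q
     then Poly_Mapping.single (compose p q) (lookup x p * lookup (y + y') q) else 0)"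
    by (rule path_mult_superset) (use sub in auto)
  also have "\<dots> = (\<Sum>p\<in>keys x. \<Sum>q\<in>?B. if source p = target q
     then Poly_Mapping.single (compose p q) (lookup x p * lookup y q) else 0)
    + (\<Sum>p\<in>keys x. \<Sum>q\<in>?B. if source p = target q
     then Poly_Mapping.single (compose p q) (lookup x p * lookup y' q) else 0)"
    unfolding sum.distrib[symmetric]
    by (intro sum.cong refl) (simp add: lookup_add distrib_left single_add)
  also have "\<dots> = x \<star> y + x \<star> y'"
    by (subst (1 2) path_mult_superset[of "keys x" _ ?B]) auto
  finally show ?thesis .
qed

lemma path_mult_zero [simp]: "0 \<star> y = 0" "x \<star> 0 = 0"
  by (simp_all add: path_mult_def)

lemma path_mult_minus_left: "(- x) \<star> y = - (x \<star> y)"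
  using path_mult_add_left[of "-x" x y] by (simp add: eq_neg_iff_add_eq_0)

lemma path_mult_minus_right: "x \<star> (- y) = - (x \<star> y)"
  using path_mult_add_right[of x "-y" y] by (simp add: eq_neg_iff_add_eq_0)

lemma path_mult_diff_left: "(x - x') \<star> y = x \<star> y - x' \<star> y"
  using path_mult_add_left[of x "-x'" y] by (simp add: path_mult_minus_left)

lemma path_mult_diff_right: "x \<star> (y - y') = x \<star> y - x \<star> y'"
  using path_mult_add_right[of x y "-y'"] by (simp add: path_mult_minus_right)

lemma path_mult_sum_left: "(\<Sum>i\<in>I. f i) \<star> y = (\<Sum>i\<in>I. f i \<star> y)"
  by (induction I rule: infinite_finite_induct) (auto simp: path_mult_add_left)

lemma path_mult_sum_right: "y \<star> (\<Sum>i\<in>I. f i) = (\<Sum>i\<in>I. y \<star> f i)"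
  by (induction I rule: infinite_finite_induct) (auto simp: path_mult_add_right)

lemma path_mult_single:
  "Poly_Mapping.single p c \<star> Poly_Mapping.single q d =
    (if source p = target q then Poly_Mapping.single (compose p q) (c * d) else 0)"
  by (subst path_mult_superset[of "{p}" _ "{q}"]) auto

lemma path_elem_expand: "x = (\<Sum>p\<in>keys x. Poly_Mapping.single p (lookup x p))"
  by (rule poly_mapping_eqI) (auto simp: lookup_sum lookup_single when_def in_keys_iff)

lemma path_elem_induct [case_names zero single add]:
  assumes "P 0" "\<And>p c. P (Poly_Mapping.single p c)" "\<And>x y. P x \<Longrightarrow> P y \<Longrightarrow> P (x + y)"
  shows "P (x :: path \<Rightarrow>\<^sub>0 'f::field)"
proof -
  have "P (\<Sum>p\<in>K. Poly_Mapping.single p (lookup x p))" if "finite K" for K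
    using that by (induction K) (auto intro: assms)
  then show ?thesis by (subst path_elem_expand) simp
qed

lemma path_mult_assoc: "(x \<star> y) \<star> z = x \<star> (y \<star> z)"
proof (induction x rule: path_elem_induct)
  case (single p c)
  show ?case
  proof (induction y rule: path_elem_induct)
    case (single q d)
    show ?case
    proof (induction z rule: path_elem_induct)
      case (single r e)
      show ?case
        by (auto simp: path_mult_single source_compose target_compose compose_assoc mult.assoc)
    qed (auto simp: path_mult_add_right)
  qed (auto simp: path_mult_add_left path_mult_add_right)
qed (auto simp: path_mult_add_left)

lemma path_one_left: "path_one \<star> x = x"
proof (induction x rule: path_elem_induct)
  case (single p c)
  have "path_one \<star> Poly_Mapping.single p c =
      (\<Sum>i\<in>UNIV. if i = target p then Poly_Mapping.single p c else 0)"
    unfolding path_one_def vertex_elem_def path_mult_sum_left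
    by (intro sum.cong refl) (auto simp: path_mult_single)
  then show ?case by simp
qed (auto simp: path_mult_add_right)

lemma path_one_right: "x \<star> path_one = x"
proof (induction x rule: path_elem_induct)
  case (single p c)
  have "Poly_Mapping.single p c \<star> path_one =
      (\<Sum>i\<in>UNIV. if i = source p then Poly_Mapping.single p c else 0)"
    unfolding path_one_def vertex_elem_def path_mult_sum_right
    by (intro sum.cong refl) (auto simp: path_mult_single)
  then show ?case by simp
qed (auto simp: path_mult_add_left)

lemma scale_single: "scale c (Poly_Mapping.single p d) = Poly_Mapping.single p (c * d)"
  by (rule poly_mapping_eqI) (simp add: lookup_single when_def)

lemma path_mult_scale_left: "scale c x \<star> y = scale c (x \<star> y)"
proof (induction x rule: path_elem_induct)
  case (single p d)
  show ?case
    by (induction y rule: path_elem_induct)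
       (auto simp: path_mult_single scale_single path_mult_add_right
         path_algebra.scale_right_distrib mult.assoc)
qed (auto simp: path_mult_add_left path_algebra.scale_right_distrib)

lemma path_mult_scale_right: "x \<star> scale c y = scale c (x \<star> y)"
proof (induction x rule: path_elem_induct)
  case (single p d)
  show ?case
    by (induction y rule: path_elem_induct)
       (auto simp: path_mult_single scale_single path_mult_add_right
         path_algebra.scale_right_distrib mult_ac)
qed (auto simp: path_mult_add_left path_algebra.scale_right_distrib)


section \<open>The preprojective algebra\<close>

fun \<sigma> :: "vertex \<Rightarrow> path \<Rightarrow>\<^sub>0 'f::field" where
  "\<sigma> V0 = - (arrow_elem A0s \<star> arrow_elem A0)"
| "\<sigma> V1 = - (arrow_elem A1s \<star> arrow_elem A1)"
| "\<sigma> V2 = arrow_elem A1 \<star> arrow_elem A1s - arrow_elem A2s \<star> arrow_elem A2"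
| "\<sigma> V3 = arrow_elem A0 \<star> arrow_elem A0s + arrow_elem A2 \<star> arrow_elem A2s
            - arrow_elem A3s \<star> arrow_elem A3"
| "\<sigma> V4 = arrow_elem A3 \<star> arrow_elem A3s - arrow_elem A4s \<star> arrow_elem A4"
| "\<sigma> V5 = arrow_elem A4 \<star> arrow_elem A4s"

definition R_space :: "(path \<Rightarrow>\<^sub>0 'f::field) set" where
  "R_space = path_algebra.span (range \<sigma>)"

definition relation_ideal :: "(path \<Rightarrow>\<^sub>0 'f::field) set" where
  "relation_ideal = path_algebra.span {u \<star> r \<star> v | u r v. r \<in> R_space}"

lemma relation_ideal_diff:
  "x \<in> relation_ideal \<Longrightarrow> y \<in> relation_ideal \<Longrightarrow> x - y \<in> relation_ideal"
  unfolding relation_ideal_def by (rule path_algebra.span_diff)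

lemma relation_ideal_add:
  "x \<in> relation_ideal \<Longrightarrow> y \<in> relation_ideal \<Longrightarrow> x + y \<in> relation_ideal"
  unfolding relation_ideal_def by (rule path_algebra.span_add)

lemma relation_ideal_minus: "x \<in> relation_ideal \<Longrightarrow> - x \<in> relation_ideal"
  unfolding relation_ideal_def by (rule path_algebra.span_neg)

lemma relation_ideal_zero: "0 \<in> relation_ideal"
  unfolding relation_ideal_def by (rule path_algebra.span_zero)

lemma relation_ideal_mult_left:
  assumes "x \<in> relation_ideal" shows "w \<star> x \<in> relation_ideal"
  using assms unfolding relation_ideal_def
proof (induction rule: path_algebra.span_induct_alt)
  case base
  then show ?case by (simp add: path_algebra.span_zero)
next
  case (step c x y)
  then obtain u r v where x: "x = u \<star> r \<star> v" "r \<in> R_space" by blast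
  have "w \<star> x = (w \<star> u) \<star> r \<star> v" by (simp add: x path_mult_assoc)
  then have "w \<star> x \<in> path_algebra.span {u \<star> r \<star> v | u r v. r \<in> R_space}"
    using x(2) by (intro path_algebra.span_base) blast
  then show ?case using step
    by (simp add: path_mult_add_right path_mult_scale_right
        path_algebra.span_add path_algebra.span_scale)
qed

lemma relation_ideal_mult_right:
  assumes "x \<in> relation_ideal" shows "x \<star> w \<in> relation_ideal"
  using assms unfolding relation_ideal_def
proof (induction rule: path_algebra.span_induct_alt)
  case base
  then show ?case by (simp add: path_algebra.span_zero)
next
  case (step c x y)
  then obtain u r v where x: "x = u \<star> r \<star> v" "r \<in> R_space" by blast
  have "x \<star> w = u \<star> r \<star> (v \<star> w)" by (simp add: x path_mult_assoc)
  then have "x \<star> w \<in> path_algebra.span {u \<star> r \<star> v | u r v. r \<in> R_space}"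
    using x(2) by (intro path_algebra.span_base) blast
  then show ?case using step
    by (simp add: path_mult_add_left path_mult_scale_left
        path_algebra.span_add path_algebra.span_scale)
qed

text \<open>The subspace of elements without component of length 0 is an ideal containing the
  relations, whence \<open>1 \<noteq> 0\<close> in the quotient.\<close>

definition positive_part :: "(path \<Rightarrow>\<^sub>0 'f::field) set" where
  "positive_part = {x. \<forall>p\<in>keys x. path_length p \<noteq> 0}"

lemma positive_part_iff:
  "x \<in> positive_part \<longleftrightarrow> (\<forall>p. path_length p = 0 \<longrightarrow> lookup x p = 0)"
  unfolding positive_part_def mem_Collect_eq Ball_def in_keys_iff by blast

lemma positive_part_add: "x \<in> positive_part \<Longrightarrow> y \<in> positive_part \<Longrightarrow> x + y \<in> positive_part"
  by (simp add: positive_part_iff lookup_add)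

lemma positive_part_scale: "x \<in> positive_part \<Longrightarrow> scale c x \<in> positive_part"
  by (simp add: positive_part_iff)

lemma positive_part_sum:
  "(\<And>i. i \<in> I \<Longrightarrow> f i \<in> positive_part) \<Longrightarrow> (\<Sum>i\<in>I. f i) \<in> positive_part"
  by (simp add: positive_part_iff lookup_sum)

lemma positive_part_mult:
  assumes "x \<in> positive_part \<or> y \<in> positive_part"
  shows "x \<star> y \<in> positive_part"
  unfolding path_mult_def
proof (intro positive_part_sum)
  fix p q assume pq: "p \<in> keys x" "q \<in> keys y"
  then have "path_length p \<noteq> 0 \<or> path_length q \<noteq> 0"
    using assms by (auto simp: positive_part_def)
  then show "(if source p = target q
      then Poly_Mapping.single (compose p q) (lookup x p * lookup y q) else 0) \<in> positive_part"
    by (auto simp: positive_part_iff lookup_single when_def path_length_compose)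
qed

lemma positive_part_relation: "\<sigma> i \<in> positive_part"
proof -
  have a: "arrow_elem a \<in> positive_part" for a
    by (auto simp: positive_part_iff arrow_elem_def lookup_single when_def)
  have neg: "x \<in> positive_part \<Longrightarrow> - x \<in> positive_part" for x
    by (simp add: positive_part_iff)
  have m: "arrow_elem a \<star> arrow_elem b \<in> positive_part" for a b
    using a by (blast intro: positive_part_mult)
  show ?thesis
    by (cases i) (auto intro!: m neg positive_part_add simp: diff_conv_add_uminus
        simp del: add_uminus_conv_diff)
qed

lemma relation_ideal_subset_positive_part: "relation_ideal \<subseteq> positive_part"
proof -
  have sub: "path_algebra.subspace positive_part"
    using positive_part_add positive_part_scale
    by (intro path_algebra.subspaceI) (simp_all add: positive_part_iff)
  have "R_space \<subseteq> positive_part"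
    unfolding R_space_def
    by (intro path_algebra.span_minimal sub) (auto intro: positive_part_relation)
  then show ?thesis
    unfolding relation_ideal_def
    by (intro path_algebra.span_minimal sub) (auto intro!: positive_part_mult)
qed

definition relation_cong :: "(path \<Rightarrow>\<^sub>0 'f::field) \<Rightarrow> (path \<Rightarrow>\<^sub>0 'f) \<Rightarrow> bool" where
  "relation_cong x y \<longleftrightarrow> x - y \<in> relation_ideal"

lemma equivp_relation_cong: "equivp relation_cong"
proof (rule equivpI)
  show "reflp relation_cong"
    by (simp add: reflp_def relation_cong_def relation_ideal_zero)
  show "symp relation_cong"
    unfolding symp_def relation_cong_def using relation_ideal_minus by (metis minus_diff_eq)
  show "transp relation_cong"
    unfolding transp_def relation_cong_def using relation_ideal_add by (metis diff_add_cancel add_diff_eq)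
qed

quotient_type (overloaded) 'f preproj = "path \<Rightarrow>\<^sub>0 'f::field" / relation_cong
  by (rule equivp_relation_cong)

instantiation preproj :: (field) ring_1
begin

lift_definition zero_preproj :: "'a preproj" is 0 .
lift_definition one_preproj :: "'a preproj" is path_one .
lift_definition plus_preproj :: "'a preproj \<Rightarrow> 'a preproj \<Rightarrow> 'a preproj" is "(+)"
  unfolding relation_cong_def by (metis add_diff_add relation_ideal_add)
lift_definition minus_preproj :: "'a preproj \<Rightarrow> 'a preproj \<Rightarrow> 'a preproj" is "(-)"
  unfolding relation_cong_def
  by (metis (no_types, opaque_lifting) diff_diff_eq2 diff_add_eq diff_diff_add add.commute
      relation_ideal_diff)
lift_definition uminus_preproj :: "'a preproj \<Rightarrow> 'a preproj" is uminus
  unfolding relation_cong_def using relation_ideal_minus by fastforce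
lift_definition times_preproj :: "'a preproj \<Rightarrow> 'a preproj \<Rightarrow> 'a preproj" is "(\<star>)"
proof -
  fix x x' y y' :: "path \<Rightarrow>\<^sub>0 'a"
  assume "relation_cong x x'" "relation_cong y y'"
  then have "(x - x') \<star> y + x' \<star> (y - y') \<in> relation_ideal"
    unfolding relation_cong_def
    by (intro relation_ideal_add relation_ideal_mult_left relation_ideal_mult_right)
  then show "relation_cong (x \<star> y) (x' \<star> y')"
    by (simp add: relation_cong_def path_mult_diff_left path_mult_diff_right)
qed

instance
proof
  fix a b c :: "'a preproj"
  have refl: "relation_cong x x" for x :: "path \<Rightarrow>\<^sub>0 'a"
    by (simp add: relation_cong_def relation_ideal_zero)
  show "a + b + c = a + (b + c)" by transfer (simp add: add.assoc refl)
  show "a + b = b + a" by transfer (simp add: add.commute refl)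
  show "0 + a = a" by transfer (simp add: refl)
  show "- a + a = 0" by transfer (simp add: refl)
  show "a - b = a + - b" by transfer (simp add: refl)
  show "a * b * c = a * (b * c)" by transfer (simp add: path_mult_assoc refl)
  show "(a + b) * c = a * c + b * c" by transfer (simp add: path_mult_add_left refl)
  show "a * (b + c) = a * b + a * c" by transfer (simp add: path_mult_add_right refl)
  show "1 * a = a" by transfer (simp add: path_one_left refl)
  show "a * 1 = a" by transfer (simp add: path_one_right refl)
  have "lookup (path_one :: path \<Rightarrow>\<^sub>0 'a) (trivial_path V0) = (\<Sum>i\<in>UNIV. if i = V0 then 1 else 0)"
    unfolding path_one_def vertex_elem_def lookup_sum
    by (intro sum.cong refl)
       (auto simp: lookup_single when_def dest: arg_cong[of _ _ source])
  then have "path_one \<notin> (positive_part :: (path \<Rightarrow>\<^sub>0 'a) set)"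
    by (auto simp: positive_part_iff intro!: exI[of _ "trivial_path V0"])
  then have "\<not> relation_cong 0 (path_one :: path \<Rightarrow>\<^sub>0 'a)"
    using relation_ideal_subset_positive_part relation_ideal_minus
    by (fastforce simp: relation_cong_def)
  then show "(0::'a preproj) \<noteq> 1"
    by transfer
qed

end

definition proj :: "(path \<Rightarrow>\<^sub>0 'f::field) \<Rightarrow> 'f preproj" where
  "proj = abs_preproj"


section \<open>Koszul cohomology\<close>

text \<open>The space \<open>V\<close> tensored \<open>n\<close> times over \<open>k\<close> is identified with the span of the paths
  of length \<open>n\<close>, and tensor products over \<open>k\<close> of subspaces of such spaces with the spans of the
  products of their elements in the path algebra.\<close>

definition V_power :: "nat \<Rightarrow> (path \<Rightarrow>\<^sub>0 'f::field) set" where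
  "V_power n = path_algebra.span {Poly_Mapping.single p 1 | p. path_length p = n}"

definition W :: "nat \<Rightarrow> (path \<Rightarrow>\<^sub>0 'f::field) set" where
  "W p = (if p < 2 then V_power p
    else {w. \<forall>i j. i + 2 + j = p \<longrightarrow>
      w \<in> path_algebra.span {u \<star> r \<star> v | u r v. u \<in> V_power i \<and> r \<in> R_space \<and> v \<in> V_power j}})"

type_synonym 'f cochain = "(path \<Rightarrow>\<^sub>0 'f) \<Rightarrow> 'f preproj"

text \<open>A \<open>p\<close>-cochain is a homomorphism of \<open>k\<close>-bimodules on \<open>W p\<close>, extended by \<open>0\<close> so that
  cochains are equal iff they agree on \<open>W p\<close>. Here \<open>k = W 0\<close>, and \<open>\<FF>\<close>-linearity is the case
  of multiples of \<open>1 \<in> k\<close>.\<close>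

definition cochains :: "nat \<Rightarrow> 'f::field cochain set" where
  "cochains p = {f.
     (\<forall>v\<in>W p. \<forall>w\<in>W p. f (v + w) = f v + f w) \<and>
     (\<forall>l\<in>W 0. \<forall>w\<in>W p. \<forall>m\<in>W 0. f (l \<star> w \<star> m) = proj l * f w * proj m) \<and>
     (\<forall>w. w \<notin> W p \<longrightarrow> f w = 0)}"

text \<open>\<open>split_eval p q f g w\<close> is \<open>f(x\<^sub>1\<dots>x\<^sub>p) g(x\<^sub>p\<^sub>+\<^sub>1\<dots>x\<^sub>p\<^sub>+\<^sub>q)\<close> for
  \<open>w = x\<^sub>1\<dots>x\<^sub>p\<^sub>+\<^sub>q\<close>: the element \<open>w\<close> of \<open>W (p + q)\<close> is a sum of products of elements of
  \<open>W p\<close> and \<open>W q\<close>, and the value does not depend on the choice of such a sum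
  when \<open>f\<close> and \<open>g\<close> are cochains.\<close>

definition split_eval :: "nat \<Rightarrow> nat \<Rightarrow> 'f::field cochain \<Rightarrow> 'f cochain \<Rightarrow> 'f cochain" where
  "split_eval p q f g w = (THE a. \<exists>ts. set ts \<subseteq> W p \<times> W q \<and>
     w = (\<Sum>(u, v)\<leftarrow>ts. u \<star> v) \<and> a = (\<Sum>(u, v)\<leftarrow>ts. f u * g v))"

definition koszul_d :: "nat \<Rightarrow> 'f::field cochain \<Rightarrow> 'f cochain" where
  "koszul_d p f = (\<lambda>w. if w \<in> W (p + 1)
     then split_eval p 1 f proj w - (-1) ^ p * split_eval 1 p proj f w else 0)"

definition cocycles :: "nat \<Rightarrow> 'f::field cochain set" where
  "cocycles p = {f \<in> cochains p. koszul_d p f = (\<lambda>_. 0)}"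

definition coboundaries :: "nat \<Rightarrow> 'f::field cochain set" where
  "coboundaries p = (case p of 0 \<Rightarrow> {\<lambda>_. 0} | Suc n \<Rightarrow> koszul_d n ` cochains n)"

definition cohomologous :: "nat \<Rightarrow> ('f::field cochain \<times> 'f cochain) set" where
  "cohomologous p = {(f, g). f \<in> cocycles p \<and> g \<in> cocycles p \<and> f - g \<in> coboundaries p}"

definition HK :: "nat \<Rightarrow> 'f::field cochain set set" where
  "HK p = cocycles p // cohomologous p"

definition cls :: "nat \<Rightarrow> 'f::field cochain \<Rightarrow> 'f cochain set" where
  "cls p f = cohomologous p `` {f}"

definition HK_zero :: "nat \<Rightarrow> 'f::field cochain set" where
  "HK_zero p = cls p (\<lambda>_. 0)"

definition cup_cochain :: "nat \<Rightarrow> nat \<Rightarrow> 'f::field cochain \<Rightarrow> 'f cochain \<Rightarrow> 'f cochain" where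
  "cup_cochain p q f g = (\<lambda>w. if w \<in> W (p + q) then (-1) ^ (p * q) * split_eval p q f g w else 0)"

text \<open>The product of classes of degrees \<open>p\<close> and \<open>q\<close>, as the union of the classes of the
  products of their representatives.\<close>

definition cup :: "'f::field cochain set \<Rightarrow> nat \<Rightarrow> nat \<Rightarrow> 'f cochain set \<Rightarrow> 'f cochain set"
    (\<open>(_ \<smile>\<^bsub>_,_\<^esub> _)\<close> [71, 0, 0, 71] 70) where
  "X \<smile>\<^bsub>p,q\<^esub> Y = (\<Union>f\<in>X. \<Union>g\<in>Y. cls (p + q) (cup_cochain p q f g))"

text \<open>The class \<open>(-1)\<^sup>n X\<close>.\<close>

definition signed :: "nat \<Rightarrow> 'f::field cochain set \<Rightarrow> 'f cochain set" where
  "signed n X = (\<lambda>f w. (-1) ^ n * f w) ` X"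


section \<open>The elements\<close>

abbreviation e :: "vertex \<Rightarrow> 'f::field preproj" where "e i \<equiv> proj (vertex_elem i)"

abbreviation arr0 (\<open>a\<^sub>0\<close>) where "a\<^sub>0 \<equiv> proj (arrow_elem A0)"
abbreviation arr1 (\<open>a\<^sub>1\<close>) where "a\<^sub>1 \<equiv> proj (arrow_elem A1)"
abbreviation arr2 (\<open>a\<^sub>2\<close>) where "a\<^sub>2 \<equiv> proj (arrow_elem A2)"
abbreviation arr3 (\<open>a\<^sub>3\<close>) where "a\<^sub>3 \<equiv> proj (arrow_elem A3)"
abbreviation arr4 (\<open>a\<^sub>4\<close>) where "a\<^sub>4 \<equiv> proj (arrow_elem A4)"
abbreviation arr0s (\<open>a\<^sub>0\<^sup>*\<close>) where "a\<^sub>0\<^sup>* \<equiv> proj (arrow_elem A0s)"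
abbreviation arr1s (\<open>a\<^sub>1\<^sup>*\<close>) where "a\<^sub>1\<^sup>* \<equiv> proj (arrow_elem A1s)"
abbreviation arr2s (\<open>a\<^sub>2\<^sup>*\<close>) where "a\<^sub>2\<^sup>* \<equiv> proj (arrow_elem A2s)"
abbreviation arr3s (\<open>a\<^sub>3\<^sup>*\<close>) where "a\<^sub>3\<^sup>* \<equiv> proj (arrow_elem A3s)"
abbreviation arr4s (\<open>a\<^sub>4\<^sup>*\<close>) where "a\<^sub>4\<^sup>* \<equiv> proj (arrow_elem A4s)"

definition c\<^sub>0 :: "'f::field preproj" where "c\<^sub>0 = a\<^sub>0 * a\<^sub>0\<^sup>*"
definition c\<^sub>2 :: "'f::field preproj" where "c\<^sub>2 = a\<^sub>2 * a\<^sub>2\<^sup>*"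
definition c\<^sub>3 :: "'f::field preproj" where "c\<^sub>3 = a\<^sub>3\<^sup>* * a\<^sub>3"

definition \<pi>\<^sub>0 :: "'f::field preproj" where "\<pi>\<^sub>0 = a\<^sub>0\<^sup>* * c\<^sub>3^2 * c\<^sub>0 * c\<^sub>3 * a\<^sub>0"
definition \<pi>\<^sub>3 :: "'f::field preproj" where "\<pi>\<^sub>3 = c\<^sub>3 * (c\<^sub>0 * c\<^sub>3)^2"

definition z\<^sub>0 :: "'f::field preproj" where "z\<^sub>0 = 1"

definition z\<^sub>6 :: "'f::field preproj" where
  "z\<^sub>6 = a\<^sub>1\<^sup>* * a\<^sub>2\<^sup>* * a\<^sub>3\<^sup>* * a\<^sub>3 * a\<^sub>2 * a\<^sub>1 + a\<^sub>2\<^sup>* * c\<^sub>3^2 * a\<^sub>2 - c\<^sub>0 * c\<^sub>3 * c\<^sub>0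
     + a\<^sub>3 * c\<^sub>2^2 * a\<^sub>3\<^sup>* + a\<^sub>4 * a\<^sub>3 * a\<^sub>2 * a\<^sub>2\<^sup>* * a\<^sub>3\<^sup>* * a\<^sub>4\<^sup>*"

text \<open>The sign of the middle term is forced by centrality: \<open>c\<^sub>0\<^sup>2 = c\<^sub>3\<^sup>3 = (c\<^sub>3 - c\<^sub>0)\<^sup>3 = 0\<close>
  gives \<open>c\<^sub>0c\<^sub>3\<^sup>2c\<^sub>0 = - c\<^sub>0c\<^sub>3c\<^sub>0c\<^sub>3\<close>, so that \<open>a\<^sub>3\<close> commutes with \<open>\<plusminus>c\<^sub>0c\<^sub>3\<^sup>2c\<^sub>0 + a\<^sub>3c\<^sub>0c\<^sub>3c\<^sub>0a\<^sub>3\<^sup>*\<close>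
  only for the sign \<open>-\<close>, unless the characteristic is 2.\<close>

definition z\<^sub>8 :: "'f::field preproj" where
  "z\<^sub>8 = a\<^sub>2\<^sup>* * c\<^sub>0 * c\<^sub>3 * c\<^sub>0 * a\<^sub>2 - c\<^sub>0 * c\<^sub>3^2 * c\<^sub>0 + a\<^sub>3 * c\<^sub>0 * c\<^sub>3 * c\<^sub>0 * a\<^sub>3\<^sup>*"

text \<open>The identification of the centre of \<open>A\<close> with the cohomology in degree 0.\<close>

definition central_class :: "'f::field preproj \<Rightarrow> 'f cochain set" where
  "central_class z = cls 0 (\<lambda>w. if w \<in> W 0 then proj w * z else 0)"

text \<open>The arrows and the \<open>\<sigma> i\<close> are bases of \<open>W 1\<close> and \<open>W 2\<close>, so the cochains below exist
  uniquely provided that each prescribed value has the same source and target as the arrow or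
  relation it is assigned to.\<close>

definition arrow_cochain :: "(arrow \<Rightarrow> 'f::field preproj) \<Rightarrow> 'f cochain" where
  "arrow_cochain \<phi> = (THE f. f \<in> cochains 1 \<and> (\<forall>a. f (arrow_elem a) = \<phi> a))"

definition relation_cochain :: "(vertex \<Rightarrow> 'f::field preproj) \<Rightarrow> 'f cochain" where
  "relation_cochain \<phi> = (THE f. f \<in> cochains 2 \<and> (\<forall>i. f (\<sigma> i) = \<phi> i))"

definition \<zeta> :: "'f::field preproj \<Rightarrow> 'f cochain" where
  "\<zeta> z = arrow_cochain (\<lambda>a. case a of
     A0 \<Rightarrow> a\<^sub>0 * z | A1 \<Rightarrow> a\<^sub>1 * z | A2 \<Rightarrow> a\<^sub>2 * z | A3 \<Rightarrow> a\<^sub>3 * z | A4 \<Rightarrow> a\<^sub>4 * z | _ \<Rightarrow> 0)"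

definition \<rho>\<^sub>3 :: "'f::field cochain" where
  "\<rho>\<^sub>3 = arrow_cochain (\<lambda>a. case a of
     A2 \<Rightarrow> c\<^sub>0 * a\<^sub>2 | A3 \<Rightarrow> a\<^sub>3 * c\<^sub>3 | A2s \<Rightarrow> a\<^sub>2\<^sup>* * c\<^sub>3 | _ \<Rightarrow> 0)"

definition \<rho>\<^sub>5 :: "'f::field cochain" where
  "\<rho>\<^sub>5 = arrow_cochain (\<lambda>a. case a of
     A0 \<Rightarrow> c\<^sub>2 * c\<^sub>3 * a\<^sub>0 | A1 \<Rightarrow> a\<^sub>2\<^sup>* * c\<^sub>0 * a\<^sub>2 * a\<^sub>1 | A2 \<Rightarrow> c\<^sub>2 * c\<^sub>0 * a\<^sub>2
   | A0s \<Rightarrow> - (a\<^sub>0\<^sup>* * c\<^sub>3^2) | A1s \<Rightarrow> - (a\<^sub>1\<^sup>* * a\<^sub>2\<^sup>* * c\<^sub>0 * a\<^sub>2) | A2s \<Rightarrow> a\<^sub>2\<^sup>* * c\<^sub>3^2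
   | _ \<Rightarrow> 0)"

definition h :: "vertex \<Rightarrow> 'f::field cochain" where
  "h j = relation_cochain (\<lambda>i. if i = j then e j else 0)"

definition \<gamma>\<^sub>4 :: "'f::field cochain" where
  "\<gamma>\<^sub>4 = relation_cochain (\<lambda>i. if i = V0 then a\<^sub>0\<^sup>* * c\<^sub>3 * a\<^sub>0 else 0)"

definition \<gamma>\<^sub>6 :: "'f::field cochain" where
  "\<gamma>\<^sub>6 = relation_cochain (\<lambda>i. if i = V0 then a\<^sub>0\<^sup>* * c\<^sub>3^2 * a\<^sub>0 else 0)"

text \<open>Pitfall: in characteristic 2 the class of \<open>\<zeta> z\<^sub>6\<close> is zero, as \<open>\<zeta> z\<^sub>6\<close> is the coboundary
  of the 0-cochain given by \<open>a\<^sub>0\<^sup>*c\<^sub>2\<^sup>2a\<^sub>0 + a\<^sub>1a\<^sub>1\<^sup>*a\<^sub>2\<^sup>*c\<^sub>0a\<^sub>2 + c\<^sub>0c\<^sub>2c\<^sub>0 + c\<^sub>2\<^sup>2c\<^sub>0 + c\<^sub>0c\<^sub>2\<^sup>2 + a\<^sub>3c\<^sub>0c\<^sub>2a\<^sub>3\<^sup>*\<close>.\<close>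

definition HK_basis :: "nat \<Rightarrow> 'f::field cochain set set" where
  "HK_basis p =
    (if p = 0 then central_class ` {z\<^sub>0, z\<^sub>6, z\<^sub>8, \<pi>\<^sub>0, \<pi>\<^sub>3}
     else if p = 1 then
       {cls 1 (\<zeta> z\<^sub>0), cls 1 (\<zeta> z\<^sub>6), cls 1 (\<zeta> z\<^sub>8)} \<union>
       (if CHAR('f) = 2 then {cls 1 \<rho>\<^sub>3} else {}) \<union> (if CHAR('f) = 3 then {cls 1 \<rho>\<^sub>5} else {})
     else if p = 2 then
       range (\<lambda>j. cls 2 (h j)) \<union>
       (if CHAR('f) = 2 then {cls 2 \<gamma>\<^sub>4} else {}) \<union> (if CHAR('f) = 3 then {cls 2 \<gamma>\<^sub>6} else {})
     else {})"

text \<open>The pairs of basis elements, tagged with their degrees, whose products are listed.\<close>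

definition listed :: "((nat \<times> 'f::field cochain set) \<times> (nat \<times> 'f cochain set)) set" where
  "listed =
     {((0, central_class z\<^sub>0), (p, X)) | p X. X \<in> HK_basis p} \<union>
     {((0, central_class z), (1, cls 1 (\<zeta> z\<^sub>0))) | z. z \<in> {z\<^sub>0, z\<^sub>6, z\<^sub>8}} \<union>
     (if CHAR('f) = 3
      then {((0, central_class z\<^sub>6), (2, cls 2 (h i))) | i. i \<in> {V1, V2, V4, V5}} else {}) \<union>
     (if CHAR('f) = 2
      then {((0, central_class z\<^sub>6), (1, cls 1 \<rho>\<^sub>3)), ((1, cls 1 (\<zeta> z\<^sub>0)), (1, cls 1 \<rho>\<^sub>3))}
      else {})"

end

theory Submission
  imports Defs
begin

text \<open>The spaces \<open>W p\<close> vanish for \<open>p \<ge> 3\<close>, and the vertices, arrows and relations are bases of \<open>W 0\<close>, \<open>W 1\<close>, \<open>W 2\<close>.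
  Hence cochains are families of elements of \<open>A\<close>, and vanishing products and the listed identities are
  finite computations in \<open>A\<close>, with explicit primitives of the coboundaries. For two cocycles \<open>f\<close>, \<open>g\<close> of degree 1, \<open>f\<close> extends
  to a derivation \<open>D\<close> of \<open>A\<close>, and \<open>f \<smile> g + g \<smile> f\<close> is the coboundary of \<open>D \<circ> g\<close>.

  Classes are nonzero for the following reasons. The differential of a 1-cochain consists of commutators, so that every
  trace on \<open>A\<close> gives a functional on the cohomology in degree 2. A coboundary of degree 1 induces an inner derivation
  of the 12-dimensional algebra \<open>e\<^sub>3 A e\<^sub>3\<close>, which is excluded by comparing coordinates.\<close>

section \<open>Coefficients of products\<close>

text \<open>Two obstacles shape the development. First, \<open>split_eval\<close> is a description
  over all ways to write an element as a sum of products. In the path algebra a right factor of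
  known length can be split off uniquely, so a basis of the right factor makes the evaluation well
  defined, and differential, product and coboundaries become formulas on families of elements of A.
  Second, reducing words in A proves equalities, never inequalities. Elements are therefore
  separated by linear functionals on the path algebra that vanish on the relation ideal. In degree 1
  a coboundary is given by an element with unknown components at all six vertices. Vertex 3, where
  the three branches meet, is chosen because the components of the module A e3 embed into the one at
  vertex 3, where the unknowns become the coordinates of a single vector. Characteristics 2 and 3
  enter through integral identities: three times \<open>\<gamma>\<^sub>6\<close> is a coboundary
  over the integers, and the equations that would make \<open>\<zeta> z\<^sub>6\<close> a coboundary
  amount to 2 = 0.\<close>

lemma compose_eq_iff:
  assumes "source p = target q" "source r = target m" "path_length q = path_length m"
  shows "compose p q = compose r m \<longleftrightarrow> p = r \<and> q = m"
  using assms
  by transfer (auto simp: walk_end_append split: prod.splits)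

text \<open>A path factors in only one way with a right factor of given length, so homogeneity of
  \<open>v\<close> leaves a single term of the double sum.\<close>

lemma lookup_path_mult:
  assumes "source r = target m" "\<And>q. q \<in> keys v \<Longrightarrow> path_length q = path_length m"
  shows "lookup (u \<star> v) (compose r m) = lookup u r * lookup v m"
proof -
  let ?g = "\<lambda>p q. if source p = target q
     then Poly_Mapping.single (compose p q) (lookup u p * lookup v q) else 0"
  let ?c = "lookup u r * lookup v m"
  have *: "lookup (?g p q) (compose r m) = (if q = m then if p = r then ?c else 0 else 0)"
    if "q \<in> keys v" for p q
  proof (cases "source p = target q")
    case True
    have "(compose p q = compose r m) = (p = r \<and> q = m)"
      by (rule compose_eq_iff[OF True assms(1) assms(2)[OF that]])
    then show ?thesis
      by (cases "p = r \<and> q = m") (use assms(1) in \<open>auto simp: lookup_single when_def True\<close>)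
  next
    case False
    then show ?thesis using assms(1) by auto
  qed
  have "lookup (u \<star> v) (compose r m) = (\<Sum>p\<in>keys u. \<Sum>q\<in>keys v. lookup (?g p q) (compose r m))"
    unfolding path_mult_def lookup_sum ..
  also have "\<dots> = (\<Sum>p\<in>keys u. \<Sum>q\<in>keys v. if q = m then if p = r then ?c else 0 else 0)"
    by (rule sum.cong[OF refl], rule sum.cong[OF refl], rule *)
  also have "\<dots> = (\<Sum>p\<in>keys u. if p = r then ?c else 0)"
    by (rule sum.cong[OF refl], cases "lookup v m = 0") (simp_all add: in_keys_iff)
  also have "\<dots> = ?c"
    by (cases "lookup u r = 0") (simp_all add: in_keys_iff)
  finally show ?thesis .
qed

lemma lookup_mult_vertex:
  "lookup (u \<star> vertex_elem i) p = (if source p = i then lookup u p else 0)"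
proof (induction u rule: path_elem_induct)
  case (single q c)
  then show ?case
    using compose_trivial_right[of q]
    by (auto simp: vertex_elem_def path_mult_single lookup_single when_def)
qed (auto simp: path_mult_add_left lookup_add)

lemma lookup_vertex_mult:
  "lookup (vertex_elem i \<star> u) p = (if target p = i then lookup u p else 0)"
proof (induction u rule: path_elem_induct)
  case (single q c)
  then show ?case
    using compose_trivial_left[of q]
    by (auto simp: vertex_elem_def path_mult_single lookup_single when_def)
qed (auto simp: path_mult_add_right lookup_add)

lemma path_length_0_iff: "path_length p = 0 \<longleftrightarrow> (\<exists>i. p = trivial_path i)"
  by transfer auto

lemma trivial_path_eq_iff [simp]: "trivial_path i = trivial_path j \<longleftrightarrow> i = j"
  by transfer auto

lemma arrow_path_eq_iff [simp]: "arrow_path a = arrow_path b \<longleftrightarrow> a = b"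
  by transfer auto

lemma path_length_1_iff: "path_length p = 1 \<longleftrightarrow> (\<exists>a. p = arrow_path a)"
  by transfer (auto simp: length_Suc_conv)

lemma Rep_Abs_path: "walk i as \<Longrightarrow> Rep_path (Abs_path (i, as)) = (i, as)"
  by (simp add: Abs_path_inverse)

lemma path_split_last:
  assumes "path_length p = Suc n"
  obtains q a where "p = compose q (arrow_path a)" "source q = arrow_target a" "path_length q = n"
proof -
  obtain i as where p: "Rep_path p = (i, as)" by (cases "Rep_path p")
  have w: "walk i as" using Rep_path[of p] p by simp
  obtain bs a where as: "as = bs @ [a]" "length bs = n"
    using assms p by (cases as rule: rev_cases) (auto simp: path_length.rep_eq)
  have rep: "Rep_path (Abs_path (arrow_target a, bs)) = (arrow_target a, bs)"
    using w as by (intro Rep_Abs_path) (auto simp: walk_append)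
  show thesis
    by (rule that[of "Abs_path (arrow_target a, bs)" a])
       (use p w as rep in \<open>auto simp: Rep_path_inject[symmetric] compose.rep_eq arrow_path.rep_eq
          source.rep_eq path_length.rep_eq walk_append\<close>)
qed

lemma path_split:
  assumes "path_length p = m + n"
  obtains q r where "p = compose q r" "source q = target r" "path_length q = m" "path_length r = n"
proof -
  have "\<exists>q r. p = compose q r \<and> source q = target r \<and> path_length q = m \<and> path_length r = n"
    using assms
  proof (induction n arbitrary: p)
    case 0
    then show ?case
      by (intro exI[of _ p] exI[of _ "trivial_path (source p)"]) simp
  next
    case (Suc n)
    then obtain q a where q: "p = compose q (arrow_path a)" "source q = arrow_target a" "path_length q = m + n"
      using path_split_last[of p "m + n"] by auto
    with Suc.IH obtain q' r where "q = compose q' r" "source q' = target r" "path_length q' = m" "path_length r = n"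
      by blast
    with q show ?case
      by (intro exI[of _ q'] exI[of _ "compose r (arrow_path a)"])
         (auto simp: compose_assoc target_compose source_compose path_length_compose)
  qed
  with that show thesis by blast
qed

text \<open>\<open>V_power n\<close> as a condition on coefficients instead of a span; the two are
  identified in \<open>V_power_eq\<close>.\<close>

definition homogeneous :: "nat \<Rightarrow> (path \<Rightarrow>\<^sub>0 'f::field) set" where
  "homogeneous n = {x. \<forall>p. path_length p \<noteq> n \<longrightarrow> lookup x p = 0}"

lemma homogeneousD: "x \<in> homogeneous n \<Longrightarrow> p \<in> keys x \<Longrightarrow> path_length p = n"
  by (auto simp: homogeneous_def in_keys_iff)

lemma subspace_homogeneous: "path_algebra.subspace (homogeneous n)"
  by (rule path_algebra.subspaceI) (auto simp: homogeneous_def lookup_add)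

lemma V_power_eq: "V_power n = (homogeneous n :: (path \<Rightarrow>\<^sub>0 'a::field) set)"
proof
  show "V_power n \<subseteq> (homogeneous n :: (path \<Rightarrow>\<^sub>0 'a) set)"
    unfolding V_power_def
    by (intro path_algebra.span_minimal subspace_homogeneous)
       (auto simp: homogeneous_def lookup_single when_def)
next
  show "homogeneous n \<subseteq> (V_power n :: (path \<Rightarrow>\<^sub>0 'a) set)"
  proof
    fix x :: "path \<Rightarrow>\<^sub>0 'a" assume x: "x \<in> homogeneous n"
    have "(\<Sum>p\<in>keys x. Poly_Mapping.single p (lookup x p)) \<in> V_power n"
      unfolding V_power_def
    proof (rule path_algebra.span_sum)
      fix p assume p: "p \<in> keys x"
      have "Poly_Mapping.single p (lookup x p) = scale (lookup x p) (Poly_Mapping.single p 1)"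
        by (simp add: scale_single)
      then show "Poly_Mapping.single p (lookup x p)
          \<in> path_algebra.span {Poly_Mapping.single p 1 |p. path_length p = n}"
        using homogeneousD[OF x p] by (auto intro: path_algebra.span_scale path_algebra.span_base)
    qed
    then show "x \<in> V_power n" using path_elem_expand[of x] by simp
  qed
qed

lemma homogeneous_mult:
  assumes "x \<in> homogeneous m" "y \<in> homogeneous n"
  shows "x \<star> y \<in> homogeneous (m + n)"
  unfolding path_mult_def
proof (intro path_algebra.subspace_sum[OF subspace_homogeneous])
  fix p q assume "p \<in> keys x" "q \<in> keys y"
  then show "(if source p = target q
      then Poly_Mapping.single (compose p q) (lookup x p * lookup y q) else 0) \<in> homogeneous (m + n)"
    using assms by (auto simp: homogeneous_def lookup_single when_def path_length_compose in_keys_iff)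
qed

lemma arrow_elem_homogeneous: "arrow_elem a \<in> homogeneous 1"
  by (auto simp: homogeneous_def arrow_elem_def lookup_single when_def)

lemma vertex_elem_homogeneous: "vertex_elem a \<in> homogeneous 0"
  by (auto simp: homogeneous_def vertex_elem_def lookup_single when_def)

lemma sigma_homogeneous: "\<sigma> i \<in> homogeneous 2"
proof -
  have "arrow_elem a \<star> arrow_elem b \<in> homogeneous 2" for a b
    using homogeneous_mult[OF arrow_elem_homogeneous arrow_elem_homogeneous] by (simp add: numeral_2_eq_2)
  then show ?thesis
    using subspace_homogeneous[of 2]
    by (cases i) (auto intro!: path_algebra.subspace_add path_algebra.subspace_diff path_algebra.subspace_neg)
qed

section \<open>Koszul spaces\<close>

fun bar :: "arrow \<Rightarrow> arrow" where
  "bar A0 = A0s" | "bar A1 = A1s" | "bar A2 = A2s" | "bar A3 = A3s" | "bar A4 = A4s"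
| "bar A0s = A0" | "bar A1s = A1" | "bar A2s = A2" | "bar A3s = A3" | "bar A4s = A4"

fun starred :: "arrow \<Rightarrow> bool" where
  "starred A0s = True" | "starred A1s = True" | "starred A2s = True" | "starred A3s = True" | "starred A4s = True"
| "starred _ = False"

lemma source_bar [simp]: "arrow_source (bar a) = arrow_target a"
  and target_bar [simp]: "arrow_target (bar a) = arrow_source a"
  and bar_bar [simp]: "bar (bar a) = a"
  by (cases a; simp)+

definition two_path :: "arrow \<Rightarrow> arrow \<Rightarrow> path" where
  "two_path x y = compose (arrow_path x) (arrow_path y)"

text \<open>The sign with which the product of \<open>x\<close> and its reverse enters the relation
  at the target of \<open>x\<close>. It turns the six relations into the single formula
  \<open>sigma_eq\<close>.\<close>

definition sgn_arrow :: "arrow \<Rightarrow> 'f::field" where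
  "sgn_arrow x = (if starred x then -1 else 1)"

lemma sgn_arrow_square [simp]: "sgn_arrow x * sgn_arrow x = 1"
  and sgn_arrow_nonzero [simp]: "sgn_arrow x \<noteq> 0"
  by (auto simp: sgn_arrow_def)

lemma arrow_mult:
  "arrow_elem x \<star> arrow_elem y =
    (if arrow_source x = arrow_target y then Poly_Mapping.single (two_path x y) 1 else 0)"
  by (auto simp: arrow_elem_def path_mult_single two_path_def)

lemma two_path_eq_iff:
  assumes "arrow_source x = arrow_target y" "arrow_source x' = arrow_target y'"
  shows "two_path x y = two_path x' y' \<longleftrightarrow> x = x' \<and> y = y'"
  unfolding two_path_def using compose_eq_iff[of "arrow_path x" "arrow_path y" "arrow_path x'" "arrow_path y'"] assms
  by auto

lemma path_length_2:
  assumes "path_length p = 2"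
  obtains x y where "p = two_path x y" "arrow_source x = arrow_target y"
proof -
  obtain q a where q: "p = compose q (arrow_path a)" "source q = arrow_target a" "path_length q = 1"
    using path_split_last[of p 1] assms by (metis Suc_1)
  then obtain b where "q = arrow_path b" using path_length_1_iff by blast
  with q that[of b a] show thesis by (simp add: two_path_def)
qed

lemma target_two_path: "arrow_source x = arrow_target y \<Longrightarrow> target (two_path x y) = arrow_target x"
  and source_two_path: "arrow_source x = arrow_target y \<Longrightarrow> source (two_path x y) = arrow_source y"
  and length_two_path: "arrow_source x = arrow_target y \<Longrightarrow> path_length (two_path x y) = 2"
  by (simp_all add: two_path_def target_compose source_compose path_length_compose)

lemma arrow_UNIV: "UNIV = {A0, A1, A2, A3, A4, A0s, A1s, A2s, A3s, A4s}"
  using arrow.exhaust by blast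

instance arrow :: finite
  by standard (simp add: arrow_UNIV)

lemma sigma_eq:
  "\<sigma> i = (\<Sum>x | arrow_target x = i. scale (sgn_arrow x) (arrow_elem x \<star> arrow_elem (bar x)))"
proof -
  have "(\<Sum>x | arrow_target x = i. scale (sgn_arrow x) (arrow_elem x \<star> arrow_elem (bar x)))
     = (\<Sum>x\<in>UNIV. if arrow_target x = i then scale (sgn_arrow x) (arrow_elem x \<star> arrow_elem (bar x)) else 0)"
    by (simp add: sum.If_cases)
  also have "\<dots> = \<sigma> i"
    by (cases i) (simp_all add: arrow_UNIV sgn_arrow_def)
  finally show ?thesis by (rule sym)
qed

section \<open>Coefficient equations satisfied by the relations\<close>

lemma lookup_sigma:
  assumes "arrow_source x = arrow_target y"
  shows "lookup (\<sigma> i) (two_path x y) = (if y = bar x \<and> arrow_target x = i then sgn_arrow x else 0)"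
proof -
  have "lookup (\<sigma> i) (two_path x y) =
      (\<Sum>z | arrow_target z = i. if z = x then if y = bar x then sgn_arrow x else 0 else 0)"
    unfolding sigma_eq lookup_sum
    by (intro sum.cong refl)
       (auto simp: arrow_mult lookup_single when_def two_path_eq_iff assms)
  also have "\<dots> = (if y = bar x \<and> arrow_target x = i then sgn_arrow x else 0)"
    by (subst sum.delta) auto
  finally show ?thesis .
qed

text \<open>Both conditions are linear and hold for each \<open>\<sigma> i\<close>: only products of
  an arrow with its reverse occur, and those with a common target occur in one relation, with
  coefficients \<open>sgn_arrow\<close>.\<close>

lemma R_space_coeff:
  assumes "r \<in> R_space" "arrow_source x = arrow_target y"
  shows "y \<noteq> bar x \<Longrightarrow> lookup r (two_path x y) = 0"
    and "arrow_target x = arrow_target x' \<Longrightarrow>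
      sgn_arrow x * lookup r (two_path x (bar x)) = sgn_arrow x' * lookup r (two_path x' (bar x'))"
proof -
  have "(y \<noteq> bar x \<longrightarrow> lookup r (two_path x y) = 0) \<and>
      (arrow_target x = arrow_target x' \<longrightarrow>
      sgn_arrow x * lookup r (two_path x (bar x)) = sgn_arrow x' * lookup r (two_path x' (bar x')))"
    using assms(1) unfolding R_space_def
  proof (induction rule: path_algebra.span_induct_alt)
    case (step c s w)
    then obtain i where "s = \<sigma> i" by blast
    with step.IH show ?case by (auto simp: lookup_sigma assms(2) lookup_add distrib_left)
  qed simp
  then show "y \<noteq> bar x \<Longrightarrow> lookup r (two_path x y) = 0"
    and "arrow_target x = arrow_target x' \<Longrightarrow>
      sgn_arrow x * lookup r (two_path x (bar x)) = sgn_arrow x' * lookup r (two_path x' (bar x'))"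
    by auto
qed

lemma R_space_homogeneous: "R_space \<subseteq> homogeneous 2"
  unfolding R_space_def
  by (intro path_algebra.span_minimal subspace_homogeneous) (auto intro: sigma_homogeneous)

lemma lookup_urv:
  assumes "u \<in> V_power i" "r \<in> R_space" "v \<in> V_power j"
    "source p = arrow_target x" "arrow_source x = arrow_target y" "arrow_source y = target q"
    "path_length q = j"
  shows "lookup (u \<star> r \<star> v) (compose p (compose (two_path x y) q))
    = lookup u p * lookup r (two_path x y) * lookup v q"
proof -
  have v: "path_length q' = path_length q" if "q' \<in> keys v" for q'
    using homogeneousD[OF _ that] assms(3,7) by (simp only: V_power_eq)
  have r: "path_length q' = path_length (two_path x y)" if "q' \<in> keys r" for q'
    using homogeneousD[OF _ that] assms(2) R_space_homogeneous length_two_path[OF assms(5)] by auto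
  have p: "source p = target (two_path x y)" and q: "source (two_path x y) = target q"
    using target_two_path[OF assms(5)] source_two_path[OF assms(5)] assms(4,6) by simp_all
  have pq: "source (compose p (two_path x y)) = target q"
    using source_compose[OF p] q by simp
  have "lookup (u \<star> r \<star> v) (compose (compose p (two_path x y)) q)
      = lookup (u \<star> r) (compose p (two_path x y)) * lookup v q"
    by (rule lookup_path_mult[OF pq]) (rule v)
  also have "lookup (u \<star> r) (compose p (two_path x y)) = lookup u p * lookup r (two_path x y)"
    by (rule lookup_path_mult[OF p]) (rule r)
  finally show ?thesis unfolding compose_assoc[OF p q] .
qed

text \<open>By \<open>lookup_urv\<close> the coefficient of \<open>u \<star> r \<star> v\<close> is
  that of \<open>r\<close> times factors that depend on \<open>p\<close> and \<open>q\<close> only.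
  Hence the equations for \<open>R_space\<close> persist between any outer paths, and they pass to
  the span.\<close>

lemma VRV_coeff:
  assumes w: "w \<in> path_algebra.span {u \<star> r \<star> v | u r v. u \<in> V_power i \<and> r \<in> R_space \<and> v \<in> V_power j}"
    and len: "path_length q = j" and p: "source p = arrow_target x"
  shows "arrow_source x = arrow_target y \<Longrightarrow> arrow_source y = target q \<Longrightarrow> y \<noteq> bar x \<Longrightarrow>
      lookup w (compose p (compose (two_path x y) q)) = 0"
    and "arrow_target x' = arrow_target x \<Longrightarrow> target q = arrow_target x \<Longrightarrow>
      sgn_arrow x * lookup w (compose p (compose (two_path x (bar x)) q)) =
      sgn_arrow x' * lookup w (compose p (compose (two_path x' (bar x')) q))"
proof -
  show "lookup w (compose p (compose (two_path x y) q)) = 0"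
    if *: "arrow_source x = arrow_target y" "arrow_source y = target q" "y \<noteq> bar x"
    using w
  proof (induction rule: path_algebra.span_induct_alt)
    case (step c s w')
    then obtain u r v where s: "s = u \<star> r \<star> v" "u \<in> V_power i" "r \<in> R_space" "v \<in> V_power j" by blast
    have "lookup s (compose p (compose (two_path x y) q)) = 0"
      unfolding s(1) lookup_urv[OF s(2-4) p *(1,2) len] R_space_coeff(1)[OF s(3) *(1,3)] by simp
    with step.IH show ?case by (simp only: lookup_add lookup_scale) simp
  qed simp
  show "sgn_arrow x * lookup w (compose p (compose (two_path x (bar x)) q)) =
      sgn_arrow x' * lookup w (compose p (compose (two_path x' (bar x')) q))"
    if *: "arrow_target x' = arrow_target x" "target q = arrow_target x"
    using w
  proof (induction rule: path_algebra.span_induct_alt)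
    case (step c s w')
    then obtain u r v where s: "s = u \<star> r \<star> v" "u \<in> V_power i" "r \<in> R_space" "v \<in> V_power j" by blast
    then have "lookup s (compose p (compose (two_path x (bar x)) q)) =
        lookup u p * lookup r (two_path x (bar x)) * lookup v q"
      and "lookup s (compose p (compose (two_path x' (bar x')) q)) =
        lookup u p * lookup r (two_path x' (bar x')) * lookup v q"
      unfolding s(1)
      using lookup_urv[OF s(2-4) p, of "bar x" q] lookup_urv[OF s(2-4), of p x' "bar x'" q] * len p
      by (simp_all only: source_bar target_bar refl simp_thms)
    moreover have "sgn_arrow x * lookup r (two_path x (bar x)) = sgn_arrow x' * lookup r (two_path x' (bar x'))"
      using R_space_coeff(2)[OF s(3), of x "bar x" x'] * by simp
    moreover have "sgn_arrow x * (lookup u p * lookup r (two_path x (bar x)) * lookup v q) =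
        lookup u p * (sgn_arrow x * lookup r (two_path x (bar x))) * lookup v q" for x
      by (simp only: ac_simps)
    ultimately have "sgn_arrow x * lookup s (compose p (compose (two_path x (bar x)) q)) =
      sgn_arrow x' * lookup s (compose p (compose (two_path x' (bar x')) q))"
      by (simp only:)
    moreover have "sgn_arrow x * (c * l + l') = c * (sgn_arrow x * l) + sgn_arrow x * l'" for x l l'
      by (simp add: distrib_left mult.left_commute)
    ultimately show ?case
      using step.IH by (simp only: lookup_add lookup_scale)
  qed simp
qed

section \<open>The spaces \<open>W p\<close> degree by degree\<close>

lemma W_homogeneous: "W p \<subseteq> homogeneous p"
proof (cases "p < 2")
  case True
  then show ?thesis by (simp add: W_def V_power_eq)
next
  case False
  then have p: "p = 0 + 2 + (p - 2)" by simp
  have "path_algebra.span {u \<star> r \<star> v | u r v. u \<in> V_power 0 \<and> r \<in> R_space \<and> v \<in> V_power (p - 2)}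
    \<subseteq> (homogeneous p :: (path \<Rightarrow>\<^sub>0 'a) set)"
  proof (intro path_algebra.span_minimal subspace_homogeneous subsetI)
    fix x :: "path \<Rightarrow>\<^sub>0 'a"
    assume "x \<in> {u \<star> r \<star> v | u r v. u \<in> V_power 0 \<and> r \<in> R_space \<and> v \<in> V_power (p - 2)}"
    then obtain u r v where x: "x = u \<star> r \<star> v" "u \<in> homogeneous 0" "r \<in> homogeneous 2" "v \<in> homogeneous (p - 2)"
      using R_space_homogeneous by (auto simp: V_power_eq)
    have "x \<in> homogeneous (0 + 2 + (p - 2))"
      unfolding x(1) by (intro homogeneous_mult x)
    then show "x \<in> homogeneous p" using p by simp
  qed
  then show ?thesis using False p unfolding W_def by fastforce
qed

text \<open>The nonzero coefficients of an element of \<open>W p\<close> belong to paths that begin with \<open>z z\<^sup>* z\<close> for an arrow \<open>z\<close>.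
  One end of \<open>z\<close> meets a further arrow, and the relation at this end equates the coefficient, up to sign, with
  one of a path of a different shape.\<close>

lemma W_ge_3:
  assumes "p \<ge> 3" shows "W p = {0 :: path \<Rightarrow>\<^sub>0 'f::field}"
proof
  show "W p \<subseteq> {0 :: path \<Rightarrow>\<^sub>0 'f}"
  proof
    fix w :: "path \<Rightarrow>\<^sub>0 'f" assume w: "w \<in> W p"
    \<comment> \<open>Relations at the first and at the second position suffice. They only involve
      the first three arrows of a path; the rest \<open>R\<close> is carried along.\<close>
    have w0: "w \<in> path_algebra.span {u \<star> r \<star> v | u r v. u \<in> V_power 0 \<and> r \<in> R_space \<and> v \<in> V_power (p - 2)}"
      and w1: "w \<in> path_algebra.span {u \<star> r \<star> v | u r v. u \<in> V_power 1 \<and> r \<in> R_space \<and> v \<in> V_power (p - 3)}"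
      using w assms unfolding W_def by (auto dest: spec[of _ 0] spec[of _ 1])
    have "lookup w P = 0" for P
    proof (cases "path_length P = p")
      case False
      then show ?thesis using w W_homogeneous[of p] by (auto simp: homogeneous_def)
    next
      case True
      then obtain P' R where R: "P = compose P' R" "source P' = target R" "path_length P' = 3" "path_length R = p - 3"
        using path_split[of P 3 "p - 3"] assms by auto
      obtain P'' x3 where P'': "P' = compose P'' (arrow_path x3)" "source P'' = arrow_target x3" "path_length P'' = 2"
        using path_split_last[of P' 2] R(3) by (auto simp: numeral_3_eq_3 numeral_2_eq_2)
      obtain x1 x2 where x: "P'' = two_path x1 x2" "arrow_source x1 = arrow_target x2"
        using path_length_2 P''(3) by blast
      have s: "arrow_source x2 = arrow_target x3" "arrow_source x3 = target R"
        using P'' x R by (auto simp: source_two_path source_compose)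
      have right: "compose (two_path x y) (compose (arrow_path z) R) = compose (arrow_path x) (compose (two_path y z) R)"
        if "arrow_source x = arrow_target y" "arrow_source y = arrow_target z" "arrow_source z = target R" for x y z
        using that unfolding two_path_def
        by (simp add: compose_assoc target_compose source_compose)
      \<comment> \<open>\<open>VRV_coeff\<close> asks for a path on the left of the relation; at the
        first position it is a trivial one.\<close>
      have triv: "compose (trivial_path (arrow_target x)) (compose (two_path x y) (compose (arrow_path z) R))
          = compose (two_path x y) (compose (arrow_path z) R)"
        if "arrow_source x = arrow_target y" "arrow_source y = arrow_target z" "arrow_source z = target R" for x y z
        using that compose_trivial_left[of "compose (two_path x y) (compose (arrow_path z) R)"]
        by (simp add: target_compose target_two_path source_two_path)
      have tl: "path_length (compose (arrow_path z) R) = p - 2" if "arrow_source z = target R" for z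
        using that R assms by (simp add: path_length_compose)
      have c0a: "lookup w (compose (two_path x y) (compose (arrow_path z) R)) = 0"
        if "arrow_source x = arrow_target y" "arrow_source y = arrow_target z" "arrow_source z = target R"
          "y \<noteq> bar x" for x y z
        using VRV_coeff(1)[OF w0 tl[OF that(3)], of "trivial_path (arrow_target x)" x y] that
        by (simp add: target_compose triv)
      have c0b: "sgn_arrow x * lookup w (compose (two_path x (bar x)) (compose (arrow_path z) R)) =
          sgn_arrow x' * lookup w (compose (two_path x' (bar x')) (compose (arrow_path z) R))"
        if "arrow_target x = arrow_target z" "arrow_target x' = arrow_target z" "arrow_source z = target R" for x x' z
        using VRV_coeff(2)[OF w0 tl[OF that(3)], of "trivial_path (arrow_target x)" x x'] that
          triv[of x "bar x" z] triv[of x' "bar x'" z]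
        by (simp only: source_bar target_bar source_trivial target_compose target_arrow source_arrow refl simp_thms)
      have c1a: "lookup w (compose (two_path z x) (compose (arrow_path y) R)) = 0"
        if "arrow_source z = arrow_target x" "arrow_source x = arrow_target y" "arrow_source y = target R"
          "y \<noteq> bar x" for x y z
        using VRV_coeff(1)[OF w1 R(4), of "arrow_path z" x y] that right[OF that(1,2,3)] by simp
      have c1b: "sgn_arrow x * lookup w (compose (two_path z x) (compose (arrow_path (bar x)) R)) =
          sgn_arrow x' * lookup w (compose (two_path z x') (compose (arrow_path (bar x')) R))"
        if "arrow_source z = arrow_target x" "arrow_target x' = arrow_target x" "arrow_target x = target R" for x x' z
      proof -
        have right_x: "compose (two_path z y) (compose (arrow_path (bar y)) R) =
            compose (arrow_path z) (compose (two_path y (bar y)) R)" if "arrow_target y = arrow_target x" for y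
          by (rule right) (use \<open>arrow_source z = arrow_target x\<close> \<open>arrow_target x = target R\<close> that in simp_all)
        show ?thesis
          unfolding right_x[OF refl] right_x[OF that(2)]
          by (rule VRV_coeff(2)[OF w1 R(4)]) (use that in simp_all)
      qed
      have P: "P = compose (two_path x1 x2) (compose (arrow_path x3) R)"
        unfolding R(1) P''(1) x(1) by (rule compose_assoc) (use x s in \<open>simp_all add: source_two_path\<close>)
      show ?thesis
      proof (cases "x2 = bar x1 \<and> x3 = bar x2")
        case False
        then show ?thesis using c0a[OF x(2) s] c1a[OF x(2) s] unfolding P by blast
      next
        case True
        then have x2: "x2 = bar x1" "x3 = x1" by auto
        have tR: "arrow_source x1 = target R" using s x2 by simp
        show ?thesis
        proof (cases "\<exists>y. y \<noteq> x1 \<and> arrow_target y = arrow_target x1")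
          case True
          then obtain y where y: "y \<noteq> x1" "arrow_target y = arrow_target x1" by blast
          then have "sgn_arrow x1 * lookup w P = 0"
            using c0b[OF refl _ tR, of y] c1a[of y "bar y" x1] tR unfolding P x2 by simp
          then show ?thesis by simp
        next
          case False
          \<comment> \<open>No edge of E6 is isolated: an arrow that is alone at its target has
            company at its source.\<close>
          then have "\<exists>y. y \<noteq> bar x1 \<and> arrow_target y = arrow_source x1"
            by (cases x1) (auto intro: exI[of _ A0] exI[of _ A1] exI[of _ A2] exI[of _ A3] exI[of _ A4]
                exI[of _ A0s] exI[of _ A1s] exI[of _ A2s] exI[of _ A3s] exI[of _ A4s])
          then obtain y where y: "y \<noteq> bar x1" "arrow_target y = arrow_source x1" by blast
          then have "sgn_arrow x2 * lookup w P = 0"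
            using c1b[of x1 "bar x1" y] c0a[of x1 y "bar y"] tR unfolding P x2 by simp
          then show ?thesis by simp
        qed
      qed
    qed
    then show "w \<in> {0}" by (simp add: poly_mapping_eqI)
  qed
  show "{0} \<subseteq> W p" using assms by (simp add: W_def path_algebra.span_zero)
qed

lemma scale_eq_mult: "scale c x = scale c path_one \<star> x"
  by (simp add: path_mult_scale_left path_one_left)

lemma vertex_mult_sigma: "vertex_elem i \<star> \<sigma> j = (if i = j then \<sigma> j else 0)"
  and sigma_mult_vertex: "\<sigma> j \<star> vertex_elem i = (if i = j then \<sigma> j else 0)"
proof -
  have *: "lookup (\<sigma> j) p = 0" if "source p \<noteq> j \<or> target p \<noteq> j" for p
  proof (cases "path_length p = 2")
    case True
    then obtain x y where "p = two_path x y" "arrow_source x = arrow_target y" by (rule path_length_2)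
    with that show ?thesis by (auto simp: lookup_sigma source_two_path target_two_path)
  next
    case False
    then show ?thesis using sigma_homogeneous by (auto simp: homogeneous_def)
  qed
  show "vertex_elem i \<star> \<sigma> j = (if i = j then \<sigma> j else 0)"
    and "\<sigma> j \<star> vertex_elem i = (if i = j then \<sigma> j else 0)"
    by (auto intro!: poly_mapping_eqI simp: lookup_vertex_mult lookup_mult_vertex *)
qed

lemma V_power_0_expand: "u \<in> V_power 0 \<Longrightarrow> u = (\<Sum>i\<in>UNIV. scale (lookup u (trivial_path i)) (vertex_elem i))"
proof (rule poly_mapping_eqI)
  fix p assume "u \<in> V_power 0"
  then have *: "lookup u p \<noteq> 0 \<Longrightarrow> path_length p = 0"
    by (auto simp: V_power_eq homogeneous_def)
  show "lookup u p = lookup (\<Sum>i\<in>UNIV. scale (lookup u (trivial_path i)) (vertex_elem i)) p"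
  proof (cases "path_length p = 0")
    case True
    then obtain j where "p = trivial_path j" using path_length_0_iff by blast
    then show ?thesis
      by (simp add: lookup_sum vertex_elem_def lookup_single when_def if_distrib cong: if_cong)
  next
    case False
    then have "trivial_path i \<noteq> p" for i by auto
    with False * show ?thesis
      by (auto simp: lookup_sum vertex_elem_def lookup_single when_def)
  qed
qed

text \<open>The only position of a relation has empty outer parts, and multiplying by elements of k
  preserves R because each relation starts and ends at one vertex.\<close>

lemma W_2: "W 2 = R_space"
proof
  show "R_space \<subseteq> (W 2 :: (path \<Rightarrow>\<^sub>0 'a) set)"
  proof
    fix r :: "path \<Rightarrow>\<^sub>0 'a" assume r: "r \<in> R_space"
    have "path_one \<in> (V_power 0 :: (path \<Rightarrow>\<^sub>0 'a) set)"
      unfolding V_power_eq path_one_def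
      by (intro path_algebra.subspace_sum subspace_homogeneous vertex_elem_homogeneous)
    then have "path_one \<star> r \<star> path_one
        \<in> {u \<star> r \<star> v | u r v. u \<in> V_power 0 \<and> r \<in> R_space \<and> v \<in> V_power 0}"
      using r by blast
    then have "r \<in> path_algebra.span {u \<star> r \<star> v | u r v. u \<in> V_power 0 \<and> r \<in> R_space \<and> v \<in> V_power 0}"
      by (intro path_algebra.span_base) (simp add: path_one_left path_one_right)
    then show "r \<in> W 2" by (simp add: W_def)
  qed
  have "{u \<star> r \<star> v | u r v. u \<in> V_power 0 \<and> r \<in> R_space \<and> v \<in> V_power 0} \<subseteq> (R_space :: (path \<Rightarrow>\<^sub>0 'a) set)"
  proof clarify
    fix u r v :: "path \<Rightarrow>\<^sub>0 'a" assume u: "u \<in> V_power 0" and r: "r \<in> R_space" and v: "v \<in> V_power 0"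
    have "\<sigma> i \<in> path_algebra.span (range \<sigma>)" for i :: vertex
      by (rule path_algebra.span_base) simp
    then have "u \<star> \<sigma> i \<star> v \<in> R_space" for i
      by (subst V_power_0_expand[OF u], subst V_power_0_expand[OF v])
         (auto simp: path_mult_sum_left path_mult_sum_right path_mult_scale_left path_mult_scale_right
           vertex_mult_sigma sigma_mult_vertex R_space_def
           intro!: path_algebra.span_sum path_algebra.span_scale path_algebra.span_zero)
    with r show "u \<star> r \<star> v \<in> R_space"
      unfolding R_space_def
    proof (induction rule: path_algebra.span_induct_alt)
      case (step c s y)
      then obtain i where "s = \<sigma> i" by blast
      with step show ?case
        by (simp add: path_mult_add_left path_mult_add_right path_mult_scale_left path_mult_scale_right
            path_algebra.span_add path_algebra.span_scale)
    qed (simp add: path_algebra.span_zero)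
  qed
  moreover have "path_algebra.subspace (R_space :: (path \<Rightarrow>\<^sub>0 'a) set)"
    unfolding R_space_def by (rule path_algebra.subspace_span)
  ultimately have "path_algebra.span {u \<star> r \<star> v | u r v. u \<in> V_power 0 \<and> r \<in> R_space \<and> v \<in> V_power 0}
      \<subseteq> (R_space :: (path \<Rightarrow>\<^sub>0 'a) set)"
    by (rule path_algebra.span_minimal)
  moreover have "w \<in> path_algebra.span {u \<star> r \<star> v | u r v. u \<in> V_power 0 \<and> r \<in> R_space \<and> v \<in> V_power 0}"
    if "w \<in> W 2" for w :: "path \<Rightarrow>\<^sub>0 'a"
  proof -
    have "\<forall>i j. i + 2 + j = 2 \<longrightarrow> w \<in> path_algebra.span {u \<star> r \<star> v | u r v. u \<in> V_power i \<and> r \<in> R_space \<and> v \<in> V_power j}"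
      using that by (simp add: W_def)
    from this[rule_format, of 0 0] show ?thesis by simp
  qed
  ultimately show "W 2 \<subseteq> (R_space :: (path \<Rightarrow>\<^sub>0 'a) set)" by blast
qed

lemma subspace_W: "path_algebra.subspace (W p)"
  by (rule path_algebra.subspaceI)
     (auto simp: W_def V_power_def intro: path_algebra.span_zero path_algebra.span_add path_algebra.span_scale)

lemma W_lt_2: "p < 2 \<Longrightarrow> W p = homogeneous p"
  by (simp add: W_def V_power_eq)

text \<open>In every position of the relation the outer factors absorb \<open>l\<close> and
  \<open>l'\<close>.\<close>

lemma W_mult:
  assumes "l \<in> W 0" "w \<in> W p" "l' \<in> W 0"
  shows "l \<star> w \<star> l' \<in> W p"
proof (cases "p < 2")
  case True
  then show ?thesis
    using homogeneous_mult[OF homogeneous_mult, of l 0 w p l' 0] assms by (simp add: W_lt_2)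
next
  case False
  have "l \<star> w \<star> l' \<in> path_algebra.span {u \<star> r \<star> v | u r v. u \<in> V_power i \<and> r \<in> R_space \<and> v \<in> V_power j}"
    if "i + 2 + j = p" for i j
  proof -
    have "w \<in> path_algebra.span {u \<star> r \<star> v | u r v. u \<in> V_power i \<and> r \<in> R_space \<and> v \<in> V_power j}"
      using assms(2) that False by (auto simp: W_def)
    then show ?thesis
    proof (induction rule: path_algebra.span_induct_alt)
      case base
      show ?case by (simp add: path_algebra.span_zero)
    next
      case (step c x y)
      then obtain u r v where x: "x = u \<star> r \<star> v" "u \<in> V_power i" "r \<in> R_space" "v \<in> V_power j" by blast
      have "l \<star> u \<in> V_power i" "v \<star> l' \<in> V_power j"
        using homogeneous_mult[of l 0 u i] homogeneous_mult[of v j l' 0] assms x by (simp_all add: W_lt_2 V_power_eq)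
      moreover have "l \<star> x \<star> l' = (l \<star> u) \<star> r \<star> (v \<star> l')"
        by (simp add: x(1) path_mult_assoc)
      ultimately have "l \<star> x \<star> l' \<in> {u \<star> r \<star> v | u r v. u \<in> V_power i \<and> r \<in> R_space \<and> v \<in> V_power j}"
        using x(3) by blast
      with step.IH show ?case
        by (simp add: path_mult_add_left path_mult_add_right path_mult_scale_left path_mult_scale_right
            path_algebra.span_add path_algebra.span_scale path_algebra.span_base)
    qed
  qed
  then show ?thesis using False by (simp add: W_def)
qed

lemma path_one_W: "path_one \<in> W 0"
  unfolding W_lt_2[of 0, simplified] path_one_def
  by (intro path_algebra.subspace_sum subspace_homogeneous vertex_elem_homogeneous)

lemma scale_path_one_W: "scale c path_one \<in> W 0"
  by (intro path_algebra.subspace_scale subspace_W path_one_W)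

lemma vertex_elem_W: "vertex_elem i \<in> W 0"
  by (simp add: W_lt_2 vertex_elem_homogeneous)

lemma arrow_elem_W: "arrow_elem a \<in> W 1"
  using arrow_elem_homogeneous by (simp add: W_lt_2)

lemma W_mult_right: "l \<in> W 0 \<Longrightarrow> w \<in> W p \<Longrightarrow> w \<star> l \<in> W p"
  using W_mult[of path_one w p l] path_one_W by (simp add: path_one_left)

section \<open>The projection onto the preprojective algebra\<close>

lemma proj_0 [simp]: "proj 0 = 0"
  and proj_one [simp]: "proj path_one = 1"
  and proj_add: "proj (x + y) = proj x + proj y"
  and proj_diff: "proj (x - y) = proj x - proj y"
  and proj_minus: "proj (- x) = - proj x"
  and proj_mult: "proj (x \<star> y) = proj x * proj y"
  by (simp_all add: proj_def zero_preproj.abs_eq one_preproj.abs_eq plus_preproj.abs_eq minus_preproj.abs_eq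
      uminus_preproj.abs_eq times_preproj.abs_eq)

lemma proj_sum: "proj (sum f S) = (\<Sum>i\<in>S. proj (f i))"
  by (induction S rule: infinite_finite_induct) (auto simp: proj_add)

lemma proj_surj: obtains y where "x = proj y"
  using that by (induction x) (auto simp: proj_def)

lemma proj_eq_iff: "proj x = proj y \<longleftrightarrow> x - y \<in> relation_ideal"
  by (simp add: proj_def preproj.abs_eq_iff relation_cong_def)

text \<open>The action of the field on A is encoded as multiplication by central elements, so that
  linear algebra in A stays inside the ring language.\<close>

definition scalar :: "'f::field \<Rightarrow> 'f preproj" where
  "scalar c = proj (scale c path_one)"

lemma proj_scale: "proj (scale c x) = scalar c * proj x"
  unfolding scalar_def by (subst scale_eq_mult) (rule proj_mult)

lemma scalar_commute: "x * scalar c = scalar c * x"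
proof -
  obtain y where y: "x = proj y" by (rule proj_surj)
  have "y \<star> scale c path_one = scale c path_one \<star> y"
    by (simp add: path_mult_scale_left path_mult_scale_right path_one_left path_one_right)
  then show ?thesis unfolding scalar_def y by (metis proj_mult)
qed

lemma scalar_left_commute: "x * (scalar c * y) = scalar c * (x * y)"
  by (metis mult.assoc scalar_commute)

lemma scalar_0 [simp]: "scalar 0 = 0"
  and scalar_1 [simp]: "scalar 1 = 1"
  and scalar_add: "scalar (c + d) = scalar c + scalar d"
  and scalar_minus: "scalar (- c) = - scalar c"
  and scalar_mult: "scalar (c * d) = scalar c * scalar d"
proof -
  show "scalar (c * d) = scalar c * scalar d"
    unfolding scalar_def proj_mult[symmetric]
    by (simp add: path_mult_scale_left path_one_left)
qed (simp_all add: scalar_def path_algebra.scale_left_distrib proj_add proj_minus)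

lemma sigma_in_relation_ideal: "\<sigma> i \<in> relation_ideal"
proof -
  have "path_one \<star> \<sigma> i \<star> path_one \<in> {u \<star> r \<star> v | u r v. r \<in> R_space}"
    unfolding R_space_def using path_algebra.span_base[of "\<sigma> i" "range \<sigma>"] by blast
  then show ?thesis
    unfolding relation_ideal_def
    by (intro path_algebra.span_base) (simp add: path_one_left path_one_right)
qed

lemma proj_sigma: "proj (\<sigma> i) = 0"
proof -
  have "proj (\<sigma> i) = proj 0"
    unfolding proj_eq_iff by (simp add: sigma_in_relation_ideal)
  then show ?thesis by simp
qed

lemma sum_scale_mult: "(\<Sum>x\<leftarrow>xs. c * f x) = c * (\<Sum>x\<leftarrow>xs. f x)" for c :: "'f::field"
  by (induction xs) (auto simp: distrib_left)

section \<open>Bimodule maps\<close>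

text \<open>The conditions on a cochain without the value 0 outside \<open>W p\<close>. This covers
  \<open>proj\<close>, which is not extended by zero but appears as a factor in
  \<open>koszul_d\<close>.\<close>

definition bimodule_map :: "nat \<Rightarrow> 'f::field cochain \<Rightarrow> bool" where
  "bimodule_map p f \<longleftrightarrow>
     (\<forall>v\<in>W p. \<forall>w\<in>W p. f (v + w) = f v + f w) \<and>
     (\<forall>l\<in>W 0. \<forall>w\<in>W p. \<forall>m\<in>W 0. f (l \<star> w \<star> m) = proj l * f w * proj m)"

lemma cochains_iff: "f \<in> cochains p \<longleftrightarrow> bimodule_map p f \<and> (\<forall>w. w \<notin> W p \<longrightarrow> f w = 0)"
  by (auto simp: cochains_def bimodule_map_def)

lemma cochain_bimodule: "f \<in> cochains p \<Longrightarrow> bimodule_map p f"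
  by (simp add: cochains_iff)

lemma bimodule_proj: "bimodule_map p proj"
  by (simp add: bimodule_map_def proj_add proj_mult)

lemma bimodule_add: "bimodule_map p f \<Longrightarrow> v \<in> W p \<Longrightarrow> w \<in> W p \<Longrightarrow> f (v + w) = f v + f w"
  by (simp add: bimodule_map_def)

lemma bimodule_left: "bimodule_map p f \<Longrightarrow> l \<in> W 0 \<Longrightarrow> w \<in> W p \<Longrightarrow> f (l \<star> w) = proj l * f w"
  unfolding bimodule_map_def using path_one_W
  by (metis mult.right_neutral path_one_right proj_one)

lemma bimodule_right: "bimodule_map p f \<Longrightarrow> l \<in> W 0 \<Longrightarrow> w \<in> W p \<Longrightarrow> f (w \<star> l) = f w * proj l"
  unfolding bimodule_map_def using path_one_W
  by (metis mult.left_neutral path_one_left proj_one)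

lemma bimodule_scale: "bimodule_map p f \<Longrightarrow> w \<in> W p \<Longrightarrow> f (scale c w) = scalar c * f w"
  using bimodule_left[OF _ scale_path_one_W, of p f w c]
  by (simp add: scalar_def scale_eq_mult[of c w])

lemma bimodule_0: "bimodule_map p f \<Longrightarrow> f 0 = 0"
  using bimodule_add[of p f 0 0] path_algebra.subspace_0[OF subspace_W[of p]] by simp

lemma bimodule_minus: "bimodule_map p f \<Longrightarrow> w \<in> W p \<Longrightarrow> f (- w) = - f w"
  using bimodule_scale[of p f w "-1"] by (simp add: scalar_minus)

lemma bimodule_sum:
  "finite S \<Longrightarrow> bimodule_map p f \<Longrightarrow> (\<And>i. i \<in> S \<Longrightarrow> x i \<in> W p) \<Longrightarrow> f (\<Sum>i\<in>S. x i) = (\<Sum>i\<in>S. f (x i))"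
proof (induction S rule: finite_induct)
  case (insert i S)
  then have "(\<Sum>i\<in>S. x i) \<in> W p"
    by (intro path_algebra.subspace_sum subspace_W) auto
  with insert show ?case by (simp add: bimodule_add)
qed (simp add: bimodule_0)

section \<open>Bases of the spaces \<open>W q\<close> and well-defined evaluation of
  products\<close>

lemma lookup_sum_list: "lookup (\<Sum>x\<leftarrow>xs. f x) p = (\<Sum>x\<leftarrow>xs. lookup (f x) p)"
  by (induction xs) (auto simp: lookup_add)

text \<open>Each basis element of \<open>W q\<close> has a leading path \<open>m k\<close> which occurs in no other one, so that
  coordinates are coefficients.\<close>

locale W_basis =
  fixes q :: nat and b :: "'k::finite \<Rightarrow> (path \<Rightarrow>\<^sub>0 'f::field)" and m :: "'k \<Rightarrow> path" and s :: "'k \<Rightarrow> 'f"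
  assumes W_span: "W q = path_algebra.span (range b)"
    and length_m: "path_length (m k) = q"
    and lookup_b: "lookup (b k) (m l) = (if k = l then s k else 0)"
    and s_square: "s k * s k = 1"
    and vertex_b: "vertex_elem i \<star> b k = (if i = target (m k) then b k else 0)"
    and b_vertex: "b k \<star> vertex_elem i = (if i = source (m k) then b k else 0)"
begin

definition coord :: "'k \<Rightarrow> (path \<Rightarrow>\<^sub>0 'f) \<Rightarrow> 'f" where
  "coord k w = s k * lookup w (m k)"

lemma coord_add: "coord k (v + w) = coord k v + coord k w"
  and coord_scale: "coord k (scale c w) = c * coord k w"
  and coord_0 [simp]: "coord k 0 = 0"
  by (simp_all add: coord_def lookup_add algebra_simps)

lemma coord_b: "coord l (b k) = (if k = l then 1 else 0)"
  by (simp add: coord_def lookup_b s_square)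

lemma b_W: "b k \<in> W q"
  unfolding W_span by (rule path_algebra.span_base) simp

lemma expand: "w \<in> W q \<Longrightarrow> w = (\<Sum>k\<in>UNIV. scale (coord k w) (b k))"
  unfolding W_span
proof (induction rule: path_algebra.span_induct_alt)
  case base
  show ?case by simp
next
  case (step c x y)
  then obtain l where x: "x = b l" by blast
  have "(\<Sum>k\<in>UNIV. scale (coord k (b l)) (b k)) = (\<Sum>k\<in>UNIV. if k = l then b k else 0)"
    by (intro sum.cong refl) (auto simp: coord_b)
  then have l: "(\<Sum>k\<in>UNIV. scale (coord k (b l)) (b k)) = b l" by simp
  have "(\<Sum>k\<in>UNIV. scale (coord k (scale c x + y)) (b k)) =
      scale c (\<Sum>k\<in>UNIV. scale (coord k x) (b k)) + (\<Sum>k\<in>UNIV. scale (coord k y) (b k))"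
    by (simp add: coord_add coord_scale path_algebra.scale_left_distrib sum.distrib path_algebra.scale_sum_right)
  also have "\<dots> = scale c x + y"
    using l step.IH by (simp add: x)
  finally show ?case by simp
qed

text \<open>This makes \<open>split_eval\<close> well defined. After expanding the right factors in
  the basis, the value depends only on the collected left coefficients of the \<open>b k\<close>,
  and these vanish: their coefficients can be read off the zero sum at the paths that end in
  \<open>m k\<close> on the right.\<close>

lemma split_zero:
  fixes f g :: "'f cochain"
  assumes f: "bimodule_map p f" and g: "bimodule_map q g"
    and ts: "set ts \<subseteq> W p \<times> W q" and sum: "(\<Sum>(u, v)\<leftarrow>ts. u \<star> v) = 0"
  shows "(\<Sum>(u, v)\<leftarrow>ts. f u * g v) = 0"
proof -
  \<comment> \<open>The left coefficient of \<open>b k\<close>. The vertex keeps the part that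
    composes with \<open>b k\<close>; it may be inserted since it fixes \<open>b k\<close> from the
    left.\<close>
  define slice where "slice k = (\<Sum>(u, v)\<leftarrow>ts. scale (coord k v) (u \<star> vertex_elem (target (m k))))" for k
  have slice: "slice k = 0" for k
  proof (rule poly_mapping_eqI)
    fix r
    have *: "coord k v * lookup u r = s k * lookup (u \<star> v) (compose r (m k))"
      if "v \<in> W q" "source r = target (m k)" for u v
    proof -
      have "lookup (u \<star> v) (compose r (m k)) = lookup u r * lookup v (m k)"
      proof (rule lookup_path_mult[OF that(2)])
        fix x assume "x \<in> keys v"
        moreover have "v \<in> homogeneous q" using that(1) W_homogeneous by blast
        ultimately show "path_length x = path_length (m k)"
          unfolding length_m by (rule homogeneousD[rotated])
      qed
      then show ?thesis by (simp add: coord_def)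
    qed
    show "lookup (slice k) r = lookup 0 r"
    proof (cases "source r = target (m k)")
      case True
      have "lookup (slice k) r = (\<Sum>(u, v)\<leftarrow>ts. coord k v * lookup u r)"
        unfolding slice_def lookup_sum_list
        by (intro arg_cong[of _ _ sum_list] map_cong refl) (auto simp only: lookup_mult_vertex lookup_scale True if_True refl split: prod.splits)
      also have "\<dots> = (\<Sum>(u, v)\<leftarrow>ts. s k * lookup (u \<star> v) (compose r (m k)))"
        using ts by (intro arg_cong[of _ _ sum_list] map_cong refl) (auto intro!: *[OF _ True])
      also have "\<dots> = s k * lookup (\<Sum>(u, v)\<leftarrow>ts. u \<star> v) (compose r (m k))"
        unfolding lookup_sum_list sum_scale_mult[symmetric]
        by (intro arg_cong[of _ _ sum_list] map_cong refl) auto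
      finally show ?thesis by (simp add: sum)
    next
      case False
      then show ?thesis
        unfolding slice_def lookup_sum_list
        by (auto simp: lookup_mult_vertex intro!: sum_list_0 simp: case_prod_unfold)
    qed
  qed
  \<comment> \<open>Membership in \<open>W p\<close> is part of the induction because
    \<open>f\<close> is additive only there.\<close>
  have "(\<Sum>(u, v)\<leftarrow>ts. f u * g v) =
    (\<Sum>k\<in>UNIV. f (\<Sum>(u, v)\<leftarrow>ts. scale (coord k v) (u \<star> vertex_elem (target (m k)))) * g (b k))
    \<and> (\<forall>k. (\<Sum>(u, v)\<leftarrow>ts. scale (coord k v) (u \<star> vertex_elem (target (m k)))) \<in> W p)"
    using ts
  proof (induction ts)
    case Nil
    then show ?case
      using f path_algebra.subspace_0[OF subspace_W[of p]] by (simp add: bimodule_0)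
  next
    case (Cons t ts)
    obtain u v where t: "t = (u, v)" by (cases t)
    with Cons.prems have u: "u \<in> W p" and v: "v \<in> W q" and ts: "set ts \<subseteq> W p \<times> W q" by auto
    define S where "S k = (\<Sum>(u, v)\<leftarrow>ts. scale (coord k v) (u \<star> vertex_elem (target (m k))))" for k
    have IH: "(\<Sum>(u, v)\<leftarrow>ts. f u * g v) = (\<Sum>k\<in>UNIV. f (S k) * g (b k))" and S: "S k \<in> W p" for k
      using Cons.IH[OF ts] by (simp_all add: S_def)
    have ue: "u \<star> vertex_elem i \<in> W p" for i
      by (rule W_mult_right[OF vertex_elem_W u])
    then have uc: "scale c (u \<star> vertex_elem i) \<in> W p" for c i
      by (rule path_algebra.subspace_scale[OF subspace_W])
    have gb: "proj (vertex_elem (target (m k))) * g (b k) = g (b k)" for k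
      using bimodule_left[OF g vertex_elem_W b_W, of "target (m k)" k] by (simp add: vertex_b)
    have "g v = (\<Sum>k\<in>UNIV. scalar (coord k v) * g (b k))"
      by (subst expand[OF v], subst bimodule_sum[OF finite g])
         (auto intro: path_algebra.subspace_scale[OF subspace_W] b_W simp: bimodule_scale[OF g b_W])
    then have "f u * g v = (\<Sum>k\<in>UNIV. f (scale (coord k v) (u \<star> vertex_elem (target (m k)))) * g (b k))"
      by (simp only: sum_distrib_left bimodule_scale[OF f ue] bimodule_right[OF f vertex_elem_W u]
          mult.assoc gb scalar_left_commute[of "f u"])
    then have "f u * g v + (\<Sum>(u, v)\<leftarrow>ts. f u * g v) =
        (\<Sum>k\<in>UNIV. f (scale (coord k v) (u \<star> vertex_elem (target (m k))) + S k) * g (b k))"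
      by (simp add: IH bimodule_add[OF f uc S] distrib_right sum.distrib)
    moreover have "scale (coord k v) (u \<star> vertex_elem (target (m k))) + S k \<in> W p" for k
      by (intro path_algebra.subspace_add subspace_W uc S)
    ultimately show ?case by (simp add: t S_def)
  qed
  then show ?thesis
    using slice bimodule_0[OF f] by (simp add: slice_def)
qed

definition extend :: "('k \<Rightarrow> 'f preproj) \<Rightarrow> 'f cochain" where
  "extend \<phi> = (\<lambda>w. if w \<in> W q then \<Sum>k\<in>UNIV. scalar (coord k w) * \<phi> k else 0)"

lemma extend_b: "extend \<phi> (b k) = \<phi> k"
proof -
  have "(\<Sum>l\<in>UNIV. scalar (coord l (b k)) * \<phi> l) = (\<Sum>l\<in>UNIV. if l = k then \<phi> l else 0)"
    by (intro sum.cong refl) (auto simp: coord_b)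
  then show ?thesis by (simp add: extend_def b_W)
qed

lemma cochain_eq_extend:
  assumes "f \<in> cochains q" shows "f = extend (\<lambda>k. f (b k))"
proof
  fix w
  have f: "bimodule_map q f" and f0: "w \<notin> W q \<Longrightarrow> f w = 0"
    using assms by (auto simp: cochains_iff)
  show "f w = extend (\<lambda>k. f (b k)) w"
  proof (cases "w \<in> W q")
    case True
    have "f (\<Sum>k\<in>UNIV. scale (coord k w) (b k)) = (\<Sum>k\<in>UNIV. scalar (coord k w) * f (b k))"
      by (subst bimodule_sum[OF finite f])
         (auto intro: path_algebra.subspace_scale[OF subspace_W] b_W simp: bimodule_scale[OF f b_W])
    then show ?thesis using True expand[OF True] by (simp add: extend_def)
  qed (simp add: extend_def f0)
qed

lemma cochain_eqI:
  "f \<in> cochains q \<Longrightarrow> g \<in> cochains q \<Longrightarrow> (\<And>k. f (b k) = g (b k)) \<Longrightarrow> f = g"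
  by (metis cochain_eq_extend ext)

lemma cochain_value:
  assumes "f \<in> cochains q"
  shows "e (target (m k)) * f (b k) = f (b k)" "f (b k) * e (source (m k)) = f (b k)"
  using bimodule_left[OF cochain_bimodule[OF assms] vertex_elem_W b_W, of "target (m k)" k]
    bimodule_right[OF cochain_bimodule[OF assms] vertex_elem_W b_W, of k "source (m k)"]
  by (simp_all add: vertex_b b_vertex)

lemma vertex_target_m: "coord k (vertex_elem i \<star> w) = (if i = target (m k) then coord k w else 0)"
  and source_m_vertex: "coord k (w \<star> vertex_elem i) = (if i = source (m k) then coord k w else 0)"
  by (auto simp: coord_def lookup_vertex_mult lookup_mult_vertex)

lemma W_0_expand: "l \<in> W 0 \<Longrightarrow> l = (\<Sum>i\<in>UNIV. scale (lookup l (trivial_path i)) (vertex_elem i))"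
  by (rule V_power_0_expand) (simp add: W_def)

lemma coord_sum: "coord k (sum x S) = (\<Sum>i\<in>S. coord k (x i))"
  by (simp add: coord_def lookup_sum sum_distrib_left)

text \<open>An element of k acts on the line of \<open>b k\<close>, and on any value with the same
  source and target, through its coefficient at one vertex. So linearity over k on both sides
  reduces to linearity over the field.\<close>

lemma extend_cochain:
  assumes "\<And>k. e (target (m k)) * \<phi> k = \<phi> k" "\<And>k. \<phi> k * e (source (m k)) = \<phi> k"
  shows "extend \<phi> \<in> cochains q"
  unfolding cochains_iff bimodule_map_def
proof (intro conjI ballI allI impI)
  fix v w :: "path \<Rightarrow>\<^sub>0 'f" assume "v \<in> W q" "w \<in> W q"
  moreover then have "v + w \<in> W q" by (rule path_algebra.subspace_add[OF subspace_W])
  ultimately show "extend \<phi> (v + w) = extend \<phi> v + extend \<phi> w"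
    by (simp add: extend_def coord_add scalar_add distrib_right sum.distrib)
next
  fix w :: "path \<Rightarrow>\<^sub>0 'f" assume "w \<notin> W q"
  then show "extend \<phi> w = 0" by (simp add: extend_def)
next
  fix l w l' :: "path \<Rightarrow>\<^sub>0 'f" assume l: "l \<in> W 0" and w: "w \<in> W q" and l': "l' \<in> W 0"
  have cl: "coord k (l \<star> w) = lookup l (trivial_path (target (m k))) * coord k w" for k w
    by (subst W_0_expand[OF l])
       (simp add: path_mult_sum_left coord_sum path_mult_scale_left coord_scale vertex_target_m if_distrib cong: if_cong)
  have cr: "coord k (w \<star> l') = lookup l' (trivial_path (source (m k))) * coord k w" for k w
    by (subst W_0_expand[OF l'])
       (simp add: path_mult_sum_right coord_sum path_mult_scale_right coord_scale source_m_vertex if_distrib cong: if_cong)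
  have ee: "e i * e j = (if i = j then e i else (0 :: 'f preproj))" for i j
  proof -
    have "vertex_elem i \<star> vertex_elem j = (if i = j then vertex_elem i else (0 :: path \<Rightarrow>\<^sub>0 'f))"
      using compose_trivial_left[of "trivial_path j"] by (auto simp: vertex_elem_def path_mult_single)
    then show ?thesis by (metis proj_mult proj_0)
  qed
  have left: "proj l * \<phi> k = scalar (lookup l (trivial_path (target (m k)))) * \<phi> k" for k
  proof -
    have "proj l * \<phi> k = (\<Sum>i\<in>UNIV. scalar (lookup l (trivial_path i)) * (e i * (e (target (m k)) * \<phi> k)))"
      by (subst W_0_expand[OF l]) (simp add: proj_sum proj_scale sum_distrib_right mult.assoc assms)
    also have "\<dots> = (\<Sum>i\<in>UNIV. if i = target (m k) then scalar (lookup l (trivial_path i)) * \<phi> k else 0)"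
      by (intro sum.cong refl) (auto simp: mult.assoc[symmetric] ee, simp add: mult.assoc assms)
    finally show ?thesis by simp
  qed
  have right: "\<phi> k * proj l' = scalar (lookup l' (trivial_path (source (m k)))) * \<phi> k" for k
  proof -
    have "\<phi> k * proj l' = (\<Sum>i\<in>UNIV. scalar (lookup l' (trivial_path i)) * ((\<phi> k * e (source (m k))) * e i))"
      by (subst W_0_expand[OF l']) (simp add: proj_sum proj_scale sum_distrib_left mult.assoc[symmetric] assms scalar_commute)
    also have "\<dots> = (\<Sum>i\<in>UNIV. if i = source (m k) then scalar (lookup l' (trivial_path i)) * \<phi> k else 0)"
      by (intro sum.cong refl) (auto simp: mult.assoc ee, simp add: assms)
    finally show ?thesis by simp
  qed
  have "proj l * (scalar c * \<phi> k) * proj l' =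
      scalar (lookup l' (trivial_path (source (m k))) * (lookup l (trivial_path (target (m k))) * c)) * \<phi> k" for c k
  proof -
    let ?s = "scalar (lookup l' (trivial_path (source (m k))))" and ?t = "scalar (lookup l (trivial_path (target (m k))))"
    have "proj l * (scalar c * \<phi> k) * proj l' = scalar c * (proj l * (\<phi> k * proj l'))"
      by (simp only: scalar_left_commute mult.assoc)
    also have "proj l * (\<phi> k * proj l') = ?s * (?t * \<phi> k)"
      unfolding right scalar_left_commute[of "proj l"] left ..
    also have "scalar c * (?s * (?t * \<phi> k)) = ?s * (?t * (scalar c * \<phi> k))"
      by (metis scalar_left_commute)
    finally show ?thesis by (simp only: scalar_mult mult.assoc)
  qed
  then show "extend \<phi> (l \<star> w \<star> l') = proj l * extend \<phi> w * proj l'"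
    using W_mult[OF l w l'] w
    by (simp add: extend_def cl cr sum_distrib_left sum_distrib_right)
qed

end

text \<open>Two sums for the same \<open>w\<close> are compared by concatenating one with the other,
  left factors negated; the result represents 0.\<close>

lemma split_eval_eq:
  assumes f: "bimodule_map p f" and g: "bimodule_map q g"
    and zero: "\<And>ts. set ts \<subseteq> W p \<times> W q \<Longrightarrow> (\<Sum>(u, v)\<leftarrow>ts. u \<star> v) = 0 \<Longrightarrow> (\<Sum>(u, v)\<leftarrow>ts. f u * g v) = 0"
    and ts: "set ts \<subseteq> W p \<times> W q" and w: "w = (\<Sum>(u, v)\<leftarrow>ts. u \<star> v)"
  shows "split_eval p q f g w = (\<Sum>(u, v)\<leftarrow>ts. f u * g v)"
  unfolding split_eval_def
proof (rule the_equality)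
  show "\<exists>ts'. set ts' \<subseteq> W p \<times> W q \<and> w = (\<Sum>(u, v)\<leftarrow>ts'. u \<star> v) \<and>
      (\<Sum>(u, v)\<leftarrow>ts. f u * g v) = (\<Sum>(u, v)\<leftarrow>ts'. f u * g v)"
    using ts w by blast
next
  fix a assume "\<exists>ts'. set ts' \<subseteq> W p \<times> W q \<and> w = (\<Sum>(u, v)\<leftarrow>ts'. u \<star> v) \<and> a = (\<Sum>(u, v)\<leftarrow>ts'. f u * g v)"
  then obtain ts' where ts': "set ts' \<subseteq> W p \<times> W q" "w = (\<Sum>(u, v)\<leftarrow>ts'. u \<star> v)"
    "a = (\<Sum>(u, v)\<leftarrow>ts'. f u * g v)" by blast
  have neg: "set (map (\<lambda>(u, v). (- u, v)) ts) \<subseteq> W p \<times> W q"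
    "(\<Sum>(u, v)\<leftarrow>map (\<lambda>(u, v). (- u, v)) ts. u \<star> v) = - (\<Sum>(u, v)\<leftarrow>ts. u \<star> v)"
    "(\<Sum>(u, v)\<leftarrow>map (\<lambda>(u, v). (- u, v)) ts. f u * g v) = - (\<Sum>(u, v)\<leftarrow>ts. f u * g v)"
    using ts by (induction ts)
      (auto simp: path_mult_minus_left bimodule_minus[OF f] path_algebra.subspace_neg[OF subspace_W])
  have "(\<Sum>(u, v)\<leftarrow>ts' @ map (\<lambda>(u, v). (- u, v)) ts. f u * g v) = 0"
    by (rule zero) (use ts' neg w in \<open>simp_all\<close>)
  then show "a = (\<Sum>(u, v)\<leftarrow>ts. f u * g v)"
    using ts'(3) neg(3) by simp
qed

declare One_nat_def [simp del]

section \<open>Vertices, arrows and relations as bases; cochains as families of values\<close>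

global_interpretation W0: W_basis 0 "vertex_elem :: vertex \<Rightarrow> path \<Rightarrow>\<^sub>0 'f::field" trivial_path "\<lambda>_. 1"
proof
  show "W 0 = path_algebra.span (range (vertex_elem :: vertex \<Rightarrow> path \<Rightarrow>\<^sub>0 'f))"
  proof -
    have "{Poly_Mapping.single p 1 |p. path_length p = 0} = range (vertex_elem :: vertex \<Rightarrow> path \<Rightarrow>\<^sub>0 'f)"
      by (auto simp: vertex_elem_def path_length_0_iff)
    then show ?thesis by (simp add: W_def V_power_def)
  qed
  fix i k
  have "compose (trivial_path k) (trivial_path k) = trivial_path k"
    using compose_trivial_left[of "trivial_path k"] by simp
  then show "vertex_elem i \<star> vertex_elem k = (if i = target (trivial_path k) then vertex_elem k else (0 :: path \<Rightarrow>\<^sub>0 'f))"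
    "vertex_elem k \<star> vertex_elem i = (if i = source (trivial_path k) then vertex_elem k else (0 :: path \<Rightarrow>\<^sub>0 'f))"
    by (auto simp: vertex_elem_def path_mult_single)
qed (auto simp: vertex_elem_def lookup_single when_def)

global_interpretation W1: W_basis 1 "arrow_elem :: arrow \<Rightarrow> path \<Rightarrow>\<^sub>0 'f::field" arrow_path "\<lambda>_. 1"
  defines arrow_extend = W1.extend and arrow_coord = W1.coord
proof
  show "W 1 = path_algebra.span (range (arrow_elem :: arrow \<Rightarrow> path \<Rightarrow>\<^sub>0 'f))"
  proof -
    have "{Poly_Mapping.single p 1 |p. path_length p = 1} = range (arrow_elem :: arrow \<Rightarrow> path \<Rightarrow>\<^sub>0 'f)"
      unfolding path_length_1_iff by (auto simp: arrow_elem_def)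
    then show ?thesis by (simp add: W_def V_power_def)
  qed
  fix i k
  show "vertex_elem i \<star> arrow_elem k = (if i = target (arrow_path k) then arrow_elem k else (0 :: path \<Rightarrow>\<^sub>0 'f))"
    "arrow_elem k \<star> vertex_elem i = (if i = source (arrow_path k) then arrow_elem k else (0 :: path \<Rightarrow>\<^sub>0 'f))"
    using compose_trivial_left[of "arrow_path k"] compose_trivial_right[of "arrow_path k"]
    by (auto simp: vertex_elem_def arrow_elem_def path_mult_single)
qed (auto simp: arrow_elem_def lookup_single when_def)

text \<open>Some arrow into the vertex, any one would do: a product of an arrow with its reverse
  occurs in the relation at its target and in no other.\<close>

fun lead :: "vertex \<Rightarrow> arrow" where
  "lead V0 = A0s" | "lead V1 = A1s" | "lead V2 = A1" | "lead V3 = A0" | "lead V4 = A3" | "lead V5 = A4"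

lemma target_lead [simp]: "arrow_target (lead i) = i"
  by (cases i) simp_all

lemma W_2_span: "W 2 = path_algebra.span (range \<sigma>)"
  by (simp only: W_2 R_space_def)

global_interpretation W2: W_basis 2 "\<sigma> :: vertex \<Rightarrow> path \<Rightarrow>\<^sub>0 'f::field"
  "\<lambda>i. two_path (lead i) (bar (lead i))" "\<lambda>i. sgn_arrow (lead i)"
proof
  fix k l :: vertex
  show "lookup (\<sigma> k :: path \<Rightarrow>\<^sub>0 'f) (two_path (lead l) (bar (lead l))) = (if k = l then sgn_arrow (lead k) else 0)"
    by (auto simp: lookup_sigma)
qed (auto simp: W_2_span length_two_path vertex_mult_sigma sigma_mult_vertex target_two_path source_two_path)

abbreviation ar :: "arrow \<Rightarrow> 'f::field preproj" where "ar x \<equiv> proj (arrow_elem x)"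

lemma e_mult_e: "e i * e j = (if i = j then e i else (0 :: 'f::field preproj))"
  unfolding proj_mult[symmetric] W0.vertex_b by auto

lemma e_mult_ar: "e i * ar x = (if i = arrow_target x then ar x else 0)"
  and ar_mult_e: "ar x * e i = (if i = arrow_source x then ar x else 0)"
  unfolding proj_mult[symmetric] W1.vertex_b W1.b_vertex by auto

text \<open>The families of values on arrows that come from 1-cochains; \<open>vertex_typed\<close>
  plays this role for relations, which are loops, and 2-cochains.\<close>

definition arrow_typed :: "(arrow \<Rightarrow> 'f::field preproj) \<Rightarrow> bool" where
  "arrow_typed \<phi> \<longleftrightarrow> (\<forall>x. e (arrow_target x) * \<phi> x = \<phi> x \<and> \<phi> x * e (arrow_source x) = \<phi> x)"

definition vertex_typed :: "(vertex \<Rightarrow> 'f::field preproj) \<Rightarrow> bool" where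
  "vertex_typed \<psi> \<longleftrightarrow> (\<forall>i. e i * \<psi> i = \<psi> i \<and> \<psi> i * e i = \<psi> i)"

lemma W1_extend_cochain: "arrow_typed \<phi> \<Longrightarrow> W1.extend \<phi> \<in> cochains 1"
  by (rule W1.extend_cochain) (auto simp: arrow_typed_def)

lemma W2_extend_cochain: "vertex_typed \<psi> \<Longrightarrow> W2.extend \<psi> \<in> cochains 2"
  by (rule W2.extend_cochain) (auto simp: vertex_typed_def target_two_path source_two_path)

lemma cochain_1_typed: "f \<in> cochains 1 \<Longrightarrow> arrow_typed (\<lambda>x. f (arrow_elem x))"
  using W1.cochain_value[of f] by (auto simp: arrow_typed_def)

lemma arrow_cochain_eq: "arrow_typed \<phi> \<Longrightarrow> arrow_cochain \<phi> = W1.extend \<phi>"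
  unfolding arrow_cochain_def
  by (rule the_equality)
     (auto simp: W1.extend_b W1_extend_cochain intro!: W1.cochain_eqI)

lemma relation_cochain_eq: "vertex_typed \<psi> \<Longrightarrow> relation_cochain \<psi> = W2.extend \<psi>"
  unfolding relation_cochain_def
  by (rule the_equality) (auto simp: W2.extend_b W2_extend_cochain intro!: W2.cochain_eqI)

lemma cochain_0_commute:
  assumes "f \<in> cochains 0" "l \<in> W 0"
  shows "f l = proj l * f path_one" "f l = f path_one * proj l"
  using bimodule_left[OF cochain_bimodule[OF assms(1)] assms(2) path_one_W]
    bimodule_right[OF cochain_bimodule[OF assms(1)] assms(2) path_one_W]
  by (simp_all add: path_one_left path_one_right)

text \<open>Every 0-cochain has this form, with \<open>z\<close> its value at 1
  (\<open>cochain_0_eq\<close>). Such a \<open>z\<close> commutes with the vertices; centrality is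
  the stronger condition of being a cocycle.\<close>

definition const_cochain :: "'f::field preproj \<Rightarrow> 'f cochain" where
  "const_cochain z = (\<lambda>w. if w \<in> W 0 then proj w * z else 0)"

lemma e_commute_W_0:
  assumes "\<And>i. e i * z = z * e i" "l \<in> W 0"
  shows "proj l * z = z * proj l"
proof -
  have "proj l * z = (\<Sum>i\<in>UNIV. scalar (lookup l (trivial_path i)) * (e i * z))"
    by (subst W0.W_0_expand[OF assms(2)]) (simp add: proj_sum proj_scale sum_distrib_right mult.assoc)
  also have "\<dots> = (\<Sum>i\<in>UNIV. z * (scalar (lookup l (trivial_path i)) * e i))"
    by (simp add: assms(1) scalar_left_commute)
  also have "\<dots> = z * proj l"
    by (subst (2) W0.W_0_expand[OF assms(2)]) (simp add: proj_sum proj_scale sum_distrib_left)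
  finally show ?thesis .
qed

lemma const_cochain:
  assumes "\<And>i. e i * z = z * e i"
  shows "const_cochain z \<in> cochains 0"
  unfolding cochains_iff bimodule_map_def
proof (intro conjI ballI allI impI)
  fix v w :: "path \<Rightarrow>\<^sub>0 'a" assume "v \<in> W 0" "w \<in> W 0"
  moreover then have "v + w \<in> W 0" by (rule path_algebra.subspace_add[OF subspace_W])
  ultimately show "const_cochain z (v + w) = const_cochain z v + const_cochain z w"
    by (simp add: const_cochain_def proj_add distrib_right)
next
  fix l w m :: "path \<Rightarrow>\<^sub>0 'a" assume l: "l \<in> W 0" and w: "w \<in> W 0" and m: "m \<in> W 0"
  have "proj m * z = z * proj m" by (rule e_commute_W_0) (use assms m in auto)
  then show "const_cochain z (l \<star> w \<star> m) = proj l * const_cochain z w * proj m"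
    using W_mult[OF l w m] w by (simp add: const_cochain_def proj_mult mult.assoc)
qed (simp add: const_cochain_def)

lemma const_cochain_one [simp]: "const_cochain z path_one = z"
  by (simp add: const_cochain_def path_one_W)

lemma cochain_0_eq:
  assumes "f \<in> cochains 0"
  shows "f = const_cochain (f path_one)" "e i * f path_one = f path_one * e i"
proof -
  show "f = const_cochain (f path_one)"
    using cochain_0_commute(1)[OF assms] assms by (auto simp: const_cochain_def cochains_iff)
  show "e i * f path_one = f path_one * e i"
    using cochain_0_commute[OF assms vertex_elem_W] by metis
qed

lemma zero_cochain: "(\<lambda>_. 0) \<in> cochains p"
  by (simp add: cochains_def)

section \<open>Evaluation of products and differentials\<close>

text \<open>The degree of the right factor decides: in degrees 0, 1, 2 it has a basis as in
  \<open>W_basis\<close>, and from degree 3 on \<open>W q\<close> is zero.\<close>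

lemma split_eval:
  fixes f g :: "'f::field cochain"
  assumes f: "bimodule_map p f" and g: "bimodule_map q g" and ts: "set ts \<subseteq> W p \<times> W q"
    and w: "w = (\<Sum>(u, v)\<leftarrow>ts. u \<star> v)"
  shows "split_eval p q f g w = (\<Sum>(u, v)\<leftarrow>ts. f u * g v)"
proof (rule split_eval_eq[OF f g _ ts w])
  fix ts :: "((path \<Rightarrow>\<^sub>0 'f) \<times> (path \<Rightarrow>\<^sub>0 'f)) list" assume *: "set ts \<subseteq> W p \<times> W q" "(\<Sum>(u, v)\<leftarrow>ts. u \<star> v) = 0"
  consider "q = 0" | "q = 1" | "q = 2" | "q \<ge> 3" by linarith
  then show "(\<Sum>(u, v)\<leftarrow>ts. f u * g v) = 0"
  proof cases
    case 1 then show ?thesis using W0.split_zero[OF f _ _ *(2)] g *(1) by simp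
  next
    case 2 then show ?thesis using W1.split_zero[OF f _ _ *(2)] g *(1) by simp
  next
    case 3 then show ?thesis using W2.split_zero[OF f _ _ *(2)] g *(1) by simp
  next
    case 4
    then have "f u * g v = 0" if "(u, v) \<in> set ts" for u v
      using *(1) that bimodule_0[OF g] by (auto simp: W_ge_3)
    then have "map (\<lambda>(u, v). f u * g v) ts = map (\<lambda>_. 0) ts"
      by (intro map_cong refl) auto
    then show ?thesis by (metis sum_list_0)
  qed
qed

text \<open>The relation at a vertex with \<open>\<mu> x\<close> in place of the product of
  \<open>x\<close> and \<open>bar x\<close>; the left arrow determines the term.\<close>

fun sigma_eval :: "(arrow \<Rightarrow> 'f::field preproj) \<Rightarrow> vertex \<Rightarrow> 'f preproj" where
  "sigma_eval \<mu> V0 = - \<mu> A0s"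
| "sigma_eval \<mu> V1 = - \<mu> A1s"
| "sigma_eval \<mu> V2 = \<mu> A1 - \<mu> A2s"
| "sigma_eval \<mu> V3 = \<mu> A0 + \<mu> A2 - \<mu> A3s"
| "sigma_eval \<mu> V4 = \<mu> A3 - \<mu> A4s"
| "sigma_eval \<mu> V5 = \<mu> A4"

lemma sigma_eval_add: "sigma_eval (\<lambda>x. \<mu> x + \<nu> x) i = sigma_eval \<mu> i + sigma_eval \<nu> i"
  and sigma_eval_diff: "sigma_eval (\<lambda>x. \<mu> x - \<nu> x) i = sigma_eval \<mu> i - sigma_eval \<nu> i"
  and sigma_eval_minus: "sigma_eval (\<lambda>x. - \<mu> x) i = - sigma_eval \<mu> i"
  and sigma_eval_mult_left: "sigma_eval (\<lambda>x. z * \<mu> x) i = z * sigma_eval \<mu> i"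
  and sigma_eval_mult_right: "sigma_eval (\<lambda>x. \<mu> x * z) i = sigma_eval \<mu> i * z"
  by (cases i; simp add: algebra_simps)+

lemma proj_sigma_eval: "sigma_eval (\<lambda>x. ar x * ar (bar x)) i = 0"
  using proj_sigma[of i] by (cases i) (simp_all add: proj_add proj_diff proj_minus proj_mult)

lemma vertex_typed_sigma_eval:
  assumes "\<And>x. e (arrow_target x) * \<mu> x = \<mu> x" "\<And>x. \<mu> x * e (arrow_target x) = \<mu> x"
  shows "vertex_typed (sigma_eval \<mu>)"
  unfolding vertex_typed_def
proof
  fix i
  show "e i * sigma_eval \<mu> i = sigma_eval \<mu> i \<and> sigma_eval \<mu> i * e i = sigma_eval \<mu> i"
    using assms[of A0] assms[of A1] assms[of A2] assms[of A3] assms[of A4]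
      assms[of A0s] assms[of A1s] assms[of A2s] assms[of A3s] assms[of A4s]
    by (cases i) (simp_all add: algebra_simps)
qed

lemma arrow_typed_mult:
  assumes "arrow_typed \<phi>" "arrow_typed \<psi>"
  shows "vertex_typed (sigma_eval (\<lambda>x. \<phi> x * \<psi> (bar x)))"
proof (rule vertex_typed_sigma_eval)
  fix x
  show "e (arrow_target x) * (\<phi> x * \<psi> (bar x)) = \<phi> x * \<psi> (bar x)"
    using assms(1) by (simp add: arrow_typed_def mult.assoc[symmetric])
  have "\<psi> (bar x) * e (arrow_source (bar x)) = \<psi> (bar x)"
    using assms(2) unfolding arrow_typed_def by blast
  then show "\<phi> x * \<psi> (bar x) * e (arrow_target x) = \<phi> x * \<psi> (bar x)"
    by (simp add: mult.assoc)
qed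

lemma vertex_typed_add: "vertex_typed \<psi> \<Longrightarrow> vertex_typed \<psi>' \<Longrightarrow> vertex_typed (\<lambda>i. \<psi> i + \<psi>' i)"
  and vertex_typed_minus: "vertex_typed \<psi> \<Longrightarrow> vertex_typed (\<lambda>i. - \<psi> i)"
  by (simp_all add: vertex_typed_def algebra_simps)

lemma arrow_typed_ar: "arrow_typed ar"
  by (simp add: arrow_typed_def e_mult_ar ar_mult_e)

lemma split_eval_1_1:
  fixes f g :: "'f::field cochain"
  assumes f: "bimodule_map 1 f" and g: "bimodule_map 1 g" and w: "w \<in> W 2"
  shows "split_eval 1 1 f g w = W2.extend (sigma_eval (\<lambda>x. f (arrow_elem x) * g (arrow_elem (bar x)))) w"
proof -
  define c where "c i = W2.coord i w" for i
  \<comment> \<open>One entry per arrow: its term in the relation at its target, with the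
    coefficient and the sign moved into the left factor.\<close>
  define ts :: "((path \<Rightarrow>\<^sub>0 'f) \<times> (path \<Rightarrow>\<^sub>0 'f)) list" where "ts = map (\<lambda>(r, x). (scale r (arrow_elem x), arrow_elem (bar x)))
    [(- c V0, A0s), (- c V1, A1s), (c V2, A1), (- c V2, A2s), (c V3, A0), (c V3, A2), (- c V3, A3s),
     (c V4, A3), (- c V4, A4s), (c V5, A4)]"
  have "w = (\<Sum>i\<in>UNIV. scale (c i) (\<sigma> i))"
    unfolding c_def by (rule W2.expand[OF w])
  also have "\<dots> = (\<Sum>(u, v)\<leftarrow>ts. u \<star> v)"
    by (simp add: ts_def UNIV_vertex path_mult_scale_left path_mult_minus_left path_algebra.scale_right_distrib
        path_algebra.scale_right_diff_distrib)
  finally have "split_eval 1 1 f g w = (\<Sum>(u, v)\<leftarrow>ts. f u * g v)"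
    by (intro split_eval[OF f g])
       (auto simp: ts_def arrow_elem_W intro!: path_algebra.subspace_scale[OF subspace_W] path_algebra.subspace_neg[OF subspace_W])
  also have "\<dots> = W2.extend (sigma_eval (\<lambda>x. f (arrow_elem x) * g (arrow_elem (bar x)))) w"
    using w bimodule_scale[OF f arrow_elem_W] bimodule_minus[OF f path_algebra.subspace_scale[OF subspace_W arrow_elem_W]]
    by (simp add: ts_def W2.extend_def c_def[symmetric] UNIV_vertex scalar_minus algebra_simps)
  finally show ?thesis .
qed

lemma split_eval_0_left:
  assumes "bimodule_map 0 f" "bimodule_map q g" "w \<in> W q"
  shows "split_eval 0 q f g w = f path_one * g w"
  using split_eval[OF assms(1,2), of "[(path_one, w)]"] assms(3) by (simp add: path_one_left path_one_W)

lemma split_eval_0_right: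
  assumes "bimodule_map p f" "bimodule_map 0 g" "w \<in> W p"
  shows "split_eval p 0 f g w = f w * g path_one"
  using split_eval[OF assms(1,2), of "[(w, path_one)]"] assms(3) by (simp add: path_one_right path_one_W)

lemma W_one_one: "W (1 + 1) = W 2"
  by (simp only: one_add_one)

text \<open>The differential of a 1-cochain: its sign \<open>- (-1) ^ p\<close> is plus for p = 1,
  so this is the Leibniz rule applied to a relation.\<close>

definition d1 :: "(arrow \<Rightarrow> 'f::field preproj) \<Rightarrow> vertex \<Rightarrow> 'f preproj" where
  "d1 \<phi> = sigma_eval (\<lambda>x. \<phi> x * ar (bar x) + ar x * \<phi> (bar x))"

lemma koszul_d_0:
  assumes "f \<in> cochains 0"
  shows "koszul_d 0 f = W1.extend (\<lambda>x. f path_one * ar x - ar x * f path_one)"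
proof
  fix w
  have f: "bimodule_map 0 f" by (rule cochain_bimodule[OF assms])
  show "koszul_d 0 f w = W1.extend (\<lambda>x. f path_one * ar x - ar x * f path_one) w"
  proof (cases "w \<in> W 1")
    case True
    have "proj w = (\<Sum>x\<in>UNIV. scalar (W1.coord x w) * ar x)"
      by (subst W1.expand[OF True]) (simp only: proj_sum proj_scale)
    then have "f path_one * proj w - proj w * f path_one =
        (\<Sum>x\<in>UNIV. scalar (W1.coord x w) * (f path_one * ar x - ar x * f path_one))"
      by (simp add: sum_distrib_left sum_distrib_right sum_subtractf[symmetric] scalar_left_commute[of "f path_one"]
          right_diff_distrib mult.assoc)
    moreover have "koszul_d 0 f w = f path_one * proj w - proj w * f path_one"
      using True split_eval_0_left[OF f bimodule_proj True] split_eval_0_right[OF bimodule_proj f True]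
      by (simp add: koszul_d_def)
    ultimately show ?thesis using True by (simp add: W1.extend_def)
  qed (simp add: koszul_d_def W1.extend_def)
qed

lemma koszul_d_1:
  assumes "f \<in> cochains 1"
  shows "koszul_d 1 f = W2.extend (d1 (\<lambda>x. f (arrow_elem x)))"
proof
  fix w
  have f: "bimodule_map 1 f" by (rule cochain_bimodule[OF assms])
  show "koszul_d 1 f w = W2.extend (d1 (\<lambda>x. f (arrow_elem x))) w"
  proof (cases "w \<in> W 2")
    case True
    have "koszul_d 1 f w = split_eval 1 1 f proj w + split_eval 1 1 proj f w"
      unfolding koszul_d_def W_one_one using True by simp
    then show ?thesis
      unfolding split_eval_1_1[OF f bimodule_proj True] split_eval_1_1[OF bimodule_proj f True] d1_def
      using True by (simp add: W2.extend_def sigma_eval_add sum.distrib distrib_left)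
  next
    case False
    then show ?thesis unfolding koszul_d_def W_one_one by (simp add: W2.extend_def)
  qed
qed

lemma split_eval_zero:
  assumes "bimodule_map p f" "bimodule_map q g"
  shows "split_eval p q f g 0 = 0"
  using split_eval[OF assms, of "[]" 0] by simp

lemma koszul_d_ge_2:
  assumes "f \<in> cochains p" "p \<ge> 2"
  shows "koszul_d p f = (\<lambda>_. 0)"
proof
  fix w
  have f: "bimodule_map p f" by (rule cochain_bimodule[OF assms(1)])
  show "koszul_d p f w = 0"
    using assms(2) by (simp add: koszul_d_def W_ge_3 split_eval_zero[OF f bimodule_proj] split_eval_zero[OF bimodule_proj f])
qed

lemma cup_0_left:
  assumes "f \<in> cochains 0" "g \<in> cochains q"
  shows "cup_cochain 0 q f g = (\<lambda>w. f path_one * g w)"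
proof
  fix w show "cup_cochain 0 q f g w = f path_one * g w"
    using split_eval_0_left[OF cochain_bimodule[OF assms(1)] cochain_bimodule[OF assms(2)], of w] assms(2)
    by (cases "w \<in> W q") (simp_all add: cup_cochain_def cochains_iff)
qed

lemma cup_0_right:
  assumes "f \<in> cochains p" "g \<in> cochains 0"
  shows "cup_cochain p 0 f g = (\<lambda>w. f w * g path_one)"
proof
  fix w show "cup_cochain p 0 f g w = f w * g path_one"
    using split_eval_0_right[OF cochain_bimodule[OF assms(1)] cochain_bimodule[OF assms(2)], of w] assms(1)
    by (cases "w \<in> W p") (simp_all add: cup_cochain_def cochains_iff)
qed

text \<open>The minus sign is \<open>(-1) ^ (p * q)\<close> for p = q = 1.\<close>

definition cup11 :: "(arrow \<Rightarrow> 'f::field preproj) \<Rightarrow> (arrow \<Rightarrow> 'f preproj) \<Rightarrow> vertex \<Rightarrow> 'f preproj" where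
  "cup11 \<phi> \<psi> i = - sigma_eval (\<lambda>x. \<phi> x * \<psi> (bar x)) i"

lemma cup_1_1:
  assumes "f \<in> cochains 1" "g \<in> cochains 1"
  shows "cup_cochain 1 1 f g = W2.extend (cup11 (\<lambda>x. f (arrow_elem x)) (\<lambda>x. g (arrow_elem x)))"
proof
  fix w show "cup_cochain 1 1 f g w = W2.extend (cup11 (\<lambda>x. f (arrow_elem x)) (\<lambda>x. g (arrow_elem x))) w"
    using split_eval_1_1[OF cochain_bimodule[OF assms(1)] cochain_bimodule[OF assms(2)], of w]
    unfolding cup_cochain_def W_one_one
    by (cases "w \<in> W 2") (simp_all add: W2.extend_def cup11_def[abs_def] sum_negf)
qed

lemma cup_ge_3:
  assumes "f \<in> cochains p" "g \<in> cochains q" "p + q \<ge> 3"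
  shows "cup_cochain p q f g = (\<lambda>_. 0)"
  using split_eval_zero[OF cochain_bimodule[OF assms(1)] cochain_bimodule[OF assms(2)]]
  by (auto simp: cup_cochain_def fun_eq_iff W_ge_3[OF assms(3)])

lemma vertex_typed_cup11: "arrow_typed \<phi> \<Longrightarrow> arrow_typed \<psi> \<Longrightarrow> vertex_typed (cup11 \<phi> \<psi>)"
  unfolding cup11_def[abs_def] by (intro vertex_typed_minus arrow_typed_mult)

lemma vertex_typed_d1:
  assumes "arrow_typed \<phi>" shows "vertex_typed (d1 \<phi>)"
proof -
  have "d1 \<phi> = (\<lambda>i. sigma_eval (\<lambda>x. \<phi> x * ar (bar x)) i + sigma_eval (\<lambda>x. ar x * \<phi> (bar x)) i)"
    by (rule ext) (simp add: d1_def sigma_eval_add)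
  then show ?thesis
    using arrow_typed_mult[OF assms arrow_typed_ar] arrow_typed_mult[OF arrow_typed_ar assms]
    by (simp add: vertex_typed_add)
qed

lemma arrow_typed_commutator:
  assumes "\<And>i. e i * z = z * e i"
  shows "arrow_typed (\<lambda>x. z * ar x - ar x * z)"
proof -
  have "e (arrow_target x) * (z * ar x) = z * ar x" "ar x * z * e (arrow_source x) = ar x * z" for x
  proof -
    have "e (arrow_target x) * (z * ar x) = z * (e (arrow_target x) * ar x)"
      by (simp only: mult.assoc[symmetric] assms)
    then show "e (arrow_target x) * (z * ar x) = z * ar x" by (simp add: e_mult_ar)
    have "ar x * z * e (arrow_source x) = ar x * e (arrow_source x) * z"
      by (simp only: mult.assoc assms)
    then show "ar x * z * e (arrow_source x) = ar x * z" by (simp add: ar_mult_e)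
  qed
  then show ?thesis
    by (simp add: arrow_typed_def right_diff_distrib left_diff_distrib e_mult_ar ar_mult_e
        mult.assoc[symmetric, of "e _" "ar _"] mult.assoc[of z "ar _" "e _"])
qed

section \<open>Cocycles and coboundaries\<close>

lemma coboundaries_0: "coboundaries 0 = {\<lambda>_. 0}"
  by (simp add: coboundaries_def)

lemma coboundaries_image: "coboundaries 1 = koszul_d 0 ` cochains 0" "coboundaries 2 = koszul_d 1 ` cochains 1"
  by (simp_all add: coboundaries_def numeral_2_eq_2 One_nat_def)

lemma coboundaries_1:
  "f \<in> coboundaries 1 \<longleftrightarrow> f \<in> cochains 1 \<and>
    (\<exists>z. (\<forall>i. e i * z = z * e i) \<and> (\<forall>x. f (arrow_elem x) = z * ar x - ar x * z))"
proof
  assume "f \<in> coboundaries 1"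
  then obtain g where g: "g \<in> cochains 0" "f = koszul_d 0 g"
    by (auto simp: coboundaries_image)
  then have "f = W1.extend (\<lambda>x. g path_one * ar x - ar x * g path_one)" by (simp add: koszul_d_0)
  with cochain_0_eq(2)[OF g(1)] show "f \<in> cochains 1 \<and>
    (\<exists>z. (\<forall>i. e i * z = z * e i) \<and> (\<forall>x. f (arrow_elem x) = z * ar x - ar x * z))"
    using W1_extend_cochain[OF arrow_typed_commutator] W1.extend_b by blast
next
  assume *: "f \<in> cochains 1 \<and> (\<exists>z. (\<forall>i. e i * z = z * e i) \<and> (\<forall>x. f (arrow_elem x) = z * ar x - ar x * z))"
  then obtain z where z: "\<And>i. e i * z = z * e i" "\<And>x. f (arrow_elem x) = z * ar x - ar x * z" by blast
  have c: "const_cochain z \<in> cochains 0" by (rule const_cochain[OF z(1)])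
  have "koszul_d 0 (const_cochain z) = W1.extend (\<lambda>x. f (arrow_elem x))"
    unfolding koszul_d_0[OF c] by (simp add: z(2))
  then have "f = koszul_d 0 (const_cochain z)"
    using W1.cochain_eq_extend[of f] * by simp
  then show "f \<in> coboundaries 1" using c by (auto simp: coboundaries_image)
qed

lemma coboundaries_2:
  "f \<in> coboundaries 2 \<longleftrightarrow> f \<in> cochains 2 \<and>
    (\<exists>\<phi>. arrow_typed \<phi> \<and> (\<forall>i. f (\<sigma> i) = d1 \<phi> i))"
proof
  assume "f \<in> coboundaries 2"
  then obtain g where g: "g \<in> cochains 1" "f = koszul_d 1 g"
    by (auto simp: coboundaries_image)
  then have "f = W2.extend (d1 (\<lambda>x. g (arrow_elem x)))" using koszul_d_1 by blast
  with cochain_1_typed[OF g(1)] show "f \<in> cochains 2 \<and> (\<exists>\<phi>. arrow_typed \<phi> \<and> (\<forall>i. f (\<sigma> i) = d1 \<phi> i))"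
    using W2_extend_cochain[OF vertex_typed_d1] W2.extend_b by blast
next
  assume *: "f \<in> cochains 2 \<and> (\<exists>\<phi>. arrow_typed \<phi> \<and> (\<forall>i. f (\<sigma> i) = d1 \<phi> i))"
  then obtain \<phi> where \<phi>: "arrow_typed \<phi>" "\<And>i. f (\<sigma> i) = d1 \<phi> i" by blast
  have c: "W1.extend \<phi> \<in> cochains 1" by (rule W1_extend_cochain[OF \<phi>(1)])
  have "koszul_d 1 (W1.extend \<phi>) = W2.extend (\<lambda>i. f (\<sigma> i))"
    unfolding koszul_d_1[OF c] \<phi>(2) W1.extend_b ..
  then have "f = koszul_d 1 (W1.extend \<phi>)"
    using W2.cochain_eq_extend[of f] * by simp
  then show "f \<in> coboundaries 2" using c by (auto simp: coboundaries_image)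
qed

lemma coboundaries_ge_3:
  assumes "p \<ge> 3" shows "coboundaries p = {\<lambda>_. 0}"
proof -
  obtain n where n: "p = Suc n" "n \<ge> 2" using assms by (cases p) auto
  then show ?thesis
    using zero_cochain[of n] koszul_d_ge_2[OF zero_cochain n(2)]
    by (auto simp: coboundaries_def koszul_d_ge_2 image_iff intro!: bexI[OF _ zero_cochain])
qed

definition central :: "'f::field preproj \<Rightarrow> bool" where
  "central z \<longleftrightarrow> (\<forall>x. z * x = x * z)"

lemma centralD: "central z \<Longrightarrow> z * x = x * z"
  by (simp add: central_def)

lemma central_left_commute: "central z \<Longrightarrow> x * (z * y) = z * (x * y)"
  by (simp only: mult.assoc[symmetric] centralD[of z x])

lemma central_mult:
  assumes "central y" "central z" shows "central (y * z)"
  unfolding central_def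
proof
  fix x
  have "y * z * x = y * (x * z)" by (simp only: mult.assoc centralD[OF assms(2), of x])
  then show "y * z * x = x * (y * z)" by (simp only: central_left_commute[OF assms(1), of x z])
qed

lemma central_iff: "central z \<longleftrightarrow> (\<forall>i. e i * z = z * e i) \<and> (\<forall>x. z * ar x = ar x * z)"
proof
  assume *: "(\<forall>i. e i * z = z * e i) \<and> (\<forall>x. z * ar x = ar x * z)"
  have single_commute: "z * proj (Poly_Mapping.single p 1) = proj (Poly_Mapping.single p 1) * z" for p
  proof (induction "path_length p" arbitrary: p)
    case 0
    then obtain i where "p = trivial_path i" using path_length_0_iff by metis
    then show ?case using *[THEN conjunct1] by (simp add: vertex_elem_def[symmetric])
  next
    case (Suc n)
    obtain q a where q: "p = compose q (arrow_path a)" "source q = arrow_target a" "path_length q = n"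
      using path_split_last Suc.hyps(2)[symmetric] by metis
    have "Poly_Mapping.single p 1 = Poly_Mapping.single q 1 \<star> (arrow_elem a :: path \<Rightarrow>\<^sub>0 'a)"
      using q by (simp add: arrow_elem_def path_mult_single)
    then have p: "proj (Poly_Mapping.single p 1) = proj (Poly_Mapping.single q 1) * (ar a :: 'a preproj)"
      by (simp only: proj_mult)
    have "z * proj (Poly_Mapping.single q 1) = proj (Poly_Mapping.single q 1) * z"
      using Suc.hyps(1) q(3) by blast
    moreover have "z * ar a = ar a * z" using * by blast
    ultimately show ?case unfolding p by (simp only: mult.assoc[symmetric]) (simp only: mult.assoc)
  qed
  have "z * proj x = proj x * z" for x
  proof (induction x rule: path_elem_induct)
    case (single p c)
    have "Poly_Mapping.single p c = scale c (Poly_Mapping.single p 1)" by (simp add: scale_single)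
    then have eq: "proj (Poly_Mapping.single p c) = scalar c * proj (Poly_Mapping.single p 1)" by (simp only: proj_scale)
    show ?case unfolding eq scalar_left_commute[of z] single_commute mult.assoc ..
  qed (simp_all add: proj_add distrib_left distrib_right)
  note * = this
  show "central z" unfolding central_def
  proof
    fix y :: "'a preproj" obtain x where "y = proj x" by (rule proj_surj)
    then show "z * y = y * z" using * by simp
  qed
qed (simp add: central_def)

section \<open>Stability of cochains, coboundaries and cocycles under linear operations and the
  centre\<close>

lemma cochain_add: "f \<in> cochains p \<Longrightarrow> g \<in> cochains p \<Longrightarrow> (\<lambda>w. f w + g w) \<in> cochains p"
  and cochain_minus: "f \<in> cochains p \<Longrightarrow> (\<lambda>w. - f w) \<in> cochains p"
  by (simp_all add: cochains_def algebra_simps)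

lemma cochain_diff: "f \<in> cochains p \<Longrightarrow> g \<in> cochains p \<Longrightarrow> (\<lambda>w. f w - g w) \<in> cochains p"
  using cochain_add[OF _ cochain_minus, of f p g] by simp

lemma cochain_central_mult: "f \<in> cochains p \<Longrightarrow> central z \<Longrightarrow> (\<lambda>w. z * f w) \<in> cochains p"
proof -
  assume f: "f \<in> cochains p" and z: "central z"
  have "z * (x * y * w) = x * (z * y) * w" for x y w
    by (simp only: mult.assoc central_left_commute[OF z])
  then show ?thesis using f by (simp add: cochains_def distrib_left)
qed

lemma degree_cases:
  obtains "p = 0" | "p = 1" | "p = 2" | "p \<ge> (3::nat)"
  by linarith

lemma arrow_typed_add: "arrow_typed \<phi> \<Longrightarrow> arrow_typed \<psi> \<Longrightarrow> arrow_typed (\<lambda>x. \<phi> x + \<psi> x)"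
  and arrow_typed_minus: "arrow_typed \<phi> \<Longrightarrow> arrow_typed (\<lambda>x. - \<phi> x)"
  by (simp_all add: arrow_typed_def distrib_left distrib_right)

lemma d1_add: "d1 (\<lambda>x. \<phi> x + \<psi> x) i = d1 \<phi> i + d1 \<psi> i"
  and d1_minus: "d1 (\<lambda>x. - \<phi> x) i = - d1 \<phi> i"
  by (cases i; simp add: d1_def algebra_simps)+

lemma coboundary_zero: "(\<lambda>_. 0) \<in> coboundaries p"
proof (cases rule: degree_cases[of p])
  case 2
  then show ?thesis by (auto simp: coboundaries_1 zero_cochain intro!: exI[of _ 0])
next
  case 3
  have "d1 (\<lambda>_. 0) i = 0" for i by (cases i) (simp_all add: d1_def)
  then show ?thesis unfolding 3 coboundaries_2
    by (auto simp: zero_cochain arrow_typed_def intro!: exI[of _ "\<lambda>_. 0"])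
qed (simp_all add: coboundaries_0 coboundaries_ge_3)

lemma coboundary_add:
  assumes f: "f \<in> coboundaries p" and g: "g \<in> coboundaries p"
  shows "(\<lambda>w. f w + g w) \<in> coboundaries p"
proof (cases rule: degree_cases[of p])
  case 2
  obtain y z where "f \<in> cochains 1" "g \<in> cochains 1"
    "\<And>i. e i * y = y * e i" "\<And>x. f (arrow_elem x) = y * ar x - ar x * y"
    "\<And>i. e i * z = z * e i" "\<And>x. g (arrow_elem x) = z * ar x - ar x * z"
    using f g unfolding 2 coboundaries_1 by blast
  note h = this
  have "f (arrow_elem x) + g (arrow_elem x) = (y + z) * ar x - ar x * (y + z)" for x
    unfolding h(4,6) by (simp add: algebra_simps)
  moreover have "e i * (y + z) = (y + z) * e i" for i
    by (simp add: h(3,5) distrib_left distrib_right)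
  ultimately show ?thesis unfolding 2 coboundaries_1
    using cochain_add[OF h(1,2)] by blast
next
  case 3
  obtain \<phi> \<psi> where "f \<in> cochains 2" "g \<in> cochains 2" "arrow_typed \<phi>" "\<And>i. f (\<sigma> i) = d1 \<phi> i"
    "arrow_typed \<psi>" "\<And>i. g (\<sigma> i) = d1 \<psi> i"
    using f g unfolding 3 coboundaries_2 by blast
  then show ?thesis unfolding 3 coboundaries_2
    by (auto intro!: cochain_add exI[of _ "\<lambda>x. \<phi> x + \<psi> x"] arrow_typed_add simp: d1_add)
qed (use f g in \<open>simp_all add: coboundaries_0 coboundaries_ge_3\<close>)

lemma coboundary_minus:
  assumes f: "f \<in> coboundaries p"
  shows "(\<lambda>w. - f w) \<in> coboundaries p"
proof (cases rule: degree_cases[of p])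
  case 2
  obtain y where "f \<in> cochains 1" "\<And>i. e i * y = y * e i" "\<And>x. f (arrow_elem x) = y * ar x - ar x * y"
    using f unfolding 2 coboundaries_1 by blast
  note h = this
  have "- f (arrow_elem x) = - y * ar x - ar x * - y" for x
    unfolding h(3) by simp
  moreover have "e i * - y = - y * e i" for i by (simp add: h(2))
  ultimately show ?thesis unfolding 2 coboundaries_1
    using cochain_minus[OF h(1)] by blast
next
  case 3
  obtain \<phi> where "f \<in> cochains 2" "arrow_typed \<phi>" "\<And>i. f (\<sigma> i) = d1 \<phi> i"
    using f unfolding 3 coboundaries_2 by blast
  then show ?thesis unfolding 3 coboundaries_2
    by (auto intro!: cochain_minus exI[of _ "\<lambda>x. - \<phi> x"] arrow_typed_minus simp: d1_minus)
qed (use f in \<open>simp_all add: coboundaries_0 coboundaries_ge_3\<close>)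

lemma arrow_typed_commute_mult:
  assumes "arrow_typed \<phi>" "\<And>i. e i * z = z * e i"
  shows "arrow_typed (\<lambda>x. z * \<phi> x)" "arrow_typed (\<lambda>x. \<phi> x * z)"
proof -
  have \<phi>: "e (arrow_target x) * \<phi> x = \<phi> x" "\<phi> x * e (arrow_source x) = \<phi> x" for x
    using assms(1) by (simp_all add: arrow_typed_def)
  show "arrow_typed (\<lambda>x. z * \<phi> x)" "arrow_typed (\<lambda>x. \<phi> x * z)"
  proof -
    have "e (arrow_target x) * (z * \<phi> x) = z * (e (arrow_target x) * \<phi> x)"
      "\<phi> x * z * e (arrow_source x) = \<phi> x * e (arrow_source x) * z" for x
      by (simp_all only: mult.assoc[symmetric] assms(2)) (simp only: mult.assoc assms(2))
    moreover have "z * \<phi> x * e (arrow_source x) = z * (\<phi> x * e (arrow_source x))"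
      "e (arrow_target x) * (\<phi> x * z) = e (arrow_target x) * \<phi> x * z" for x
      by (simp_all only: mult.assoc)
    ultimately show "arrow_typed (\<lambda>x. z * \<phi> x)" "arrow_typed (\<lambda>x. \<phi> x * z)"
      unfolding arrow_typed_def by (simp_all only: \<phi> simp_thms)
  qed
qed

text \<open>A central factor passes through commutators and through the products in
  \<open>d1\<close>, so multiplying a primitive by it gives a primitive.\<close>

lemma coboundary_central_mult:
  assumes f: "f \<in> coboundaries p" and z: "central z"
  shows "(\<lambda>w. z * f w) \<in> coboundaries p"
proof (cases rule: degree_cases[of p])
  case 2
  obtain y where y: "f \<in> cochains 1" "\<And>i. e i * y = y * e i" "\<And>x. f (arrow_elem x) = y * ar x - ar x * y"
    using f unfolding 2 coboundaries_1 by blast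
  have "z * y * ar x - ar x * (z * y) = z * (y * ar x - ar x * y)" "e i * (z * y) = z * y * e i" for x i
    by (simp_all add: right_diff_distrib mult.assoc central_left_commute[OF z] y(2))
  then show ?thesis unfolding 2 coboundaries_1
    using cochain_central_mult[OF y(1) z] y(3) by (auto intro!: exI[of _ "z * y"])
next
  case 3
  obtain \<phi> where \<phi>: "f \<in> cochains 2" "arrow_typed \<phi>" "\<And>i. f (\<sigma> i) = d1 \<phi> i"
    using f unfolding 3 coboundaries_2 by blast
  have "ar x * (z * y) = z * (ar x * y)" for x y
    by (rule central_left_commute[OF z])
  then have "d1 (\<lambda>x. z * \<phi> x) i = z * d1 \<phi> i" for i
    unfolding d1_def sigma_eval_mult_left[symmetric] by (simp add: mult.assoc distrib_left)
  then show ?thesis unfolding 3 coboundaries_2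
    using cochain_central_mult[OF \<phi>(1) z] arrow_typed_commute_mult(1)[OF \<phi>(2), of z] z \<phi>(3)
    by (auto intro!: exI[of _ "\<lambda>x. z * \<phi> x"] simp: central_def)
qed (use f in \<open>simp_all add: coboundaries_0 coboundaries_ge_3\<close>)

text \<open>The differential consists of the commutators with the arrows, and commuting with the
  vertices is built into a 0-cochain; the two together are centrality by
  \<open>central_iff\<close>.\<close>

lemma cocycles_0: "f \<in> cocycles 0 \<longleftrightarrow> (\<exists>z. central z \<and> f = const_cochain z)"
proof
  assume f: "f \<in> cocycles 0"
  then have c: "f \<in> cochains 0" "koszul_d 0 f = (\<lambda>_. 0)" by (auto simp: cocycles_def)
  have "f path_one * ar x - ar x * f path_one = 0" for x
    using c(2) W1.extend_b[of "\<lambda>x. f path_one * ar x - ar x * f path_one" x] unfolding koszul_d_0[OF c(1)] by metis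
  then have "central (f path_one)" using cochain_0_eq(2)[OF c(1)] by (simp add: central_iff)
  then show "\<exists>z. central z \<and> f = const_cochain z" using cochain_0_eq(1)[OF c(1)] by blast
next
  assume "\<exists>z. central z \<and> f = const_cochain z"
  then obtain z where z: "central z" "f = const_cochain z" by blast
  then have c: "const_cochain z \<in> cochains 0" by (intro const_cochain) (simp add: central_def)
  have "W1.extend (\<lambda>x. 0) = (\<lambda>_. 0)" by (simp add: W1.extend_def fun_eq_iff)
  then show "f \<in> cocycles 0"
    using z koszul_d_0[OF c] c by (simp add: cocycles_def central_def)
qed

lemma cocycle_0_cases:
  assumes "f \<in> cocycles 0" obtains z where "central z" "f = const_cochain z"
  using assms unfolding cocycles_0 by (elim exE conjE)

lemma W2_extend_zero: "W2.extend (\<lambda>i. 0) = (\<lambda>_. 0)"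
  by (simp add: W2.extend_def fun_eq_iff)

lemma cocycles_1: "f \<in> cocycles 1 \<longleftrightarrow> f \<in> cochains 1 \<and> (\<forall>i. d1 (\<lambda>x. f (arrow_elem x)) i = 0)"
proof -
  have *: "W2.extend \<psi> = (\<lambda>_. 0) \<longleftrightarrow> (\<forall>i. \<psi> i = 0)" for \<psi> :: "vertex \<Rightarrow> 'a preproj"
  proof
    assume "W2.extend \<psi> = (\<lambda>_. 0)"
    then show "\<forall>i. \<psi> i = 0" using W2.extend_b[of \<psi>] by metis
  next
    assume "\<forall>i. \<psi> i = 0"
    then have "\<psi> = (\<lambda>i. 0)" by auto
    then show "W2.extend \<psi> = (\<lambda>_. 0)" by (simp add: W2_extend_zero)
  qed
  show ?thesis
  proof (cases "f \<in> cochains 1")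
    case True
    then show ?thesis unfolding cocycles_def mem_Collect_eq koszul_d_1[OF True] * by simp
  qed (simp add: cocycles_def)
qed

lemma cocycles_ge_2: "p \<ge> 2 \<Longrightarrow> cocycles p = cochains p"
  using koszul_d_ge_2 by (auto simp: cocycles_def)

lemma cocycle_cochain: "f \<in> cocycles p \<Longrightarrow> f \<in> cochains p"
  by (simp add: cocycles_def)

lemma zero_cocycle: "(\<lambda>_. 0 :: 'f::field preproj) \<in> cocycles p"
proof (cases rule: degree_cases[of p])
  case 1
  have "const_cochain (0 :: 'f preproj) = (\<lambda>_. 0)" by (simp add: const_cochain_def fun_eq_iff)
  moreover have "central (0 :: 'f preproj)" by (simp add: central_def)
  ultimately show ?thesis unfolding 1 cocycles_0 by (intro exI[of _ 0]) simp
next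
  case 2
  have "d1 (\<lambda>_. 0 :: 'f preproj) i = 0" for i by (cases i) (simp_all add: d1_def)
  then show ?thesis unfolding 2 by (simp add: cocycles_1 zero_cochain)
qed (simp_all add: cocycles_ge_2 zero_cochain)

lemma cocycle_minus: "f \<in> cocycles p \<Longrightarrow> (\<lambda>w. - f w) \<in> cocycles p"
proof (cases rule: degree_cases[of p])
  case 1
  assume "f \<in> cocycles p"
  then obtain z where "central z" "f = const_cochain z" using 1 cocycles_0 by blast
  then have "central (- z)" "(\<lambda>w. - f w) = const_cochain (- z)"
    by (auto simp: central_def const_cochain_def fun_eq_iff)
  then show ?thesis using 1 cocycles_0 by blast
next
  case 2
  assume "f \<in> cocycles p"
  then show ?thesis unfolding 2 by (simp add: cocycles_1 cochain_minus d1_minus)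
qed (simp_all add: cocycles_ge_2 cochain_minus)

section \<open>Cohomology classes\<close>

lemma fun_diff_eq: "f - g = (\<lambda>w. f w - g w)"
  by (simp add: fun_eq_iff)

lemma equiv_cohomologous: "equiv (cocycles p) (cohomologous p)"
proof (rule equivI)
  show "refl_on (cocycles p) (cohomologous p)"
    using coboundary_zero by (auto simp: refl_on_def cohomologous_def fun_diff_eq)
  show "sym (cohomologous p)"
  proof (rule symI)
    fix f g assume "(f, g) \<in> cohomologous p"
    then show "(g, f) \<in> cohomologous p"
      using coboundary_minus[of "f - g" p] by (auto simp: cohomologous_def fun_diff_eq)
  qed
  show "trans (cohomologous p)"
  proof (rule transI)
    fix f g h assume "(f, g) \<in> cohomologous p" "(g, h) \<in> cohomologous p"
    then show "(f, h) \<in> cohomologous p"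
      using coboundary_add[of "f - g" p "g - h"] by (auto simp: cohomologous_def fun_diff_eq)
  qed
qed (auto simp: cohomologous_def)

lemma cls_eq_iff: "f \<in> cocycles p \<Longrightarrow> g \<in> cocycles p \<Longrightarrow> cls p f = cls p g \<longleftrightarrow> (\<lambda>w. f w - g w) \<in> coboundaries p"
  using eq_equiv_class_iff[OF equiv_cohomologous[of p], of f g] by (simp add: cls_def cohomologous_def fun_diff_eq)

lemma cls_mem: "g \<in> cls p f \<longleftrightarrow> f \<in> cocycles p \<and> g \<in> cocycles p \<and> (\<lambda>w. f w - g w) \<in> coboundaries p"
  by (auto simp: cls_def cohomologous_def fun_diff_eq)

lemma cls_HK: "f \<in> cocycles p \<Longrightarrow> cls p f \<in> HK p"
  unfolding HK_def cls_def by (rule quotientI)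

lemma HK_cases:
  assumes "X \<in> HK p" obtains f where "f \<in> cocycles p" "X = cls p f"
  using assms unfolding HK_def cls_def by (auto elim: quotientE)

lemma cls_eq_zero_iff: "f \<in> cocycles p \<Longrightarrow> cls p f = HK_zero p \<longleftrightarrow> f \<in> coboundaries p"
  unfolding HK_zero_def by (simp add: cls_eq_iff zero_cocycle)

lemma cup_right_commute:
  assumes f: "f \<in> cochains p" and g: "g \<in> cocycles 0"
  shows "cup_cochain p 0 f g = cup_cochain 0 p g f"
proof -
  obtain z where z: "central z" "g = const_cochain z" by (rule cocycle_0_cases[OF g])
  show ?thesis
    unfolding cup_0_right[OF f cocycle_cochain[OF g]] cup_0_left[OF cocycle_cochain[OF g] f]
    by (simp add: z(2) centralD[OF z(1)])
qed

text \<open>A factor of degree 0 is multiplication by a central element. A product of two 1-cocycles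
  is a 2-cochain, and those are all cocycles because \<open>W 3\<close> vanishes.\<close>

lemma cup_cochain_cocycle:
  assumes f: "f \<in> cocycles p" and g: "g \<in> cocycles q"
  shows "cup_cochain p q f g \<in> cocycles (p + q)"
proof -
  have zero_left: "cup_cochain 0 q f g \<in> cocycles q" if f0: "f \<in> cocycles 0" and gq: "g \<in> cocycles q" for f g :: "'a cochain" and q
  proof -
    obtain z where z: "central z" "f = const_cochain z" by (rule cocycle_0_cases[OF f0])
    have eq: "cup_cochain 0 q f g = (\<lambda>w. z * g w)"
      using cup_0_left[OF cocycle_cochain[OF f0] cocycle_cochain[OF gq]] z by simp
    show ?thesis unfolding eq
    proof (cases rule: degree_cases[of q])
      case 1
      obtain y where y: "central y" "g = const_cochain y" by (rule cocycle_0_cases[OF gq[unfolded 1]])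
      have "central (z * y)" by (rule central_mult[OF z(1) y(1)])
      moreover have "z * g w = const_cochain (z * y) w" for w
        by (simp add: y(2) const_cochain_def central_left_commute[OF z(1), of "proj w"])
      then have "(\<lambda>w. z * g w) = const_cochain (z * y)" by (rule ext)
      ultimately show "(\<lambda>w. z * g w) \<in> cocycles q" using 1 cocycles_0 by blast
    next
      case 2
      have "ar x * (z * y) = z * (ar x * y)" for x y
        by (rule central_left_commute[OF z(1)])
      then have "d1 (\<lambda>x. z * \<phi> x) i = z * d1 \<phi> i" for i \<phi>
        unfolding d1_def sigma_eval_mult_left[symmetric] by (simp add: mult.assoc distrib_left)
      then show "(\<lambda>w. z * g w) \<in> cocycles q"
        using gq cochain_central_mult[OF cocycle_cochain[OF gq] z(1)] unfolding 2 cocycles_1 by simp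
    qed (use cochain_central_mult[OF cocycle_cochain[OF gq] z(1)] in \<open>simp_all add: cocycles_ge_2\<close>)
  qed
  consider "p = 0" | "q = 0" | "p = 1" "q = 1" | "p + q \<ge> 3" by linarith
  then show ?thesis
  proof cases
    case 1 then show ?thesis using zero_left[of f g q] f g by simp
  next
    case 2 then show ?thesis using zero_left[of g f p] f g cup_right_commute[of f p g] by (simp add: cocycle_cochain)
  next
    case 3
    have "p + q = 2" using 3 by simp
    then show ?thesis
      using f g cup_1_1[of f g] unfolding 3
      by (simp add: cocycles_ge_2 W2_extend_cochain vertex_typed_cup11 cochain_1_typed cocycle_cochain)
  next
    case 4 then show ?thesis using cup_ge_3[of f p g q] f g zero_cocycle by (simp add: cocycle_cochain)
  qed
qed

section \<open>Products of cocycles with coboundaries\<close>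

lemma sigma_eval_product_rule:
  assumes "\<And>i. d1 \<phi> i = 0"
  shows "sigma_eval (\<lambda>x. ar x * \<phi> (bar x)) i = - sigma_eval (\<lambda>x. \<phi> x * ar (bar x)) i"
  using assms[of i] unfolding d1_def sigma_eval_add by (simp add: eq_neg_iff_add_eq_0 add.commute)

text \<open>A graded Leibniz rule. The cocycle condition, in the form
  \<open>sigma_eval_product_rule\<close>, trades the terms \<open>ar x * \<phi> (bar x)\<close> for
  the negatives of \<open>\<phi> x * ar (bar x)\<close>.\<close>

lemma cup11_commutator_right:
  assumes "\<And>i. d1 \<phi> i = 0"
  shows "cup11 \<phi> (\<lambda>x. z * ar x - ar x * z) i = d1 (\<lambda>x. - (\<phi> x * z)) i"
proof -
  have "d1 (\<lambda>x. - (\<phi> x * z)) i = - sigma_eval (\<lambda>x. \<phi> x * z * ar (bar x) + ar x * \<phi> (bar x) * z) i"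
    unfolding d1_def sigma_eval_minus[symmetric] by (simp add: mult.assoc)
  also have "\<dots> = - sigma_eval (\<lambda>x. \<phi> x * z * ar (bar x)) i - sigma_eval (\<lambda>x. ar x * \<phi> (bar x)) i * z"
    by (simp add: sigma_eval_add sigma_eval_mult_right)
  also have "\<dots> = - sigma_eval (\<lambda>x. \<phi> x * z * ar (bar x)) i + sigma_eval (\<lambda>x. \<phi> x * ar (bar x) * z) i"
    by (simp add: sigma_eval_product_rule[OF assms] sigma_eval_mult_right)
  also have "\<dots> = cup11 \<phi> (\<lambda>x. z * ar x - ar x * z) i"
    by (simp add: cup11_def right_diff_distrib sigma_eval_diff mult.assoc)
  finally show ?thesis ..
qed

lemma cup11_commutator_left:
  assumes "\<And>i. d1 \<psi> i = 0"
  shows "cup11 (\<lambda>x. z * ar x - ar x * z) \<psi> i = d1 (\<lambda>x. z * \<psi> x) i"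
proof -
  have "d1 (\<lambda>x. z * \<psi> x) i = z * sigma_eval (\<lambda>x. \<psi> x * ar (bar x)) i + sigma_eval (\<lambda>x. ar x * z * \<psi> (bar x)) i"
    unfolding d1_def sigma_eval_mult_left[symmetric] sigma_eval_add[symmetric] by (simp add: mult.assoc)
  also have "sigma_eval (\<lambda>x. \<psi> x * ar (bar x)) i = - sigma_eval (\<lambda>x. ar x * \<psi> (bar x)) i"
    by (simp add: sigma_eval_product_rule[OF assms])
  finally show ?thesis
    by (simp add: cup11_def left_diff_distrib sigma_eval_diff mult.assoc sigma_eval_mult_left)
qed

lemma cup_cochain_cong_right:
  assumes f: "f \<in> cocycles p" and g: "g \<in> cocycles q" "g' \<in> cocycles q"
    and d: "(\<lambda>w. g w - g' w) \<in> coboundaries q"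
  shows "(\<lambda>w. cup_cochain p q f g w - cup_cochain p q f g' w) \<in> coboundaries (p + q)"
proof -
  note c = cocycle_cochain[OF f] cocycle_cochain[OF g(1)] cocycle_cochain[OF g(2)]
  consider "p = 0" | "q = 0" | "p = 1" "q = 1" | "p + q \<ge> 3" by linarith
  then show ?thesis
  proof cases
    case 1
    then obtain z where z: "central z" "f = const_cochain z" using f cocycles_0 by blast
    then show ?thesis
      using c coboundary_central_mult[OF d z(1)] unfolding 1 by (simp add: cup_0_left right_diff_distrib)
  next
    case 2
    then have "g = g'" using d by (auto simp: coboundaries_0 fun_eq_iff)
    then show ?thesis using coboundary_zero by simp
  next
    case 3
    obtain z where z: "\<And>i. e i * z = z * e i" "\<And>x. g (arrow_elem x) - g' (arrow_elem x) = z * ar x - ar x * z"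
      using d unfolding 3 coboundaries_1 by blast
    let ?v = "\<lambda>f x. f (arrow_elem x)"
    have df: "d1 (?v f) i = 0" for i using f unfolding 3 cocycles_1 by blast
    have typed: "vertex_typed (cup11 (?v f) (?v g))" "vertex_typed (cup11 (?v f) (?v g'))"
      using c unfolding 3 by (simp_all add: vertex_typed_cup11 cochain_1_typed)
    have "cup11 (?v f) (?v g) i - cup11 (?v f) (?v g') i = cup11 (?v f) (\<lambda>x. z * ar x - ar x * z) i" for i
      unfolding z(2)[symmetric] by (simp add: cup11_def right_diff_distrib sigma_eval_diff)
    also have "\<dots> i = d1 (\<lambda>x. - (?v f x * z)) i" for i
      by (rule cup11_commutator_right[OF df])
    finally have "(\<lambda>w. W2.extend (cup11 (?v f) (?v g)) w - W2.extend (cup11 (?v f) (?v g')) w) \<in> coboundaries 2"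
      unfolding coboundaries_2
      using cochain_diff[OF W2_extend_cochain[OF typed(1)] W2_extend_cochain[OF typed(2)]]
        arrow_typed_minus[OF arrow_typed_commute_mult(2)[OF cochain_1_typed z(1)], of f] c(1) 3
      by (auto simp: W2.extend_b)
    then show ?thesis using c cup_1_1[of f] unfolding 3 by (simp add: one_add_one)
  next
    case 4 then show ?thesis
      using cup_ge_3[OF c(1) c(2)] cup_ge_3[OF c(1) c(3)] coboundary_zero[of "p + q"] by simp
  qed
qed

lemma cup_cochain_cong_left:
  assumes f: "f \<in> cocycles p" "f' \<in> cocycles p" and g: "g \<in> cocycles q"
    and d: "(\<lambda>w. f w - f' w) \<in> coboundaries p"
  shows "(\<lambda>w. cup_cochain p q f g w - cup_cochain p q f' g w) \<in> coboundaries (p + q)"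
proof -
  note c = cocycle_cochain[OF f(1)] cocycle_cochain[OF f(2)] cocycle_cochain[OF g]
  consider "p = 0" | "q = 0" | "p = 1" "q = 1" | "p + q \<ge> 3" by linarith
  then show ?thesis
  proof cases
    case 1
    then have "f = f'" using d by (auto simp: coboundaries_0 fun_eq_iff)
    then show ?thesis using coboundary_zero by simp
  next
    case 2
    then show ?thesis
      using cup_cochain_cong_right[of g 0 f p f'] f g d cup_right_commute[of f p g] cup_right_commute[of f' p g] c by simp
  next
    case 3
    obtain z where z: "\<And>i. e i * z = z * e i" "\<And>x. f (arrow_elem x) - f' (arrow_elem x) = z * ar x - ar x * z"
      using d unfolding 3 coboundaries_1 by blast
    let ?v = "\<lambda>f x. f (arrow_elem x)"
    have dg: "d1 (?v g) i = 0" for i using g unfolding 3 cocycles_1 by blast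
    have typed: "vertex_typed (cup11 (?v f) (?v g))" "vertex_typed (cup11 (?v f') (?v g))"
      using c unfolding 3 by (simp_all add: vertex_typed_cup11 cochain_1_typed)
    have "cup11 (?v f) (?v g) i - cup11 (?v f') (?v g) i = cup11 (\<lambda>x. z * ar x - ar x * z) (?v g) i" for i
      unfolding z(2)[symmetric] by (simp add: cup11_def left_diff_distrib sigma_eval_diff)
    also have "\<dots> i = d1 (\<lambda>x. z * ?v g x) i" for i
      by (rule cup11_commutator_left[OF dg])
    finally have "(\<lambda>w. W2.extend (cup11 (?v f) (?v g)) w - W2.extend (cup11 (?v f') (?v g)) w) \<in> coboundaries 2"
      unfolding coboundaries_2
      using cochain_diff[OF W2_extend_cochain[OF typed(1)] W2_extend_cochain[OF typed(2)]]
        arrow_typed_commute_mult(1)[OF cochain_1_typed z(1), of g] c(3) 3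
      by (auto simp: W2.extend_b)
    then show ?thesis using c cup_1_1[of f g] cup_1_1[of f' g] unfolding 3 by (simp add: one_add_one)
  next
    case 4 then show ?thesis
      using cup_ge_3[OF c(1) c(3)] cup_ge_3[OF c(2) c(3)] coboundary_zero[of "p + q"] by simp
  qed
qed

text \<open>The union in \<open>cup\<close> runs over all representatives; it collapses because any
  two pairs of representatives give the same class.\<close>

lemma cup_cls:
  assumes f: "f \<in> cocycles p" and g: "g \<in> cocycles q"
  shows "cls p f \<smile>\<^bsub>p,q\<^esub> cls q g = cls (p + q) (cup_cochain p q f g)"
proof -
  have "cls (p + q) (cup_cochain p q f' g') = cls (p + q) (cup_cochain p q f g)"
    if "f' \<in> cls p f" "g' \<in> cls q g" for f' g'
  proof -
    have f': "f' \<in> cocycles p" "(\<lambda>w. f w - f' w) \<in> coboundaries p"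
      and g': "g' \<in> cocycles q" "(\<lambda>w. g w - g' w) \<in> coboundaries q"
      using that by (simp_all add: cls_mem)
    have "cls (p + q) (cup_cochain p q f g) = cls (p + q) (cup_cochain p q f g')"
      by (subst cls_eq_iff) (intro cup_cochain_cocycle cup_cochain_cong_right f g f' g')+
    also have "\<dots> = cls (p + q) (cup_cochain p q f' g')"
      by (subst cls_eq_iff) (intro cup_cochain_cocycle cup_cochain_cong_left f g f' g')+
    finally show ?thesis ..
  qed
  moreover have "f \<in> cls p f" "g \<in> cls q g"
    using f g coboundary_zero by (simp_all add: cls_mem)
  ultimately show ?thesis unfolding cup_def by blast
qed

lemma signed_cls:
  assumes f: "f \<in> cocycles p"
  shows "signed n (cls p f) = cls p (\<lambda>w. (-1) ^ n * f w)"
proof (cases "even n")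
  case True
  then show ?thesis by (simp add: signed_def)
next
  case False
  have iff: "(\<lambda>w. - g w) \<in> cls p (\<lambda>w. - f w) \<longleftrightarrow> g \<in> cls p f" for g
  proof -
    have "g \<in> cocycles p \<longleftrightarrow> (\<lambda>w. - g w) \<in> cocycles p"
      using cocycle_minus[of g p] cocycle_minus[of "\<lambda>w. - g w" p] by auto
    moreover have "(\<lambda>w. f w - g w) \<in> coboundaries p \<longleftrightarrow> (\<lambda>w. - f w - - g w) \<in> coboundaries p"
      using coboundary_minus[of "\<lambda>w. f w - g w" p] coboundary_minus[of "\<lambda>w. - f w - - g w" p]
      by (auto simp: algebra_simps)
    ultimately show ?thesis using f cocycle_minus[OF f] by (simp add: cls_mem)
  qed
  have "(\<lambda>g w. - g w) ` cls p f = cls p (\<lambda>w. - f w)"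
  proof (intro equalityI subsetI)
    fix g assume "g \<in> cls p (\<lambda>w. - f w)"
    then have "(\<lambda>w. - g w) \<in> cls p f" using iff[of "\<lambda>w. - g w"] by simp
    then show "g \<in> (\<lambda>g w. - g w) ` cls p f" by (intro image_eqI[of _ _ "\<lambda>w. - g w"]) simp_all
  qed (auto simp: iff)
  then show ?thesis using False by (simp add: signed_def)
qed

section \<open>Graded commutativity\<close>

text \<open>The empty word is 1 and not a vertex idempotent, so the vertex of a trivial path is
  lost; \<open>proj_path\<close> restores it by the factor \<open>e (source p)\<close>.\<close>

fun word :: "arrow list \<Rightarrow> 'f::field preproj" where
  "word [] = 1"
| "word (a # as) = ar a * word as"

fun word_derivation :: "(arrow \<Rightarrow> 'f::field preproj) \<Rightarrow> arrow list \<Rightarrow> 'f preproj" where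
  "word_derivation \<phi> [] = 0"
| "word_derivation \<phi> (a # as) = \<phi> a * word as + ar a * word_derivation \<phi> as"

lemma word_append: "word (as @ bs) = word as * word bs"
  by (induction as) (simp_all add: mult.assoc)

lemma word_derivation_append:
  "word_derivation \<phi> (as @ bs) = word_derivation \<phi> as * word bs + word as * word_derivation \<phi> bs"
  by (induction as) (simp_all add: word_append mult.assoc distrib_left distrib_right)

lemma e_mult_word: "walk i as \<Longrightarrow> e (walk_end i as) * word as = (word as * e i :: 'f::field preproj)"
proof (induction as)
  case (Cons a as)
  then have IH: "e (arrow_source a) * word as = (word as * e i :: 'f preproj)" by simp
  have "e (arrow_target a) * (ar a * word as) = (ar a * word as :: 'f preproj)"
    by (simp add: mult.assoc[symmetric] e_mult_ar)
  moreover have "ar a * word as * e i = (ar a * e (arrow_source a) * word as :: 'f preproj)"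
    by (simp only: mult.assoc IH)
  ultimately show ?case by (simp add: ar_mult_e)
qed simp

lemma word_derivation_typed:
  fixes \<phi> :: "arrow \<Rightarrow> 'f::field preproj"
  assumes "arrow_typed \<phi>" "walk i as"
  shows "e (walk_end i as) * word_derivation \<phi> as = word_derivation \<phi> as"
    and "word_derivation \<phi> as * e i = word_derivation \<phi> as"
proof -
  have \<phi>: "e (arrow_target x) * \<phi> x = \<phi> x" "\<phi> x * e (arrow_source x) = \<phi> x" for x
    using assms(1) by (simp_all add: arrow_typed_def)
  show "e (walk_end i as) * word_derivation \<phi> as = word_derivation \<phi> as"
    by (cases as) (simp_all add: distrib_left mult.assoc[symmetric] \<phi> e_mult_ar)
  show "word_derivation \<phi> as * e i = word_derivation \<phi> as"
    using assms(2)
  proof (induction as)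
    case (Cons a as)
    then have "e (arrow_source a) * word as = (word as * e i :: 'f preproj)"
      using e_mult_word[of i as, where ?'f = 'f] by simp
    then have "\<phi> a * word as * e i = \<phi> a * e (arrow_source a) * word as"
      by (simp only: mult.assoc)
    then have "\<phi> a * (word as * e i) = \<phi> a * word as" by (simp only: \<phi> mult.assoc[symmetric])
    with Cons show ?case by (simp add: distrib_right mult.assoc)
  qed simp
qed

lemma proj_path: "proj (Poly_Mapping.single p 1) = word (snd (Rep_path p)) * e (source p)"
proof (induction "path_length p" arbitrary: p)
  case 0
  then obtain i where "p = trivial_path i" using path_length_0_iff by metis
  then show ?case by (simp add: vertex_elem_def trivial_path.rep_eq)
next
  case (Suc n)
  obtain i as where p: "Rep_path p = (i, as)" by (cases "Rep_path p")
  with Suc.hyps(2) obtain a bs where as: "as = a # bs" by (cases as) (auto simp: path_length.rep_eq)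
  have w: "walk i as" using Rep_path[of p] p by simp
  define q where "q = Abs_path (i, bs)"
  have q: "Rep_path q = (i, bs)" unfolding q_def by (rule Rep_Abs_path) (use w as in simp)
  have tq: "source (arrow_path a) = target q"
    using w as by (simp add: target.rep_eq q)
  have pq: "p = compose (arrow_path a) q"
    using w as p q by (simp add: Rep_path_inject[symmetric] compose.rep_eq arrow_path.rep_eq)
  have "Poly_Mapping.single p 1 = (arrow_elem a :: path \<Rightarrow>\<^sub>0 'a) \<star> Poly_Mapping.single q 1"
    using tq by (simp add: arrow_elem_def path_mult_single pq)
  then have "proj (Poly_Mapping.single p 1) = (ar a :: 'a preproj) * proj (Poly_Mapping.single q 1)"
    by (simp only: proj_mult)
  moreover have "n = path_length q" using Suc.hyps(2) p q as by (simp add: path_length.rep_eq)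
  moreover have "source p = source q" using p q by (simp add: source.rep_eq)
  ultimately show ?case using Suc.hyps(1)[of q] p q as by (simp add: mult.assoc)
qed

section \<open>The derivation of A defined by a 1-cocycle\<close>

definition path_derivation :: "(arrow \<Rightarrow> 'f::field preproj) \<Rightarrow> (path \<Rightarrow>\<^sub>0 'f) \<Rightarrow> 'f preproj" where
  "path_derivation \<phi> x = (\<Sum>p\<in>keys x. scalar (lookup x p) * word_derivation \<phi> (snd (Rep_path p)))"

lemma path_derivation_superset:
  assumes "finite S" "keys x \<subseteq> S"
  shows "path_derivation \<phi> x = (\<Sum>p\<in>S. scalar (lookup x p) * word_derivation \<phi> (snd (Rep_path p)))"
  unfolding path_derivation_def
  by (rule sum.mono_neutral_left) (use assms in \<open>auto simp: in_keys_iff\<close>)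

lemma path_derivation_0 [simp]: "path_derivation \<phi> 0 = 0"
  by (simp add: path_derivation_def)

lemma path_derivation_add: "path_derivation \<phi> (x + y) = path_derivation \<phi> x + path_derivation \<phi> y"
proof -
  let ?S = "keys x \<union> keys y"
  show ?thesis
    using path_derivation_superset[of ?S x \<phi>] path_derivation_superset[of ?S y \<phi>]
      path_derivation_superset[of ?S "x + y" \<phi>] keys_add[of x y]
    by (simp add: lookup_add scalar_add distrib_right sum.distrib)
qed

lemma path_derivation_single:
  "path_derivation \<phi> (Poly_Mapping.single p c) = scalar c * word_derivation \<phi> (snd (Rep_path p))"
  by (subst path_derivation_superset[of "{p}"]) simp_all

lemma path_derivation_scale: "path_derivation \<phi> (scale c x) = scalar c * path_derivation \<phi> x"
  by (induction x rule: path_elem_induct)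
     (simp_all add: scale_single path_derivation_single scalar_mult mult.assoc path_derivation_add
       path_algebra.scale_right_distrib distrib_left)

lemma path_derivation_minus: "path_derivation \<phi> (- x) = - path_derivation \<phi> x"
  using path_derivation_add[of \<phi> "-x" x] by (simp add: eq_neg_iff_add_eq_0)

lemma path_derivation_diff: "path_derivation \<phi> (x - y) = path_derivation \<phi> x - path_derivation \<phi> y"
  using path_derivation_add[of \<phi> x "-y"] by (simp add: path_derivation_minus)

text \<open>For paths that do not compose the left side is zero, and each term on the right contains
  a product of two distinct vertex idempotents.\<close>

lemma path_derivation_mult_path:
  assumes \<phi>: "arrow_typed \<phi>"
  shows "path_derivation \<phi> (Poly_Mapping.single p 1 \<star> Poly_Mapping.single q 1) =
    path_derivation \<phi> (Poly_Mapping.single p 1) * proj (Poly_Mapping.single q 1) +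
    proj (Poly_Mapping.single p 1) * path_derivation \<phi> (Poly_Mapping.single q 1)"
proof -
  obtain i as where p: "Rep_path p = (i, as)" by (cases "Rep_path p")
  obtain j bs where q: "Rep_path q = (j, bs)" by (cases "Rep_path q")
  have wp: "walk i as" and wq: "walk j bs"
    using Rep_path[of p] Rep_path[of q] p q by simp_all
  have sp: "source p = i" and sq: "source q = j" and tq: "target q = walk_end j bs"
    using p q by (simp_all add: source.rep_eq target.rep_eq)
  let ?D = "word_derivation \<phi>"
  note Dp = word_derivation_typed(2)[OF \<phi> wp] and Dq = word_derivation_typed(1)[OF \<phi> wq]
  have "?D as * (word bs * e j) = ?D as * e i * (e (walk_end j bs) * word bs)"
    unfolding e_mult_word[OF wq] Dp ..
  then have l: "?D as * (word bs * e j) = (?D as * (e i * e (walk_end j bs))) * word bs"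
    by (simp only: mult.assoc)
  have "word as * e i * ?D bs = word as * e i * (e (walk_end j bs) * ?D bs)"
    unfolding Dq ..
  then have r: "word as * e i * ?D bs = word as * (e i * e (walk_end j bs)) * ?D bs"
    by (simp only: mult.assoc)
  show ?thesis
  proof (cases "i = walk_end j bs")
    case True
    have "?D as * (word bs * e j) = ?D as * word bs"
      using l unfolding True e_mult_e using Dp[unfolded True] by simp
    moreover have "word as * e i * ?D bs = word as * ?D bs"
      unfolding mult.assoc using Dq unfolding True by simp
    ultimately show ?thesis
      using True by (simp add: path_mult_single path_derivation_single proj_path sp sq tq p q compose.rep_eq
          word_derivation_append)
  next
    case False
    then show ?thesis
      using l r by (simp add: path_mult_single path_derivation_single proj_path sp sq tq p q e_mult_e)
  qed
qed

lemma single_eq_scale: "Poly_Mapping.single p c = scale c (Poly_Mapping.single p 1)"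
  by (simp add: scale_single)

lemma path_derivation_mult:
  assumes \<phi>: "arrow_typed \<phi>"
  shows "path_derivation \<phi> (x \<star> y) = path_derivation \<phi> x * proj y + proj x * path_derivation \<phi> y"
proof (induction x rule: path_elem_induct)
  case (single p c)
  show ?case
  proof (induction y rule: path_elem_induct)
    case (single q d)
    let ?p = "Poly_Mapping.single p 1 :: path \<Rightarrow>\<^sub>0 'a" and ?q = "Poly_Mapping.single q 1 :: path \<Rightarrow>\<^sub>0 'a"
    have "path_derivation \<phi> (scale c ?p \<star> scale d ?q) = scalar c * (scalar d * path_derivation \<phi> (?p \<star> ?q))"
      by (simp only: path_mult_scale_left path_derivation_scale) (simp only: path_mult_scale_right path_derivation_scale)
    also have "\<dots> = scalar c * path_derivation \<phi> ?p * (scalar d * proj ?q)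
        + scalar c * proj ?p * (scalar d * path_derivation \<phi> ?q)"
      unfolding path_derivation_mult_path[OF \<phi>]
      by (simp only: distrib_left mult.assoc scalar_left_commute[of "path_derivation \<phi> ?p"] scalar_left_commute[of "proj ?p"])
    finally show ?case
      unfolding single_eq_scale[of p c] single_eq_scale[of q d] by (simp only: path_derivation_scale proj_scale)
  qed (simp_all add: path_mult_add_right path_derivation_add distrib_left proj_add algebra_simps)
qed (simp_all add: path_mult_add_left path_derivation_add distrib_right proj_add algebra_simps)

lemma path_derivation_arrow: "path_derivation \<phi> (arrow_elem a) = \<phi> a"
  by (simp add: arrow_elem_def path_derivation_single arrow_path.rep_eq)

text \<open>The derivation takes the value \<open>d1 \<phi> i\<close> on the relation at
  \<open>i\<close>, so the cocycle condition is what lets it descend to A. On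
  \<open>u \<star> r \<star> v\<close> the other two terms contain \<open>proj r\<close>, which is
  zero.\<close>

lemma path_derivation_ideal:
  assumes \<phi>: "arrow_typed \<phi>" and d: "\<And>i. d1 \<phi> i = 0" and x: "x \<in> relation_ideal"
  shows "path_derivation \<phi> x = 0"
proof -
  have sigma: "path_derivation \<phi> (\<sigma> i) = 0" for i
    using d[of i]
    by (cases i) (simp_all add: path_derivation_minus path_derivation_diff path_derivation_add
        path_derivation_mult[OF \<phi>] path_derivation_arrow d1_def)
  have R: "path_derivation \<phi> r = 0 \<and> proj r = 0" if "r \<in> R_space" for r
    using that unfolding R_space_def
  proof (induction rule: path_algebra.span_induct_alt)
    case (step c s y)
    then obtain i where "s = \<sigma> i" by blast
    with step show ?case by (simp add: path_derivation_add path_derivation_scale proj_add proj_scale sigma proj_sigma)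
  qed simp
  show ?thesis
    using x unfolding relation_ideal_def
  proof (induction rule: path_algebra.span_induct_alt)
    case (step c s y)
    then obtain u r v where s: "s = u \<star> r \<star> v" "r \<in> R_space" by blast
    have "path_derivation \<phi> s = 0"
      using R[OF s(2)] by (simp add: s(1) path_derivation_mult[OF \<phi>] proj_mult)
    with step show ?case by (simp add: path_derivation_add path_derivation_scale)
  qed simp
qed

lemma derivation_exists:
  fixes \<phi> :: "arrow \<Rightarrow> 'f::field preproj"
  assumes \<phi>: "arrow_typed \<phi>" and d: "\<And>i. d1 \<phi> i = 0"
  obtains D :: "'f preproj \<Rightarrow> 'f preproj"
  where "\<And>x y. D (x + y) = D x + D y" "\<And>x y. D (x * y) = D x * y + x * D y"
    "\<And>a. D (ar a) = \<phi> a" "\<And>i. D (e i) = 0"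
proof -
  \<comment> \<open>The value at an arbitrary preimage; \<open>path_derivation_ideal\<close> makes
    the choice immaterial.\<close>
  define D where "D x = path_derivation \<phi> (SOME y. proj y = x)" for x
  have D: "D (proj y) = path_derivation \<phi> y" for y
  proof -
    have "proj (SOME y'. proj y' = proj y) = proj y" by (rule someI) (rule refl)
    then have "(SOME y'. proj y' = proj y) - y \<in> relation_ideal" by (simp only: proj_eq_iff)
    from path_derivation_ideal[OF \<phi> d this] show ?thesis
      by (simp add: D_def path_derivation_diff)
  qed
  show thesis
  proof (rule that[of D])
    fix x y :: "'f preproj"
    obtain x' y' where xy: "x = proj x'" "y = proj y'" using proj_surj by metis
    show "D (x + y) = D x + D y" unfolding xy proj_add[symmetric] D by (rule path_derivation_add)
    show "D (x * y) = D x * y + x * D y"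
      unfolding xy proj_mult[symmetric] D by (rule path_derivation_mult[OF \<phi>])
  next
    show "D (ar a) = \<phi> a" for a by (simp add: D path_derivation_arrow)
    show "D (e i) = 0" for i
      by (simp add: D vertex_elem_def path_derivation_single trivial_path.rep_eq)
  qed
qed

text \<open>The derivation \<open>D\<close> that extends \<open>\<phi>\<close> is applied to the
  equation \<open>d1 \<psi> i = 0\<close>. By the Leibniz rule this gives \<open>d1\<close> of the
  composite of \<open>D\<close> with \<open>\<psi>\<close> plus mixed terms, which are the two
  products up to sign.\<close>

lemma cup11_graded_commutative:
  assumes \<phi>: "arrow_typed \<phi>" "\<And>i. d1 \<phi> i = 0" and \<psi>: "arrow_typed \<psi>" "\<And>i. d1 \<psi> i = 0"
  obtains \<omega> where "arrow_typed \<omega>" "\<And>i. cup11 \<phi> \<psi> i + cup11 \<psi> \<phi> i = d1 \<omega> i"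
proof -
  obtain D where D: "\<And>x y. D (x + y) = D x + D y" "\<And>x y. D (x * y) = D x * y + x * D y"
    "\<And>a. D (ar a) = \<phi> a" "\<And>i. D (e i) = 0"
    using derivation_exists[OF \<phi>] by metis
  have D0: "D 0 = 0" using D(1)[of 0 0] by simp
  have Dm: "D (- x) = - D x" for x using D(1)[of "-x" x] D0 by (simp add: eq_neg_iff_add_eq_0)
  have Dd: "D (x - y) = D x - D y" for x y using D(1)[of x "-y"] Dm by simp
  have Ds: "D (sigma_eval \<mu> i) = sigma_eval (\<lambda>x. D (\<mu> x)) i" for \<mu> i
    by (cases i) (simp_all add: D(1) Dm Dd)
  have typed: "arrow_typed (\<lambda>x. D (\<psi> x))"
    unfolding arrow_typed_def
  proof
    fix x
    have "e (arrow_target x) * \<psi> x = \<psi> x" "\<psi> x * e (arrow_source x) = \<psi> x"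
      using \<psi>(1) by (simp_all add: arrow_typed_def)
    then show "e (arrow_target x) * D (\<psi> x) = D (\<psi> x) \<and> D (\<psi> x) * e (arrow_source x) = D (\<psi> x)"
      using D(2)[of "e (arrow_target x)" "\<psi> x"] D(2)[of "\<psi> x" "e (arrow_source x)"] by (simp add: D(4))
  qed
  have "d1 (\<lambda>x. D (\<psi> x)) i = cup11 \<phi> \<psi> i + cup11 \<psi> \<phi> i" for i
  proof -
    have "D (\<psi> x * ar (bar x) + ar x * \<psi> (bar x)) =
        (D (\<psi> x) * ar (bar x) + ar x * D (\<psi> (bar x))) + (\<psi> x * \<phi> (bar x) + \<phi> x * \<psi> (bar x))" for x
      by (simp add: D(1-3))
    then have "D (d1 \<psi> i) = d1 (\<lambda>x. D (\<psi> x)) i + (sigma_eval (\<lambda>x. \<psi> x * \<phi> (bar x)) i + sigma_eval (\<lambda>x. \<phi> x * \<psi> (bar x)) i)"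
      unfolding d1_def Ds by (simp only: sigma_eval_add)
    then show ?thesis
      unfolding \<psi>(2) D0 cup11_def by (simp add: eq_neg_iff_add_eq_0 algebra_simps)
  qed
  then show thesis using that[OF typed] by metis
qed

lemma cup_graded_commutative:
  fixes X Y :: "'f::field cochain set"
  assumes X: "X \<in> HK p" and Y: "Y \<in> HK q"
  shows "X \<smile>\<^bsub>p,q\<^esub> Y = signed (p * q) (Y \<smile>\<^bsub>q,p\<^esub> X)"
proof -
  obtain f where f: "f \<in> cocycles p" "X = cls p f" using X by (rule HK_cases)
  obtain g where g: "g \<in> cocycles q" "Y = cls q g" using Y by (rule HK_cases)
  have c: "f \<in> cochains p" "g \<in> cochains q" using f(1) g(1) by (simp_all add: cocycle_cochain)
  let ?l = "cup_cochain p q f g" and ?r = "\<lambda>w. (-1) ^ (p * q) * cup_cochain q p g f w"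
  have gf: "cup_cochain q p g f \<in> cocycles (p + q)"
    using cup_cochain_cocycle[OF g(1) f(1)] by (simp add: add.commute)
  have r: "?r \<in> cocycles (p + q)"
    by (cases "even (p * q)") (simp_all add: gf cocycle_minus)
  have "(\<lambda>w. ?l w - ?r w) \<in> coboundaries (p + q)"
  proof -
    consider "p = 0" | "q = 0" | "p = 1" "q = 1" | "p + q \<ge> 3" by linarith
    then show ?thesis
    proof cases
      case 1
      have "cup_cochain q 0 g f = cup_cochain 0 q f g" by (rule cup_right_commute[OF c(2) f(1)[unfolded 1]])
      then show ?thesis using coboundary_zero[of "p + q"] unfolding 1 by simp
    next
      case 2
      have "cup_cochain p 0 f g = cup_cochain 0 p g f" by (rule cup_right_commute[OF c(1) g(1)[unfolded 2]])
      then show ?thesis using coboundary_zero[of "p + q"] unfolding 2 by simp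
    next
      case 3
      let ?\<phi> = "\<lambda>x. f (arrow_elem x)" and ?\<psi> = "\<lambda>x. g (arrow_elem x)"
      have fg: "f \<in> cocycles 1" "g \<in> cocycles 1" "f \<in> cochains 1" "g \<in> cochains 1"
        using f(1) g(1) c unfolding 3 by simp_all
      have df: "d1 ?\<phi> i = 0" "d1 ?\<psi> i = 0" for i
        using fg(1,2) unfolding cocycles_1 by blast+
      note typed = cochain_1_typed[OF fg(3)] cochain_1_typed[OF fg(4)]
      obtain \<omega> where \<omega>: "arrow_typed \<omega>" "\<And>i. cup11 ?\<phi> ?\<psi> i + cup11 ?\<psi> ?\<phi> i = d1 \<omega> i"
        using cup11_graded_commutative[OF typed(1) df(1) typed(2) df(2)] by metis
      have "(\<lambda>w. W2.extend (cup11 ?\<phi> ?\<psi>) w + W2.extend (cup11 ?\<psi> ?\<phi>) w) \<in> coboundaries 2"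
        unfolding coboundaries_2
        using cochain_add[OF W2_extend_cochain[OF vertex_typed_cup11[OF typed]]
            W2_extend_cochain[OF vertex_typed_cup11[OF typed(2,1)]]] \<omega>
        by (auto simp: W2.extend_b)
      then show ?thesis
        unfolding 3 cup_1_1[OF fg(3,4)] cup_1_1[OF fg(4,3)] by (simp add: one_add_one)
    next
      case 4
      then show ?thesis
        using cup_ge_3[OF c 4] cup_ge_3[OF c(2,1)] coboundary_zero[of "p + q"] by (simp add: add.commute)
    qed
  qed
  then have "cls (p + q) ?l = cls (p + q) ?r"
    using cls_eq_iff[OF cup_cochain_cocycle[OF f(1) g(1)] r] by blast
  also have "\<dots> = signed (p * q) (cls (p + q) (cup_cochain q p g f))"
    using signed_cls[OF gf] by simp
  finally show ?thesis
    unfolding f(2) g(2) cup_cls[OF f(1) g(1)] cup_cls[OF g(1) f(1)] by (simp only: add.commute)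
qed

section \<open>Computing in the preprojective algebra\<close>

text \<open>The rules of \<open>path_rules\<close> form a noncommutative Groebner basis of the relations, for a degree-lexicographic
  order; each rule has a variant for words that continue to the right. A rule of degree at least 3 is the
  critical pair of the two named rules, whose left-hand sides overlap in the words \<open>s\<close> and \<open>t\<close>.\<close>

named_theorems path_rules

text \<open>The word \<open>u * t = s * v\<close> is rewritten by each of the two given rules; the
  difference of the results is the new rule, with the opposite sign in
  \<open>overlap_sym\<close>.\<close>

lemma overlap:
  fixes l :: "'a::ring"
  assumes "u = u'" "v = v'" "u * t = s * v" "l - r = u' * t - s * v'"
  shows "l = r"
  using assms by simp

lemma overlap_sym:
  fixes l :: "'a::ring"
  assumes "u = u'" "v = v'" "u * t = s * v" "l - r = s * v' - u' * t"
  shows "l = r"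
  using assms by simp

lemma times_right: "u = v \<Longrightarrow> u * x = v * x" for u :: "'a::ring"
  by simp

lemmas path_distribs = mult.assoc distrib_right left_diff_distrib minus_mult_left[symmetric] mult_zero_left

lemma rule_0s0 [path_rules]: "a\<^sub>0\<^sup>* * a\<^sub>0 = 0"
  using proj_sigma[of V0] by (simp add: proj_diff proj_add proj_minus proj_mult)

lemmas [path_rules] = times_right[OF rule_0s0, unfolded path_distribs]

lemma rule_2s2 [path_rules]: "a\<^sub>2\<^sup>* * a\<^sub>2 = a\<^sub>1 * a\<^sub>1\<^sup>*"
  by (rule sym, use proj_sigma[of V2] in \<open>simp add: proj_diff proj_add proj_minus proj_mult\<close>)

lemmas [path_rules] = times_right[OF rule_2s2, unfolded path_distribs]

lemma rule_44s [path_rules]: "a\<^sub>4 * a\<^sub>4\<^sup>* = 0"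
  using proj_sigma[of V5] by (simp add: proj_diff proj_add proj_minus proj_mult)

lemmas [path_rules] = times_right[OF rule_44s, unfolded path_distribs]

lemma rule_33s [path_rules]: "a\<^sub>3 * a\<^sub>3\<^sup>* = a\<^sub>4\<^sup>* * a\<^sub>4"
  using proj_sigma[of V4] by (simp add: proj_diff proj_add proj_minus proj_mult)

lemmas [path_rules] = times_right[OF rule_33s, unfolded path_distribs]

lemma rule_1s1 [path_rules]: "a\<^sub>1\<^sup>* * a\<^sub>1 = 0"
  using proj_sigma[of V1] by (simp add: proj_diff proj_add proj_minus proj_mult)

lemmas [path_rules] = times_right[OF rule_1s1, unfolded path_distribs]

lemma rule_3s3 [path_rules]: "a\<^sub>3\<^sup>* * a\<^sub>3 = a\<^sub>0 * a\<^sub>0\<^sup>* + a\<^sub>2 * a\<^sub>2\<^sup>*"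
  by (rule sym, use proj_sigma[of V3] in \<open>simp add: proj_diff proj_add proj_minus proj_mult\<close>)

lemmas [path_rules] = times_right[OF rule_3s3, unfolded path_distribs]

lemma rule_322s [path_rules]: "a\<^sub>3 * (a\<^sub>2 * a\<^sub>2\<^sup>*) = a\<^sub>4\<^sup>* * (a\<^sub>4 * a\<^sub>3) - a\<^sub>3 * (a\<^sub>0 * a\<^sub>0\<^sup>*)"
  by (rule overlap_sym[OF rule_33s rule_3s3, where s = "a\<^sub>3" and t = "a\<^sub>3"])
     (simp only: mult.assoc, simp add: path_rules algebra_simps)

lemmas [path_rules] = times_right[OF rule_322s, unfolded path_distribs]

lemma rule_3s4s4 [path_rules]: "a\<^sub>3\<^sup>* * (a\<^sub>4\<^sup>* * a\<^sub>4) = a\<^sub>0 * (a\<^sub>0\<^sup>* * a\<^sub>3\<^sup>*) + a\<^sub>2 * (a\<^sub>2\<^sup>* * a\<^sub>3\<^sup>*)"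
  by (rule overlap_sym[OF rule_3s3 rule_33s, where s = "a\<^sub>3\<^sup>*" and t = "a\<^sub>3\<^sup>*"])
     (simp only: mult.assoc, simp add: path_rules algebra_simps)

lemmas [path_rules] = times_right[OF rule_3s4s4, unfolded path_distribs]

lemma rule_22s3s4s [path_rules]: "a\<^sub>2 * (a\<^sub>2\<^sup>* * (a\<^sub>3\<^sup>* * a\<^sub>4\<^sup>*)) = - (a\<^sub>0 * (a\<^sub>0\<^sup>* * (a\<^sub>3\<^sup>* * a\<^sub>4\<^sup>*)))"
  by (rule overlap[OF rule_3s4s4 rule_44s, where s = "a\<^sub>3\<^sup>* * a\<^sub>4\<^sup>*" and t = "a\<^sub>4\<^sup>*"])
     (simp only: mult.assoc, simp add: path_rules algebra_simps)

lemmas [path_rules] = times_right[OF rule_22s3s4s, unfolded path_distribs]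

lemma rule_3211s [path_rules]: "a\<^sub>3 * (a\<^sub>2 * (a\<^sub>1 * a\<^sub>1\<^sup>*)) = a\<^sub>4\<^sup>* * (a\<^sub>4 * (a\<^sub>3 * a\<^sub>2)) - a\<^sub>3 * (a\<^sub>0 * (a\<^sub>0\<^sup>* * a\<^sub>2))"
  by (rule overlap_sym[OF rule_322s rule_2s2, where s = "a\<^sub>3 * a\<^sub>2" and t = "a\<^sub>2"])
     (simp only: mult.assoc, simp add: path_rules algebra_simps)

lemmas [path_rules] = times_right[OF rule_3211s, unfolded path_distribs]

lemma rule_2s00s3s4s [path_rules]: "a\<^sub>2\<^sup>* * (a\<^sub>0 * (a\<^sub>0\<^sup>* * (a\<^sub>3\<^sup>* * a\<^sub>4\<^sup>*))) = - (a\<^sub>1 * (a\<^sub>1\<^sup>* * (a\<^sub>2\<^sup>* * (a\<^sub>3\<^sup>* * a\<^sub>4\<^sup>*))))"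
  by (rule overlap[OF rule_2s2 rule_22s3s4s, where s = "a\<^sub>2\<^sup>*" and t = "a\<^sub>2\<^sup>* * (a\<^sub>3\<^sup>* * a\<^sub>4\<^sup>*)"])
     (simp only: mult.assoc, simp add: path_rules algebra_simps)

lemmas [path_rules] = times_right[OF rule_2s00s3s4s, unfolded path_distribs]

lemma rule_22s00s3s [path_rules]: "a\<^sub>2 * (a\<^sub>2\<^sup>* * (a\<^sub>0 * (a\<^sub>0\<^sup>* * a\<^sub>3\<^sup>*))) = - (a\<^sub>0 * (a\<^sub>0\<^sup>* * (a\<^sub>2 * (a\<^sub>2\<^sup>* * a\<^sub>3\<^sup>*)))) - a\<^sub>2 * (a\<^sub>1 * (a\<^sub>1\<^sup>* * (a\<^sub>2\<^sup>* * a\<^sub>3\<^sup>*)))"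
  by (rule overlap_sym[OF rule_22s3s4s rule_3s4s4, where s = "a\<^sub>2 * a\<^sub>2\<^sup>*" and t = "a\<^sub>4"])
     (simp only: mult.assoc, simp add: path_rules algebra_simps)

lemmas [path_rules] = times_right[OF rule_22s00s3s, unfolded path_distribs]

lemma rule_300s21 [path_rules]: "a\<^sub>3 * (a\<^sub>0 * (a\<^sub>0\<^sup>* * (a\<^sub>2 * a\<^sub>1))) = a\<^sub>4\<^sup>* * (a\<^sub>4 * (a\<^sub>3 * (a\<^sub>2 * a\<^sub>1)))"
  by (rule overlap_sym[OF rule_3211s rule_1s1, where s = "a\<^sub>3 * (a\<^sub>2 * a\<^sub>1)" and t = "a\<^sub>1"])
     (simp only: mult.assoc, simp add: path_rules algebra_simps)

lemmas [path_rules] = times_right[OF rule_300s21, unfolded path_distribs]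

lemma rule_2s00s22s3s [path_rules]: "a\<^sub>2\<^sup>* * (a\<^sub>0 * (a\<^sub>0\<^sup>* * (a\<^sub>2 * (a\<^sub>2\<^sup>* * a\<^sub>3\<^sup>*)))) = - (a\<^sub>1 * (a\<^sub>1\<^sup>* * (a\<^sub>2\<^sup>* * (a\<^sub>0 * (a\<^sub>0\<^sup>* * a\<^sub>3\<^sup>*)))))"
  by (rule overlap[OF rule_2s2 rule_22s00s3s, where s = "a\<^sub>2\<^sup>*" and t = "a\<^sub>2\<^sup>* * (a\<^sub>0 * (a\<^sub>0\<^sup>* * a\<^sub>3\<^sup>*))"])
     (simp only: mult.assoc, simp add: path_rules algebra_simps)

lemmas [path_rules] = times_right[OF rule_2s00s22s3s, unfolded path_distribs]

lemma rule_22s00s22s [path_rules]: "a\<^sub>2 * (a\<^sub>2\<^sup>* * (a\<^sub>0 * (a\<^sub>0\<^sup>* * (a\<^sub>2 * a\<^sub>2\<^sup>*)))) = - (a\<^sub>0 * (a\<^sub>0\<^sup>* * (a\<^sub>2 * (a\<^sub>1 * (a\<^sub>1\<^sup>* * a\<^sub>2\<^sup>*))))) - a\<^sub>0 * (a\<^sub>0\<^sup>* * (a\<^sub>2 * (a\<^sub>2\<^sup>* * (a\<^sub>0 * a\<^sub>0\<^sup>*)))) - a\<^sub>2 * (a\<^sub>1 * (a\<^sub>1\<^sup>* * (a\<^sub>2\<^sup>* * (a\<^sub>0 * a\<^sub>0\<^sup>*))))"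
  by (rule overlap_sym[OF rule_22s00s3s rule_3s3, where s = "a\<^sub>2 * (a\<^sub>2\<^sup>* * (a\<^sub>0 * a\<^sub>0\<^sup>*))" and t = "a\<^sub>3"])
     (simp only: mult.assoc, simp add: path_rules algebra_simps)

lemmas [path_rules] = times_right[OF rule_22s00s22s, unfolded path_distribs]

lemma rule_2s00s22s00s [path_rules]: "a\<^sub>2\<^sup>* * (a\<^sub>0 * (a\<^sub>0\<^sup>* * (a\<^sub>2 * (a\<^sub>2\<^sup>* * (a\<^sub>0 * a\<^sub>0\<^sup>*))))) = - (a\<^sub>1 * (a\<^sub>1\<^sup>* * (a\<^sub>2\<^sup>* * (a\<^sub>0 * (a\<^sub>0\<^sup>* * (a\<^sub>2 * a\<^sub>2\<^sup>*)))))) - a\<^sub>2\<^sup>* * (a\<^sub>0 * (a\<^sub>0\<^sup>* * (a\<^sub>2 * (a\<^sub>1 * (a\<^sub>1\<^sup>* * a\<^sub>2\<^sup>*)))))"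
  by (rule overlap[OF rule_2s2 rule_22s00s22s, where s = "a\<^sub>2\<^sup>*" and t = "a\<^sub>2\<^sup>* * (a\<^sub>0 * (a\<^sub>0\<^sup>* * (a\<^sub>2 * a\<^sub>2\<^sup>*)))"])
     (simp only: mult.assoc, simp add: path_rules algebra_simps)

lemmas [path_rules] = times_right[OF rule_2s00s22s00s, unfolded path_distribs]

lemma rule_22s00s211s [path_rules]: "a\<^sub>2 * (a\<^sub>2\<^sup>* * (a\<^sub>0 * (a\<^sub>0\<^sup>* * (a\<^sub>2 * (a\<^sub>1 * a\<^sub>1\<^sup>*))))) = - (a\<^sub>0 * (a\<^sub>0\<^sup>* * (a\<^sub>2 * (a\<^sub>2\<^sup>* * (a\<^sub>0 * (a\<^sub>0\<^sup>* * a\<^sub>2)))))) - a\<^sub>2 * (a\<^sub>1 * (a\<^sub>1\<^sup>* * (a\<^sub>2\<^sup>* * (a\<^sub>0 * (a\<^sub>0\<^sup>* * a\<^sub>2)))))"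
  by (rule overlap_sym[OF rule_22s00s22s rule_2s2, where s = "a\<^sub>2 * (a\<^sub>2\<^sup>* * (a\<^sub>0 * (a\<^sub>0\<^sup>* * a\<^sub>2)))" and t = "a\<^sub>2"])
     (simp only: mult.assoc, simp add: path_rules algebra_simps)

lemmas [path_rules] = times_right[OF rule_22s00s211s, unfolded path_distribs]

lemma rule_2s00s211s2s0 [path_rules]: "a\<^sub>2\<^sup>* * (a\<^sub>0 * (a\<^sub>0\<^sup>* * (a\<^sub>2 * (a\<^sub>1 * (a\<^sub>1\<^sup>* * (a\<^sub>2\<^sup>* * a\<^sub>0)))))) = - (a\<^sub>1 * (a\<^sub>1\<^sup>* * (a\<^sub>2\<^sup>* * (a\<^sub>0 * (a\<^sub>0\<^sup>* * (a\<^sub>2 * (a\<^sub>2\<^sup>* * a\<^sub>0)))))))"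
  by (rule overlap_sym[OF rule_2s00s22s00s rule_0s0, where s = "a\<^sub>2\<^sup>* * (a\<^sub>0 * (a\<^sub>0\<^sup>* * (a\<^sub>2 * (a\<^sub>2\<^sup>* * a\<^sub>0))))" and t = "a\<^sub>0"])
     (simp only: mult.assoc, simp add: path_rules algebra_simps)

lemmas [path_rules] = times_right[OF rule_2s00s211s2s0, unfolded path_distribs]

lemma rule_211s2s00s21 [path_rules]: "a\<^sub>2 * (a\<^sub>1 * (a\<^sub>1\<^sup>* * (a\<^sub>2\<^sup>* * (a\<^sub>0 * (a\<^sub>0\<^sup>* * (a\<^sub>2 * a\<^sub>1)))))) = - (a\<^sub>0 * (a\<^sub>0\<^sup>* * (a\<^sub>2 * (a\<^sub>2\<^sup>* * (a\<^sub>0 * (a\<^sub>0\<^sup>* * (a\<^sub>2 * a\<^sub>1)))))))"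
  by (rule overlap_sym[OF rule_22s00s211s rule_1s1, where s = "a\<^sub>2 * (a\<^sub>2\<^sup>* * (a\<^sub>0 * (a\<^sub>0\<^sup>* * (a\<^sub>2 * a\<^sub>1))))" and t = "a\<^sub>1"])
     (simp only: mult.assoc, simp add: path_rules algebra_simps)

lemmas [path_rules] = times_right[OF rule_211s2s00s21, unfolded path_distribs]

text \<open>This rule and the next two have length 11, one more than the top degree h - 2 = 10 of A,
  where h = 12 is the Coxeter number of E6.\<close>

lemma rule_00s211s2s00s22s0 [path_rules]: "a\<^sub>0 * (a\<^sub>0\<^sup>* * (a\<^sub>2 * (a\<^sub>1 * (a\<^sub>1\<^sup>* * (a\<^sub>2\<^sup>* * (a\<^sub>0 * (a\<^sub>0\<^sup>* * (a\<^sub>2 * (a\<^sub>2\<^sup>* * a\<^sub>0))))))))) = 0"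
  by (rule overlap[OF rule_211s2s00s21 rule_2s00s211s2s0, where s = "a\<^sub>2 * (a\<^sub>1 * a\<^sub>1\<^sup>*)" and t = "a\<^sub>1\<^sup>* * (a\<^sub>2\<^sup>* * a\<^sub>0)"])
     (simp only: mult.assoc, simp add: path_rules algebra_simps)

lemmas [path_rules] = times_right[OF rule_00s211s2s00s22s0, unfolded path_distribs]

lemma rule_11s2s00s211s2s3s4s [path_rules]: "a\<^sub>1 * (a\<^sub>1\<^sup>* * (a\<^sub>2\<^sup>* * (a\<^sub>0 * (a\<^sub>0\<^sup>* * (a\<^sub>2 * (a\<^sub>1 * (a\<^sub>1\<^sup>* * (a\<^sub>2\<^sup>* * (a\<^sub>3\<^sup>* * a\<^sub>4\<^sup>*))))))))) = 0"
  by (rule overlap[OF rule_2s00s211s2s0 rule_2s00s3s4s, where s = "a\<^sub>2\<^sup>* * (a\<^sub>0 * (a\<^sub>0\<^sup>* * (a\<^sub>2 * (a\<^sub>1 * a\<^sub>1\<^sup>*))))" and t = "a\<^sub>0\<^sup>* * (a\<^sub>3\<^sup>* * a\<^sub>4\<^sup>*)"])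
     (simp only: mult.assoc, simp add: path_rules algebra_simps)

lemmas [path_rules] = times_right[OF rule_11s2s00s211s2s3s4s, unfolded path_distribs]

lemma rule_4s4300s22s00s21 [path_rules]: "a\<^sub>4\<^sup>* * (a\<^sub>4 * (a\<^sub>3 * (a\<^sub>0 * (a\<^sub>0\<^sup>* * (a\<^sub>2 * (a\<^sub>2\<^sup>* * (a\<^sub>0 * (a\<^sub>0\<^sup>* * (a\<^sub>2 * a\<^sub>1))))))))) = 0"
  by (rule overlap_sym[OF rule_300s21 rule_211s2s00s21, where s = "a\<^sub>3 * (a\<^sub>0 * a\<^sub>0\<^sup>*)" and t = "a\<^sub>1\<^sup>* * (a\<^sub>2\<^sup>* * (a\<^sub>0 * (a\<^sub>0\<^sup>* * (a\<^sub>2 * a\<^sub>1))))"])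
     (simp only: mult.assoc, simp add: path_rules algebra_simps)

lemmas [path_rules] = times_right[OF rule_4s4300s22s00s21, unfolded path_distribs]
lemma ar_mult_ar_zero: "arrow_source x \<noteq> arrow_target y \<Longrightarrow> ar x * ar y = 0"
  and ar_mult_ar_zero_left: "arrow_source x \<noteq> arrow_target y \<Longrightarrow> ar x * (ar y * z) = 0"
proof -
  assume "arrow_source x \<noteq> arrow_target y"
  then show "ar x * ar y = 0"
    by (simp add: proj_mult[symmetric] arrow_mult)
  then show "ar x * (ar y * z) = 0"
    by (metis mult.assoc mult_zero_left)
qed

lemma e_mult_ar_left: "e i * (ar x * z) = (if i = arrow_target x then ar x * z else 0)"
  by (simp add: mult.assoc[symmetric] e_mult_ar)

lemmas path_simps = path_rules ar_mult_ar_zero ar_mult_ar_zero_left e_mult_ar e_mult_ar_left ar_mult_e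

lemmas element_defs = c\<^sub>0_def c\<^sub>2_def c\<^sub>3_def \<pi>\<^sub>0_def \<pi>\<^sub>3_def z\<^sub>6_def z\<^sub>8_def power2_eq_square

lemma all_arrows: "(\<forall>x. P x) \<longleftrightarrow> P A0 \<and> P A1 \<and> P A2 \<and> P A3 \<and> P A4 \<and> P A0s \<and> P A1s \<and> P A2s \<and> P A3s \<and> P A4s"
  by (metis arrow.exhaust)

lemma all_vertices: "(\<forall>i. P i) \<longleftrightarrow> P V0 \<and> P V1 \<and> P V2 \<and> P V3 \<and> P V4 \<and> P V5"
  by (metis vertex.exhaust)

section \<open>Normal forms, centrality and products of the central elements\<close>

lemma z6_normal: "z\<^sub>6 = a\<^sub>1\<^sup>* * (a\<^sub>2\<^sup>* * (a\<^sub>0 * (a\<^sub>0\<^sup>* * (a\<^sub>2 * a\<^sub>1)))) + a\<^sub>2\<^sup>* * (a\<^sub>0 * (a\<^sub>0\<^sup>* * (a\<^sub>2 * (a\<^sub>1 * a\<^sub>1\<^sup>*))))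
    + a\<^sub>1 * (a\<^sub>1\<^sup>* * (a\<^sub>2\<^sup>* * (a\<^sub>0 * (a\<^sub>0\<^sup>* * a\<^sub>2)))) - a\<^sub>0 * (a\<^sub>0\<^sup>* * (a\<^sub>2 * (a\<^sub>2\<^sup>* * (a\<^sub>0 * a\<^sub>0\<^sup>*))))
    - a\<^sub>3 * (a\<^sub>0 * (a\<^sub>0\<^sup>* * (a\<^sub>2 * (a\<^sub>2\<^sup>* * a\<^sub>3\<^sup>*)))) - a\<^sub>4\<^sup>* * (a\<^sub>4 * (a\<^sub>3 * (a\<^sub>0 * (a\<^sub>0\<^sup>* * a\<^sub>3\<^sup>*))))
    - a\<^sub>4 * (a\<^sub>3 * (a\<^sub>0 * (a\<^sub>0\<^sup>* * (a\<^sub>3\<^sup>* * a\<^sub>4\<^sup>*))))"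
  by (simp add: element_defs path_simps algebra_simps)

lemma z8_normal: "z\<^sub>8 = a\<^sub>4\<^sup>* * (a\<^sub>4 * (a\<^sub>3 * (a\<^sub>0 * (a\<^sub>0\<^sup>* * (a\<^sub>2 * (a\<^sub>2\<^sup>* * a\<^sub>3\<^sup>*))))))
    - a\<^sub>1 * (a\<^sub>1\<^sup>* * (a\<^sub>2\<^sup>* * (a\<^sub>0 * (a\<^sub>0\<^sup>* * (a\<^sub>2 * (a\<^sub>1 * a\<^sub>1\<^sup>*))))))
    - a\<^sub>0 * (a\<^sub>0\<^sup>* * (a\<^sub>2 * (a\<^sub>1 * (a\<^sub>1\<^sup>* * (a\<^sub>2\<^sup>* * (a\<^sub>0 * a\<^sub>0\<^sup>*))))))"
  by (simp add: element_defs path_simps algebra_simps)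

lemma pi0_normal: "\<pi>\<^sub>0 = a\<^sub>0\<^sup>* * (a\<^sub>2 * (a\<^sub>1 * (a\<^sub>1\<^sup>* * (a\<^sub>2\<^sup>* * (a\<^sub>0 * (a\<^sub>0\<^sup>* * (a\<^sub>2 * (a\<^sub>2\<^sup>* * a\<^sub>0))))))))"
  by (simp add: element_defs path_simps algebra_simps)

lemma pi3_normal: "\<pi>\<^sub>3 = - (a\<^sub>0 * (a\<^sub>0\<^sup>* * (a\<^sub>2 * (a\<^sub>1 * (a\<^sub>1\<^sup>* * (a\<^sub>2\<^sup>* * (a\<^sub>0 * (a\<^sub>0\<^sup>* * (a\<^sub>2 * a\<^sub>2\<^sup>*)))))))))"
  by (simp add: element_defs path_simps algebra_simps)

lemmas normal_forms = z6_normal z8_normal pi0_normal pi3_normal c\<^sub>0_def c\<^sub>2_def c\<^sub>3_def power2_eq_square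

lemma central_elements: "central z\<^sub>0" "central z\<^sub>6" "central z\<^sub>8" "central \<pi>\<^sub>0" "central \<pi>\<^sub>3"
proof -
  show "central z\<^sub>0" by (simp add: central_def z\<^sub>0_def)
  show "central z\<^sub>6" "central z\<^sub>8" "central \<pi>\<^sub>0" "central \<pi>\<^sub>3"
    unfolding central_iff all_arrows all_vertices
    by (simp_all add: normal_forms path_simps algebra_simps)
qed

text \<open>Both elements have length 10, the top degree of A, and so lie in the socle.\<close>

lemma pi_products: "\<pi>\<^sub>0 * ar x = 0" "\<pi>\<^sub>3 * ar x = 0"
  by (cases x; simp add: normal_forms path_simps algebra_simps)+

text \<open>The lengths 12, 14 and 16 exceed the top degree.\<close>

lemma z_products: "z\<^sub>6 * z\<^sub>6 = 0" "z\<^sub>6 * z\<^sub>8 = 0" "z\<^sub>8 * z\<^sub>8 = 0"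
  by (simp_all add: normal_forms path_simps algebra_simps)

section \<open>The basis elements\<close>

definition zeta_val :: "'f::field preproj \<Rightarrow> arrow \<Rightarrow> 'f preproj" where
  "zeta_val z x = (if starred x then 0 else ar x * z)"

definition rho3_val :: "arrow \<Rightarrow> 'f::field preproj" where
  "rho3_val = (\<lambda>a. case a of A2 \<Rightarrow> c\<^sub>0 * a\<^sub>2 | A3 \<Rightarrow> a\<^sub>3 * c\<^sub>3 | A2s \<Rightarrow> a\<^sub>2\<^sup>* * c\<^sub>3 | _ \<Rightarrow> 0)"

definition rho5_val :: "arrow \<Rightarrow> 'f::field preproj" where
  "rho5_val = (\<lambda>a. case a of
     A0 \<Rightarrow> c\<^sub>2 * c\<^sub>3 * a\<^sub>0 | A1 \<Rightarrow> a\<^sub>2\<^sup>* * c\<^sub>0 * a\<^sub>2 * a\<^sub>1 | A2 \<Rightarrow> c\<^sub>2 * c\<^sub>0 * a\<^sub>2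
   | A0s \<Rightarrow> - (a\<^sub>0\<^sup>* * c\<^sub>3^2) | A1s \<Rightarrow> - (a\<^sub>1\<^sup>* * a\<^sub>2\<^sup>* * c\<^sub>0 * a\<^sub>2) | A2s \<Rightarrow> a\<^sub>2\<^sup>* * c\<^sub>3^2
   | _ \<Rightarrow> 0)"

definition h_val :: "vertex \<Rightarrow> vertex \<Rightarrow> 'f::field preproj" where
  "h_val j i = (if i = j then e j else 0)"

definition at_0 :: "'f::field preproj \<Rightarrow> vertex \<Rightarrow> 'f preproj" where
  "at_0 y i = (if i = V0 then y else 0)"

abbreviation gamma4_val :: "vertex \<Rightarrow> 'f::field preproj" where "gamma4_val \<equiv> at_0 (a\<^sub>0\<^sup>* * c\<^sub>3 * a\<^sub>0)"
abbreviation gamma6_val :: "vertex \<Rightarrow> 'f::field preproj" where "gamma6_val \<equiv> at_0 (a\<^sub>0\<^sup>* * c\<^sub>3^2 * a\<^sub>0)"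

lemma zeta_val_typed:
  assumes "central z" shows "arrow_typed (zeta_val z)"
proof -
  have "ar x * z * e i = ar x * e i * z" for x i
    by (simp only: mult.assoc centralD[OF assms])
  then show ?thesis
    by (simp add: arrow_typed_def zeta_val_def e_mult_ar ar_mult_e mult.assoc[symmetric])
qed

lemma rho_typed: "arrow_typed rho3_val" "arrow_typed rho5_val"
  by (simp_all add: arrow_typed_def all_arrows rho3_val_def rho5_val_def normal_forms path_simps algebra_simps)

lemma h_val_typed: "vertex_typed (h_val j)"
  by (simp add: vertex_typed_def h_val_def e_mult_e)

lemma gamma_typed: "vertex_typed gamma4_val" "vertex_typed gamma6_val"
  by (simp_all add: vertex_typed_def all_vertices at_0_def normal_forms path_simps algebra_simps)

lemma zeta_eq: "central z \<Longrightarrow> \<zeta> z = W1.extend (zeta_val z)"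
proof -
  assume z: "central z"
  have "(\<lambda>a. case a of A0 \<Rightarrow> a\<^sub>0 * z | A1 \<Rightarrow> a\<^sub>1 * z | A2 \<Rightarrow> a\<^sub>2 * z | A3 \<Rightarrow> a\<^sub>3 * z | A4 \<Rightarrow> a\<^sub>4 * z | _ \<Rightarrow> 0) = zeta_val z"
    by (rule ext) (simp add: zeta_val_def split: arrow.split)
  then show ?thesis unfolding \<zeta>_def using arrow_cochain_eq[OF zeta_val_typed[OF z]] by simp
qed

lemma rho_eq: "\<rho>\<^sub>3 = W1.extend rho3_val" "\<rho>\<^sub>5 = W1.extend rho5_val"
  using arrow_cochain_eq[OF rho_typed(1)] arrow_cochain_eq[OF rho_typed(2)]
  by (simp_all only: \<rho>\<^sub>3_def \<rho>\<^sub>5_def rho3_val_def rho5_val_def)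

lemma h_eq: "h j = W2.extend (h_val j)"
  using relation_cochain_eq[OF h_val_typed, of j] by (simp only: h_def h_val_def[abs_def])

lemma gamma_eq: "\<gamma>\<^sub>4 = W2.extend gamma4_val" "\<gamma>\<^sub>6 = W2.extend gamma6_val"
  using relation_cochain_eq[OF gamma_typed(1)] relation_cochain_eq[OF gamma_typed(2)]
  by (simp_all only: \<gamma>\<^sub>4_def \<gamma>\<^sub>6_def at_0_def[abs_def])

lemma central_class_eq: "central_class z = cls 0 (const_cochain z)"
  by (simp add: central_class_def const_cochain_def)

lemma const_cocycle: "central z \<Longrightarrow> const_cochain z \<in> cocycles 0"
  using cocycles_0 by blast

lemma extend_1_cocycle: "arrow_typed \<phi> \<Longrightarrow> (\<And>i. d1 \<phi> i = 0) \<Longrightarrow> W1.extend \<phi> \<in> cocycles 1"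
  by (simp add: cocycles_1 W1_extend_cochain W1.extend_b)

lemma extend_2_cocycle: "vertex_typed \<psi> \<Longrightarrow> W2.extend \<psi> \<in> cocycles 2"
  by (simp add: cocycles_ge_2 W2_extend_cochain)

text \<open>Exactly one of \<open>x\<close> and \<open>bar x\<close> is unstarred, so each term of
  the differential contains \<open>z\<close> once. As \<open>z\<close> is central it moves to the
  right, which leaves the relation times \<open>z\<close>.\<close>

lemma d1_zeta:
  assumes "central z" shows "d1 (zeta_val z) i = 0"
proof -
  have "zeta_val z x * ar (bar x) + ar x * zeta_val z (bar x) = ar x * ar (bar x) * z" for x
    using centralD[OF assms] by (cases x) (simp_all add: zeta_val_def mult.assoc)
  then show ?thesis
    by (simp add: d1_def sigma_eval_mult_right proj_sigma_eval)
qed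

subsection \<open>Small characteristics\<close>

lemma of_nat_CHAR_preproj: "of_nat (CHAR('f)) = (0 :: 'f::field preproj)"
proof -
  have "scalar (of_nat n :: 'f) = of_nat n" for n
    by (induction n) (simp_all add: scalar_add)
  from this[of "CHAR('f)"] show ?thesis by simp
qed

text \<open>Oriented for rewriting: subtraction disappears and equal neighbours cancel, also inside
  a right-nested sum, so that sorting with \<open>add_ac\<close> gives normal forms modulo 2.
  \<open>char_3\<close> does the same with three neighbours.\<close>

lemma char_2:
  fixes x y :: "'f::field preproj"
  assumes "CHAR('f) = 2"
  shows "x + x = 0" "x + (x + y) = y" "- x = x" "x - y = x + y"
proof -
  have "of_nat 2 = (0 :: 'f preproj)" using of_nat_CHAR_preproj[where ?'f = 'f] assms by simp
  then have two: "1 + 1 = (0 :: 'f preproj)" by simp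
  have double: "w + w = 0" for w :: "'f preproj"
  proof -
    have "(1 + 1) * w = w + w" by (simp only: distrib_right mult_1_left)
    then show ?thesis unfolding two by simp
  qed
  show "x + x = 0" by (rule double)
  show "x + (x + y) = y" by (simp add: add.assoc[symmetric] double)
  show neg: "- x = x" using double[of x] by (simp add: minus_unique)
  have "- y = y" using double[of y] by (simp add: minus_unique)
  then show "x - y = x + y" by (metis diff_conv_add_uminus)
qed

lemma char_3:
  fixes x y :: "'f::field preproj"
  assumes "CHAR('f) = 3"
  shows "x + (x + x) = 0" "x + (x + (x + y)) = y" "- x = x + x" "x - y = x + (y + y)"
proof -
  have "of_nat 3 = (0 :: 'f preproj)" using of_nat_CHAR_preproj[where ?'f = 'f] assms by simp
  then have three: "1 + (1 + 1) = (0 :: 'f preproj)" by simp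
  have triple: "w + (w + w) = 0" for w :: "'f preproj"
  proof -
    have "(1 + (1 + 1)) * w = w + (w + w)" by (simp only: distrib_right mult_1_left)
    then show ?thesis unfolding three by simp
  qed
  show "x + (x + x) = 0" by (rule triple)
  have "x + (x + (x + y)) = x + (x + x) + y" by (simp only: add.assoc)
  then show "x + (x + (x + y)) = y" unfolding triple by simp
  have neg: "- w = w + w" for w :: "'f preproj" using triple[of w] by (simp add: minus_unique)
  show "- x = x + x" by (rule neg)
  show "x - y = x + (y + y)" using neg[of y] by (metis diff_conv_add_uminus)
qed

lemmas normalize = normal_forms path_simps distrib_left distrib_right mult.assoc add_ac

lemma d1_rho3: "CHAR('f) = 2 \<Longrightarrow> d1 rho3_val i = (0 :: 'f::field preproj)"
  by (cases i) (simp_all add: d1_def rho3_val_def normalize char_2)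

lemma d1_rho5: "CHAR('f) = 3 \<Longrightarrow> d1 rho5_val i = (0 :: 'f::field preproj)"
  by (cases i) (simp_all add: d1_def rho5_val_def normalize char_3)

subsection \<open>Explicit coboundaries\<close>

text \<open>\<open>exact1\<close> and \<open>exact2\<close> are the coboundary conditions of
  \<open>coboundaries_1\<close> and \<open>coboundaries_2\<close> for families of values, without
  reference to the spaces \<open>W p\<close>.\<close>

definition exact1 :: "(arrow \<Rightarrow> 'f::field preproj) \<Rightarrow> bool" where
  "exact1 \<phi> \<longleftrightarrow> (\<exists>z. (\<forall>i. e i * z = z * e i) \<and> (\<forall>x. \<phi> x = z * ar x - ar x * z))"

definition exact2 :: "(vertex \<Rightarrow> 'f::field preproj) \<Rightarrow> bool" where
  "exact2 \<psi> \<longleftrightarrow> (\<exists>\<phi>. arrow_typed \<phi> \<and> (\<forall>i. \<psi> i = d1 \<phi> i))"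

lemma exact2_zero: "exact2 (\<lambda>i. 0 :: 'f::field preproj)"
proof -
  have "d1 (\<lambda>_. 0 :: 'f preproj) i = 0" for i by (cases i) (simp_all add: d1_def)
  then show ?thesis unfolding exact2_def arrow_typed_def by (intro exI[of _ "\<lambda>_. 0"]) simp
qed

lemma exact2_add: "exact2 \<psi> \<Longrightarrow> exact2 \<psi>' \<Longrightarrow> exact2 (\<lambda>i. \<psi> i + \<psi>' i)"
  unfolding exact2_def by (metis arrow_typed_add d1_add)

lemma exact2_minus: "exact2 \<psi> \<Longrightarrow> exact2 (\<lambda>i. - \<psi> i)"
  unfolding exact2_def by (metis arrow_typed_minus d1_minus)

lemma exact2_scalar: "exact2 \<psi> \<Longrightarrow> exact2 (\<lambda>i. scalar c * \<psi> i)"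
proof -
  assume "exact2 \<psi>"
  then obtain \<phi> where \<phi>: "arrow_typed \<phi>" "\<And>i. \<psi> i = d1 \<phi> i" unfolding exact2_def by blast
  have "d1 (\<lambda>x. scalar c * \<phi> x) i = scalar c * d1 \<phi> i" for i
    unfolding d1_def sigma_eval_mult_left[symmetric]
    by (simp add: distrib_left mult.assoc scalar_left_commute[of "ar _"])
  moreover have "arrow_typed (\<lambda>x. scalar c * \<phi> x)"
    by (rule arrow_typed_commute_mult(1)[OF \<phi>(1)]) (rule scalar_commute)
  ultimately show ?thesis unfolding exact2_def \<phi>(2) by metis
qed

lemmas exact_simps = arrow_typed_def all_arrows all_vertices d1_def h_val_def at_0_def

text \<open>Up to coboundaries, \<open>z\<^sub>6 h\<^sub>i = \<plusminus>\<gamma>\<^sub>6\<close> for \<open>i = 1, 2, 4, 5\<close> and \<open>3\<gamma>\<^sub>6 = 0\<close> hold over the integers, which settles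
  all characteristics. The cochains below are solutions of linear systems over the integers.\<close>

lemma z6_h1: "exact2 (\<lambda>i. z\<^sub>6 * h_val V1 i - gamma6_val i)"
  unfolding exact2_def
  by (rule exI[of _ "\<lambda>a. case a of A1 \<Rightarrow> - (a\<^sub>2\<^sup>* * a\<^sub>0 * a\<^sub>0\<^sup>* * a\<^sub>2 * a\<^sub>1) | A2 \<Rightarrow> - (a\<^sub>0 * a\<^sub>0\<^sup>* * a\<^sub>2 * a\<^sub>1 * a\<^sub>1\<^sup>*)
      | A0s \<Rightarrow> a\<^sub>0\<^sup>* * a\<^sub>2 * a\<^sub>1 * a\<^sub>1\<^sup>* * a\<^sub>2\<^sup>* | _ \<Rightarrow> 0"])
     (simp add: exact_simps normal_forms path_simps algebra_simps)

lemma z6_h4: "exact2 (\<lambda>i. z\<^sub>6 * h_val V4 i - gamma6_val i)"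
  unfolding exact2_def
  by (rule exI[of _ "\<lambda>a. case a of A3 \<Rightarrow> - (a\<^sub>4\<^sup>* * a\<^sub>4 * a\<^sub>3 * a\<^sub>0 * a\<^sub>0\<^sup>*) - a\<^sub>3 * a\<^sub>0 * a\<^sub>0\<^sup>* * a\<^sub>2 * a\<^sub>2\<^sup>*
      | A0s \<Rightarrow> a\<^sub>0\<^sup>* * a\<^sub>2 * a\<^sub>1 * a\<^sub>1\<^sup>* * a\<^sub>2\<^sup>* | _ \<Rightarrow> 0"])
     (simp add: exact_simps normal_forms path_simps algebra_simps)

lemma z6_h2: "exact2 (\<lambda>i. z\<^sub>6 * h_val V2 i + gamma6_val i)"
  unfolding exact2_def
  by (rule exI[of _ "\<lambda>a. case a of A0 \<Rightarrow> - (a\<^sub>2 * a\<^sub>1 * a\<^sub>1\<^sup>* * a\<^sub>2\<^sup>* * a\<^sub>0) - a\<^sub>0 * a\<^sub>0\<^sup>* * a\<^sub>2 * a\<^sub>2\<^sup>* * a\<^sub>0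
      | A2 \<Rightarrow> - (a\<^sub>0 * a\<^sub>0\<^sup>* * a\<^sub>2 * a\<^sub>1 * a\<^sub>1\<^sup>*) - a\<^sub>2 * a\<^sub>2\<^sup>* * a\<^sub>0 * a\<^sub>0\<^sup>* * a\<^sub>2 | _ \<Rightarrow> 0"])
     (simp add: exact_simps normal_forms path_simps algebra_simps)

lemma z6_h5: "exact2 (\<lambda>i. z\<^sub>6 * h_val V5 i + gamma6_val i)"
  unfolding exact2_def
  by (rule exI[of _ "\<lambda>a. case a of A0 \<Rightarrow> - (a\<^sub>2 * a\<^sub>1 * a\<^sub>1\<^sup>* * a\<^sub>2\<^sup>* * a\<^sub>0) - a\<^sub>0 * a\<^sub>0\<^sup>* * a\<^sub>2 * a\<^sub>2\<^sup>* * a\<^sub>0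
      | A3 \<Rightarrow> - (a\<^sub>4\<^sup>* * a\<^sub>4 * a\<^sub>3 * a\<^sub>0 * a\<^sub>0\<^sup>*) | A4 \<Rightarrow> - (a\<^sub>4 * a\<^sub>3 * a\<^sub>0 * a\<^sub>0\<^sup>* * a\<^sub>3\<^sup>*) | _ \<Rightarrow> 0"])
     (simp add: exact_simps normal_forms path_simps algebra_simps)

text \<open>\<open>z\<^sub>6\<close> has no component at vertex 0, so the product vanishes already
  as a cochain.\<close>

lemma z6_h0: "exact2 (\<lambda>i. z\<^sub>6 * h_val V0 i :: 'f::field preproj)"
proof -
  have "z\<^sub>6 * h_val V0 i = (0 :: 'f preproj)" for i by (simp add: h_val_def normal_forms path_simps algebra_simps)
  then show ?thesis using exact2_zero by simp
qed

lemma z6_h3: "exact2 (\<lambda>i. z\<^sub>6 * h_val V3 i)"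
  unfolding exact2_def
  by (rule exI[of _ "\<lambda>a. case a of A0 \<Rightarrow> - (a\<^sub>0 * a\<^sub>0\<^sup>* * a\<^sub>2 * a\<^sub>2\<^sup>* * a\<^sub>0) | _ \<Rightarrow> 0"])
     (simp add: exact_simps normal_forms path_simps algebra_simps)

text \<open>\<open>gamma6_val\<close> raises the length by 4, hence so does the primitive: it sends
  arrows to combinations of paths of length 5 with the same ends.\<close>

lemma three_gamma6: "exact2 (\<lambda>i. gamma6_val i + gamma6_val i + gamma6_val i)"
  unfolding exact2_def
  by (rule exI[of _ "\<lambda>a. case a of A0 \<Rightarrow> - (a\<^sub>2 * a\<^sub>1 * a\<^sub>1\<^sup>* * a\<^sub>2\<^sup>* * a\<^sub>0) - a\<^sub>0 * a\<^sub>0\<^sup>* * a\<^sub>2 * a\<^sub>2\<^sup>* * a\<^sub>0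
      | A2 \<Rightarrow> a\<^sub>0 * a\<^sub>0\<^sup>* * a\<^sub>2 * a\<^sub>1 * a\<^sub>1\<^sup>* - a\<^sub>2 * a\<^sub>2\<^sup>* * a\<^sub>0 * a\<^sub>0\<^sup>* * a\<^sub>2
      | A1 \<Rightarrow> a\<^sub>2\<^sup>* * a\<^sub>0 * a\<^sub>0\<^sup>* * a\<^sub>2 * a\<^sub>1 | A1s \<Rightarrow> - (a\<^sub>1\<^sup>* * a\<^sub>2\<^sup>* * a\<^sub>0 * a\<^sub>0\<^sup>* * a\<^sub>2)
      | A0s \<Rightarrow> - (a\<^sub>0\<^sup>* * a\<^sub>2 * a\<^sub>1 * a\<^sub>1\<^sup>* * a\<^sub>2\<^sup>*) - a\<^sub>0\<^sup>* * a\<^sub>2 * a\<^sub>1 * a\<^sub>1\<^sup>* * a\<^sub>2\<^sup>* | _ \<Rightarrow> 0"])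
     (simp add: exact_simps normal_forms path_simps algebra_simps)

text \<open>Where 3 is invertible, a third of the primitive in \<open>three_gamma6\<close> is a
  primitive of \<open>gamma6_val\<close>.\<close>

lemma gamma6_exact:
  assumes "CHAR('f::field) \<noteq> 3"
  shows "exact2 (gamma6_val :: vertex \<Rightarrow> 'f preproj)"
proof -
  have "(of_nat 3 :: 'f) \<noteq> 0"
  proof
    assume "(of_nat 3 :: 'f) = 0"
    then have "CHAR('f) dvd 3" by (simp only: of_nat_eq_0_iff_char_dvd)
    moreover have "CHAR('f) \<noteq> 1" by (metis of_nat_1 of_nat_CHAR one_neq_zero)
    moreover have "d = 1 \<or> d = 3" if "d dvd 3" for d :: nat
    proof -
      have "d \<le> 3" using that by (rule dvd_imp_le) simp
      then have "d = 0 \<or> d = 1 \<or> d = 2 \<or> d = 3" by linarith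
      with that show ?thesis by auto
    qed
    ultimately show False using assms by blast
  qed
  then have "scalar (1 / 3) * (x + x + x) = x" for x :: "'f preproj"
  proof -
    assume 3: "(of_nat 3 :: 'f) \<noteq> 0"
    have "scalar c * (x + x + x) = scalar (c + c + c) * x" for c :: 'f
      by (simp only: scalar_add distrib_left distrib_right)
    also have "1 / 3 + 1 / 3 + 1 / 3 = (1 :: 'f)" using 3 by (simp add: field_simps)
    finally show ?thesis by simp
  qed
  then show ?thesis using exact2_scalar[OF three_gamma6, of "1 / 3 :: 'f"] by simp
qed

lemma z6_h_exact:
  assumes "CHAR('f::field) \<noteq> 3"
  shows "exact2 (\<lambda>i. z\<^sub>6 * h_val j i :: 'f preproj)"
proof (cases j)
  case V0 then show ?thesis using z6_h0 by simp
next
  case V1 then show ?thesis using exact2_add[OF z6_h1 gamma6_exact[OF assms]] by simp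
next
  case V2 then show ?thesis using exact2_add[OF z6_h2 exact2_minus[OF gamma6_exact[OF assms]]] by simp
next
  case V3 then show ?thesis using z6_h3 by simp
next
  case V4 then show ?thesis using exact2_add[OF z6_h4 gamma6_exact[OF assms]] by simp
next
  case V5 then show ?thesis using exact2_add[OF z6_h5 exact2_minus[OF gamma6_exact[OF assms]]] by simp
qed

text \<open>\<open>z\<^sub>8\<close> has components at the vertices 2, 3 and 4 only, so the
  primitive is zero for the other \<open>j\<close>.\<close>

lemma z8_h_exact: "exact2 (\<lambda>i. z\<^sub>8 * h_val j i)"
  unfolding exact2_def
  by (cases j;
      rule exI[of _ "\<lambda>a. if j = V2 \<and> a = A1 then - (a\<^sub>1 * a\<^sub>1\<^sup>* * a\<^sub>2\<^sup>* * a\<^sub>0 * a\<^sub>0\<^sup>* * a\<^sub>2 * a\<^sub>1)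
        else if (j = V3 \<or> j = V4) \<and> a = A0 then - (a\<^sub>0 * a\<^sub>0\<^sup>* * a\<^sub>2 * a\<^sub>1 * a\<^sub>1\<^sup>* * a\<^sub>2\<^sup>* * a\<^sub>0)
        else if j = V4 \<and> a = A3 then a\<^sub>3 * a\<^sub>0 * a\<^sub>0\<^sup>* * a\<^sub>2 * a\<^sub>2\<^sup>* * a\<^sub>0 * a\<^sub>0\<^sup>* else 0"];
      simp add: exact_simps normal_forms path_simps algebra_simps)

lemma pi0_h_exact: "exact2 (\<lambda>i. \<pi>\<^sub>0 * h_val j i)"
  unfolding exact2_def
  by (cases j;
      rule exI[of _ "\<lambda>a. if j = V0 \<and> a = A0 then - (a\<^sub>2 * a\<^sub>1 * a\<^sub>1\<^sup>* * a\<^sub>2\<^sup>* * a\<^sub>0 * a\<^sub>0\<^sup>* * a\<^sub>2 * a\<^sub>2\<^sup>* * a\<^sub>0)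
        else if j = V0 \<and> a = A2 then - (a\<^sub>0 * a\<^sub>0\<^sup>* * a\<^sub>2 * a\<^sub>1 * a\<^sub>1\<^sup>* * a\<^sub>2\<^sup>* * a\<^sub>0 * a\<^sub>0\<^sup>* * a\<^sub>2) else 0"];
      simp add: exact_simps normal_forms path_simps algebra_simps)

lemma pi3_h_exact: "exact2 (\<lambda>i. \<pi>\<^sub>3 * h_val j i)"
  unfolding exact2_def
  by (cases j;
      rule exI[of _ "\<lambda>a. if j = V3 \<and> a = A2 then - (a\<^sub>0 * a\<^sub>0\<^sup>* * a\<^sub>2 * a\<^sub>1 * a\<^sub>1\<^sup>* * a\<^sub>2\<^sup>* * a\<^sub>0 * a\<^sub>0\<^sup>* * a\<^sub>2) else 0"];
      simp add: exact_simps normal_forms path_simps algebra_simps)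

text \<open>\<open>z\<^sub>6\<close>, \<open>z\<^sub>8\<close> and \<open>\<pi>\<^sub>3\<close> have
  no component at vertex 0, where these cochains take their values, and \<open>\<pi>\<^sub>0\<close>
  lies in the socle.\<close>

lemma central_gamma:
  assumes "z \<in> {z\<^sub>6, z\<^sub>8, \<pi>\<^sub>0, \<pi>\<^sub>3}"
  shows "z * gamma4_val i = 0" "z * gamma6_val i = 0"
proof -
  have "\<forall>z\<in>{z\<^sub>6, z\<^sub>8, \<pi>\<^sub>0, \<pi>\<^sub>3}. z * gamma4_val i = 0 \<and> z * gamma6_val i = 0"
    by (simp add: at_0_def normal_forms path_simps algebra_simps)
  then show "z * gamma4_val i = 0" "z * gamma6_val i = 0" using assms by blast+
qed

text \<open>All these products have length at least 11, beyond the top degree.\<close>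

lemma central_rho:
  "z\<^sub>6 * rho5_val x = 0" "z\<^sub>8 * rho3_val x = 0" "z\<^sub>8 * rho5_val x = 0" "\<pi>\<^sub>0 * rho3_val x = 0" "\<pi>\<^sub>0 * rho5_val x = 0"
  "\<pi>\<^sub>3 * rho3_val x = 0" "\<pi>\<^sub>3 * rho5_val x = 0"
  by (cases x; simp add: rho3_val_def rho5_val_def normal_forms path_simps algebra_simps)+

text \<open>The two cochains differ by the commutator with the component of \<open>z\<^sub>8\<close>
  at vertex 2, whose sign is immaterial in characteristic 2.\<close>

lemma z6_rho3:
  assumes "CHAR('f::field) = 2"
  shows "exact1 (\<lambda>x. z\<^sub>6 * rho3_val x - zeta_val z\<^sub>8 x :: 'f preproj)"
  unfolding exact1_def
  by (rule exI[of _ "a\<^sub>1 * a\<^sub>1\<^sup>* * a\<^sub>2\<^sup>* * a\<^sub>0 * a\<^sub>0\<^sup>* * a\<^sub>2 * a\<^sub>1 * a\<^sub>1\<^sup>*"])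
     (simp add: all_arrows all_vertices zeta_val_def rho3_val_def normalize char_2[OF assms])

lemma zeta0_rho3:
  assumes "CHAR('f::field) = 2"
  shows "exact2 (\<lambda>i. cup11 (zeta_val z\<^sub>0) rho3_val i - gamma4_val i :: 'f preproj)"
  unfolding exact2_def
  by (rule exI[of _ "\<lambda>a. case a of A0 \<Rightarrow> a\<^sub>2 * a\<^sub>2\<^sup>* * a\<^sub>0 | A2 \<Rightarrow> a\<^sub>2 * a\<^sub>1 * a\<^sub>1\<^sup>* | _ \<Rightarrow> 0"])
     (simp add: exact_simps cup11_def zeta_val_def z\<^sub>0_def rho3_val_def normalize char_2[OF assms])

lemma zeta6_rho3:
  assumes "CHAR('f::field) = 2"
  shows "exact2 (cup11 (zeta_val z\<^sub>6) rho3_val :: vertex \<Rightarrow> 'f preproj)"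
  unfolding exact2_def
  by (rule exI[of _ "\<lambda>a. case a of A2 \<Rightarrow> a\<^sub>0 * a\<^sub>0\<^sup>* * a\<^sub>2 * a\<^sub>1 * a\<^sub>1\<^sup>* * a\<^sub>2\<^sup>* * a\<^sub>0 * a\<^sub>0\<^sup>* * a\<^sub>2 | _ \<Rightarrow> 0"])
     (simp add: exact_simps cup11_def zeta_val_def rho3_val_def normalize char_2[OF assms])

text \<open>Graded commutativity only says that twice the square is zero, which is void in
  characteristic 2; the square requires a primitive of its own.\<close>

lemma rho3_rho3:
  assumes "CHAR('f::field) = 2"
  shows "exact2 (cup11 rho3_val rho3_val :: vertex \<Rightarrow> 'f preproj)"
  unfolding exact2_def
  by (rule exI[of _ "\<lambda>a. case a of A1s \<Rightarrow> a\<^sub>1\<^sup>* * a\<^sub>2\<^sup>* * a\<^sub>0 * a\<^sub>0\<^sup>* * a\<^sub>2 | A1 \<Rightarrow> a\<^sub>2\<^sup>* * a\<^sub>0 * a\<^sub>0\<^sup>* * a\<^sub>2 * a\<^sub>1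
      | A2 \<Rightarrow> a\<^sub>0 * a\<^sub>0\<^sup>* * a\<^sub>2 * a\<^sub>1 * a\<^sub>1\<^sup>* | A0 \<Rightarrow> a\<^sub>0 * a\<^sub>0\<^sup>* * a\<^sub>2 * a\<^sub>2\<^sup>* * a\<^sub>0 | _ \<Rightarrow> 0"])
     (simp add: exact_simps cup11_def rho3_val_def normalize char_2[OF assms])

lemma zeta0_rho5:
  assumes "CHAR('f::field) = 3"
  shows "exact2 (cup11 (zeta_val z\<^sub>0) rho5_val :: vertex \<Rightarrow> 'f preproj)"
  unfolding exact2_def
  by (rule exI[of _ "\<lambda>a. case a of A1s \<Rightarrow> a\<^sub>1\<^sup>* * a\<^sub>2\<^sup>* * a\<^sub>0 * a\<^sub>0\<^sup>* * a\<^sub>2 | A1 \<Rightarrow> - (a\<^sub>2\<^sup>* * a\<^sub>0 * a\<^sub>0\<^sup>* * a\<^sub>2 * a\<^sub>1)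
      | A2 \<Rightarrow> - (a\<^sub>0 * a\<^sub>0\<^sup>* * a\<^sub>2 * a\<^sub>1 * a\<^sub>1\<^sup>*) | A0 \<Rightarrow> - (a\<^sub>0 * a\<^sub>0\<^sup>* * a\<^sub>2 * a\<^sub>2\<^sup>* * a\<^sub>0) | _ \<Rightarrow> 0"])
     (simp add: exact_simps cup11_def zeta_val_def z\<^sub>0_def rho5_val_def normalize char_3[OF assms])

lemma rho5_rho5:
  assumes "CHAR('f::field) = 3"
  shows "exact2 (cup11 rho5_val rho5_val :: vertex \<Rightarrow> 'f preproj)"
  unfolding exact2_def
  by (rule exI[of _ "\<lambda>a. case a of A0 \<Rightarrow> - (a\<^sub>2 * a\<^sub>1 * a\<^sub>1\<^sup>* * a\<^sub>2\<^sup>* * a\<^sub>0 * a\<^sub>0\<^sup>* * a\<^sub>2 * a\<^sub>2\<^sup>* * a\<^sub>0)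
      | A2 \<Rightarrow> - (a\<^sub>0 * a\<^sub>0\<^sup>* * a\<^sub>2 * a\<^sub>1 * a\<^sub>1\<^sup>* * a\<^sub>2\<^sup>* * a\<^sub>0 * a\<^sub>0\<^sup>* * a\<^sub>2) | _ \<Rightarrow> 0"])
     (simp add: exact_simps cup11_def rho5_val_def normalize char_3[OF assms])

text \<open>Each term of a relation contains a starred arrow, where \<open>zeta_val\<close> is
  zero.\<close>

lemma cup_zeta_zeta: "cup11 (zeta_val y) (zeta_val z) i = 0"
  by (cases i) (simp_all add: cup11_def zeta_val_def)

text \<open>The values would have length at least 12, beyond the top degree.\<close>

lemma cup_zeta_rho_zero: "cup11 (zeta_val z\<^sub>8) rho3_val i = 0" "cup11 (zeta_val z\<^sub>6) rho5_val i = 0"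
  "cup11 (zeta_val z\<^sub>8) rho5_val i = 0"
  by (cases i; simp add: cup11_def zeta_val_def rho3_val_def rho5_val_def normal_forms path_simps algebra_simps)+

lemma pi_z_products:
  assumes "y \<in> {\<pi>\<^sub>0, \<pi>\<^sub>3}" "z \<in> {z\<^sub>6, z\<^sub>8, \<pi>\<^sub>0, \<pi>\<^sub>3}"
  shows "y * z = 0"
proof -
  have "\<forall>y\<in>{\<pi>\<^sub>0, \<pi>\<^sub>3}. \<forall>z\<in>{z\<^sub>6, z\<^sub>8, \<pi>\<^sub>0, \<pi>\<^sub>3}. y * z = 0"
    by (simp add: normal_forms path_simps algebra_simps)
  then show ?thesis using assms by blast
qed

section \<open>Linear functionals on the preprojective algebra\<close>

type_synonym 'f weight = "vertex \<times> arrow list \<Rightarrow> 'f"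

definition linear_ext :: "'f::field weight \<Rightarrow> (path \<Rightarrow>\<^sub>0 'f) \<Rightarrow> 'f" where
  "linear_ext T x = (\<Sum>p\<in>keys x. lookup x p * T (Rep_path p))"

lemma linear_ext_superset:
  assumes "finite S" "keys x \<subseteq> S"
  shows "linear_ext T x = (\<Sum>p\<in>S. lookup x p * T (Rep_path p))"
  unfolding linear_ext_def
  by (rule sum.mono_neutral_left) (use assms in \<open>auto simp: in_keys_iff\<close>)

lemma linear_ext_0 [simp]: "linear_ext T 0 = 0"
  by (simp add: linear_ext_def)

lemma linear_ext_add: "linear_ext T (x + y) = linear_ext T x + linear_ext T y"
proof -
  let ?S = "keys x \<union> keys y"
  show ?thesis
    using linear_ext_superset[of ?S x T] linear_ext_superset[of ?S y T]
      linear_ext_superset[of ?S "x + y" T] keys_add[of x y]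
    by (simp add: lookup_add distrib_right sum.distrib)
qed

lemma linear_ext_single: "linear_ext T (Poly_Mapping.single p c) = c * T (Rep_path p)"
  by (subst linear_ext_superset[of "{p}"]) simp_all

lemma linear_ext_scale: "linear_ext T (scale c x) = c * linear_ext T x"
  by (induction x rule: path_elem_induct)
     (simp_all add: scale_single linear_ext_single mult.assoc linear_ext_add path_algebra.scale_right_distrib distrib_left)

lemma linear_ext_minus: "linear_ext T (- x) = - linear_ext T x"
  using linear_ext_add[of T "-x" x] by (simp add: eq_neg_iff_add_eq_0)

lemma linear_ext_diff: "linear_ext T (x - y) = linear_ext T x - linear_ext T y"
  using linear_ext_add[of T x "-y"] by (simp add: linear_ext_minus)

lemma linear_ext_sum: "linear_ext T (sum f S) = (\<Sum>i\<in>S. linear_ext T (f i))"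
  by (induction S rule: infinite_finite_induct) (simp_all add: linear_ext_add)

text \<open>Vanishing on all \<open>p \<star> \<sigma> i \<star> q\<close> with composable paths,
  phrased on arrow lists so that it can be checked by computation.\<close>

definition respects_relations :: "'f::field weight \<Rightarrow> bool" where
  "respects_relations T \<longleftrightarrow> (\<forall>j as bs i. walk j bs \<and> walk_end j bs = i \<and> walk i as \<longrightarrow>
     (\<Sum>x | arrow_target x = i. sgn_arrow x * T (j, as @ x # bar x # bs)) = 0)"

lemma linear_ext_relation:
  assumes T: "respects_relations T"
  shows "linear_ext T (Poly_Mapping.single p c \<star> \<sigma> i \<star> Poly_Mapping.single q d) = 0"
proof (cases "source p = i \<and> target q = i")
  case True
  obtain i' as where p: "Rep_path p = (i', as)" by (cases "Rep_path p")
  obtain j bs where q: "Rep_path q = (j, bs)" by (cases "Rep_path q")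
  have i': "i' = i" and end_bs: "walk_end j bs = i"
    using True p q by (simp_all add: source.rep_eq target.rep_eq)
  have walks: "walk i as" "walk j bs" using Rep_path[of p] Rep_path[of q] p q i' by simp_all
  have "Poly_Mapping.single p c \<star> scale (sgn_arrow x) (arrow_elem x \<star> arrow_elem (bar x)) \<star> Poly_Mapping.single q d
     = scale (c * d * sgn_arrow x) (Poly_Mapping.single (compose (compose p (two_path x (bar x))) q) 1)"
    if x: "arrow_target x = i" for x
    using x True
    by (simp add: arrow_mult path_mult_scale_left path_mult_scale_right path_mult_single target_two_path
        source_two_path source_compose scale_single mult_ac)
  moreover have "Rep_path (compose (compose p (two_path x (bar x))) q) = (j, as @ x # bar x # bs)"
    if x: "arrow_target x = i" for x
    using x by (simp add: p q i' end_bs compose.rep_eq two_path_def arrow_path.rep_eq)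
  ultimately have "linear_ext T (Poly_Mapping.single p c \<star> \<sigma> i \<star> Poly_Mapping.single q d)
      = (\<Sum>x | arrow_target x = i. c * d * (sgn_arrow x * T (j, as @ x # bar x # bs)))"
    unfolding sigma_eq path_mult_sum_left path_mult_sum_right linear_ext_sum
    by (intro sum.cong refl) (simp add: linear_ext_scale linear_ext_single mult.assoc)
  also have "\<dots> = c * d * (\<Sum>x | arrow_target x = i. sgn_arrow x * T (j, as @ x # bar x # bs))"
    by (simp add: sum_distrib_left)
  also have "(\<Sum>x | arrow_target x = i. sgn_arrow x * T (j, as @ x # bar x # bs)) = 0"
    using T walks end_bs unfolding respects_relations_def by blast
  finally show ?thesis by simp
next
  case False
  have p: "Poly_Mapping.single p c = Poly_Mapping.single p c \<star> vertex_elem (source p)"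
    and q: "Poly_Mapping.single q d = vertex_elem (target q) \<star> Poly_Mapping.single q d"
    using compose_trivial_left[of q] compose_trivial_right[of p] by (simp_all add: vertex_elem_def path_mult_single)
  have "Poly_Mapping.single p c \<star> \<sigma> i \<star> Poly_Mapping.single q d
     = Poly_Mapping.single p c \<star> (vertex_elem (source p) \<star> \<sigma> i \<star> vertex_elem (target q)) \<star> Poly_Mapping.single q d"
    by (subst p, subst q) (simp only: path_mult_assoc)
  also have "vertex_elem (source p) \<star> \<sigma> i \<star> vertex_elem (target q) = 0"
    using False by (auto simp: vertex_mult_sigma sigma_mult_vertex)
  finally show ?thesis by simp
qed

lemma linear_ext_ideal:
  assumes T: "respects_relations T" and x: "x \<in> relation_ideal"
  shows "linear_ext T x = 0"
proof -
  have sigma: "linear_ext T (u \<star> \<sigma> i \<star> v) = 0" for u v i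
  proof (induction u rule: path_elem_induct)
    case (single p c)
    show ?case
      by (induction v rule: path_elem_induct)
         (simp_all add: linear_ext_relation[OF T] path_mult_add_right linear_ext_add)
  qed (simp_all add: path_mult_add_left linear_ext_add)
  have R: "linear_ext T (u \<star> r \<star> v) = 0" if "r \<in> R_space" for u r v
    using that unfolding R_space_def
  proof (induction rule: path_algebra.span_induct_alt)
    case (step c s y)
    then obtain i where "s = \<sigma> i" by blast
    with step show ?case
      by (simp add: path_mult_add_left path_mult_add_right path_mult_scale_left path_mult_scale_right
          linear_ext_add linear_ext_scale sigma)
  qed simp
  show ?thesis
    using x unfolding relation_ideal_def
  proof (induction rule: path_algebra.span_induct_alt)
    case (step c s y)
    then obtain u r v where "s = u \<star> r \<star> v" "r \<in> R_space" by blast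
    with step R show ?case by (simp add: linear_ext_add linear_ext_scale)
  qed simp
qed

text \<open>The preimage is arbitrary; for weights that respect the relations the value does not
  depend on it (\<open>functional_proj\<close>).\<close>

definition functional :: "'f::field weight \<Rightarrow> 'f preproj \<Rightarrow> 'f" where
  "functional T a = linear_ext T (SOME x. proj x = a)"

lemma functional_proj:
  assumes "respects_relations T"
  shows "functional T (proj x) = linear_ext T x"
proof -
  have "proj (SOME y. proj y = proj x) = proj x" by (rule someI) (rule refl)
  then have "(SOME y. proj y = proj x) - x \<in> relation_ideal" by (simp only: proj_eq_iff)
  from linear_ext_ideal[OF assms this] show ?thesis
    by (simp add: functional_def linear_ext_diff)
qed

lemma functional_add:
  assumes "respects_relations T"
  shows "functional T (x + y) = functional T x + functional T y"
proof -
  obtain x' y' where "x = proj x'" "y = proj y'" using proj_surj by metis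
  then show ?thesis by (simp only: proj_add[symmetric] functional_proj[OF assms] linear_ext_add)
qed

lemma functional_0: "respects_relations T \<Longrightarrow> functional T 0 = 0"
  using functional_proj[of T 0] by simp

lemma functional_minus: "respects_relations T \<Longrightarrow> functional T (- x) = - functional T x"
  using functional_add[of T "-x" x] functional_0[of T] by (simp add: eq_neg_iff_add_eq_0)

lemma functional_diff: "respects_relations T \<Longrightarrow> functional T (x - y) = functional T x - functional T y"
  using functional_add[of T x "-y"] functional_minus[of T y] by simp

text \<open>A last arrow is split off because it fixes the source; the empty word is 1, a sum over
  all vertices.\<close>

lemma functional_word:
  assumes "respects_relations T" "walk i (as @ [a])"
  shows "functional T (word (as @ [a])) = T (i, as @ [a])"
proof -
  define p where "p = Abs_path (i, as @ [a])"
  have rep: "Rep_path p = (i, as @ [a])" unfolding p_def using assms(2) by (rule Rep_Abs_path)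
  have "arrow_source a = i" using assms(2) by (simp add: walk_append)
  then have "word (as @ [a]) = (proj (Poly_Mapping.single p 1) :: 'a preproj)"
    unfolding proj_path rep by (simp add: word_append mult.assoc source.rep_eq rep ar_mult_e)
  then show ?thesis by (simp add: functional_proj[OF assms(1)] linear_ext_single rep)
qed

section \<open>Traces\<close>

text \<open>The weight of a closed path depends only on the multiplicities of its arrows, hence it is invariant under
  rotation and defines a trace.\<close>

definition trace_weight :: "nat \<Rightarrow> ((arrow \<Rightarrow> nat) \<Rightarrow> int) \<Rightarrow> 'f::field weight" where
  "trace_weight n \<theta> = (\<lambda>(i, as). if walk_end i as = i \<and> length as = n then of_int (\<theta> (count_list as)) else 0)"

lemma trace_weight_rotate:
  assumes "walk i as" "walk j bs" "walk_end j bs = i" "walk_end i as = j"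
  shows "trace_weight n \<theta> (j, as @ bs) = trace_weight n \<theta> (i, bs @ as)"
proof -
  have "count_list (as @ bs) = count_list (bs @ as)" by (simp add: fun_eq_iff)
  then show ?thesis
    using assms by (simp add: trace_weight_def walk_end_append add.commute)
qed

lemma linear_ext_trace_commute:
  "linear_ext (trace_weight n \<theta>) (x \<star> y) = linear_ext (trace_weight n \<theta>) (y \<star> x)"
proof (induction x rule: path_elem_induct)
  case (single p c)
  show ?case
  proof (induction y rule: path_elem_induct)
    case (single q d)
    obtain i as where p: "Rep_path p = (i, as)" by (cases "Rep_path p")
    obtain j bs where q: "Rep_path q = (j, bs)" by (cases "Rep_path q")
    have w: "walk i as" "walk j bs" using Rep_path[of p] Rep_path[of q] p q by simp_all
    show ?case
    proof (cases "walk_end j bs = i \<and> walk_end i as = j")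
      case True
      then show ?thesis
        by (simp add: trace_weight_rotate[OF w] path_mult_single linear_ext_single p q source.rep_eq target.rep_eq compose.rep_eq mult_ac)
    next
      case False
      then show ?thesis
        by (auto simp: path_mult_single linear_ext_single p q source.rep_eq target.rep_eq compose.rep_eq
            trace_weight_def walk_end_append)
    qed
  qed (simp_all add: path_mult_add_left path_mult_add_right linear_ext_add)
qed (simp_all add: path_mult_add_left path_mult_add_right linear_ext_add)

lemma functional_trace_commute:
  fixes x y :: "'f::field preproj"
  assumes "respects_relations (trace_weight n \<theta> :: 'f weight)"
  shows "functional (trace_weight n \<theta>) (x * y) = functional (trace_weight n \<theta>) (y * x)"
proof -
  obtain x' y' where "x = proj x'" "y = proj y'" using proj_surj by metis
  then show ?thesis
    by (simp only: proj_mult[symmetric] functional_proj[OF assms] linear_ext_trace_commute[of n \<theta> x' y'])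
qed

text \<open>The differential of a 1-cochain is a sum of commutators, so a trace kills it.\<close>

lemma trace_not_exact:
  fixes \<psi> :: "vertex \<Rightarrow> 'f::field preproj"
  assumes T: "respects_relations (trace_weight n \<theta> :: 'f weight)"
    and "(\<Sum>i\<in>UNIV. functional (trace_weight n \<theta>) (\<psi> i)) \<noteq> 0"
  shows "\<not> exact2 \<psi>"
proof
  assume "exact2 \<psi>"
  then obtain \<phi> where \<phi>: "\<And>i. \<psi> i = d1 \<phi> i" unfolding exact2_def by blast
  let ?F = "functional (trace_weight n \<theta>)"
  have "?F (ar x * \<phi> y) = ?F (\<phi> y * ar x)" for x y
    by (rule functional_trace_commute[OF T])
  then have "(\<Sum>i\<in>UNIV. ?F (d1 \<phi> i)) = 0"
    by (simp add: UNIV_vertex d1_def functional_add[OF T] functional_diff[OF T] functional_minus[OF T])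
  with assms(2) show False by (simp add: \<phi>)
qed

section \<open>Verification of traces by enumerating closed paths\<close>

definition arrow_list :: "arrow list" where
  "arrow_list = [A0, A1, A2, A3, A4, A0s, A1s, A2s, A3s, A4s]"

lemma set_arrow_list: "set arrow_list = UNIV"
  by (simp add: arrow_list_def arrow_UNIV)

fun walks :: "vertex \<Rightarrow> nat \<Rightarrow> arrow list list" where
  "walks i 0 = [[]]"
| "walks i (Suc n) = concat (map (\<lambda>as. map (\<lambda>a. a # as) (filter (\<lambda>a. arrow_source a = walk_end i as) arrow_list)) (walks i n))"

lemma walk_in_walks: "walk i as \<Longrightarrow> as \<in> set (walks i (length as))"
  by (induction as) (auto simp: set_arrow_list)

text \<open>An executable form of \<open>respects_relations\<close>. By invariance under rotation
  only the closed path around the relation matters; it has length \<open>n\<close>, two less than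
  the paths that are weighed. Divisibility by \<open>m\<close> stands for vanishing in the
  field.\<close>

definition trace_check :: "nat \<Rightarrow> int \<Rightarrow> ((arrow \<Rightarrow> nat) \<Rightarrow> int) \<Rightarrow> bool" where
  "trace_check n m \<theta> \<longleftrightarrow> (\<forall>i\<in>{V0, V1, V2, V3, V4, V5}. \<forall>as\<in>set (walks i n). walk_end i as = i \<longrightarrow>
     m dvd (\<Sum>x\<leftarrow>filter (\<lambda>x. arrow_target x = i) arrow_list.
        (if starred x then -1 else 1) * \<theta> (count_list (x # bar x # as))))"

lemma trace_check_respects:
  assumes check: "trace_check n (int (CHAR('f))) \<theta>"
  shows "respects_relations (trace_weight (n + 2) \<theta> :: 'f::field weight)"
  unfolding respects_relations_def
proof (intro allI impI, elim conjE)
  fix j i as bs assume w: "walk j bs" "walk_end j bs = i" "walk i as"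
  show "(\<Sum>x | arrow_target x = i. sgn_arrow x * (trace_weight (n + 2) \<theta> (j, as @ x # bar x # bs) :: 'f)) = 0"
  proof (cases "walk_end i as = j \<and> length (bs @ as) = n")
    case True
    have wi: "walk i (bs @ as)" "walk_end i (bs @ as) = i"
      using w True by (simp_all add: walk_append walk_end_append)
    let ?S = "\<Sum>x\<leftarrow>filter (\<lambda>x. arrow_target x = i) arrow_list.
        (if starred x then -1 else 1) * \<theta> (count_list (x # bar x # bs @ as))"
    have "bs @ as \<in> set (walks i n)" using walk_in_walks[OF wi(1)] True by simp
    moreover have "i \<in> {V0, V1, V2, V3, V4, V5}" by (cases i) simp_all
    ultimately have "int (CHAR('f)) dvd ?S"
      using check wi(2) unfolding trace_check_def by blast
    then have zero: "(of_int ?S :: 'f) = 0" by (simp only: of_int_eq_0_iff_char_dvd)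
    have counts: "count_list (as @ x # bar x # bs) = count_list (x # bar x # bs @ as)" for x
      by (simp add: fun_eq_iff)
    have "(\<Sum>x | arrow_target x = i. sgn_arrow x * (trace_weight (n + 2) \<theta> (j, as @ x # bar x # bs) :: 'f))
       = (\<Sum>x | arrow_target x = i. of_int ((if starred x then -1 else 1) * \<theta> (count_list (x # bar x # bs @ as))))"
      using True w
      by (intro sum.cong refl) (simp add: trace_weight_def counts walk_end_append sgn_arrow_def)
    also have "\<dots> = of_int ?S"
    proof -
      have "distinct (filter (\<lambda>x. arrow_target x = i) arrow_list)" by (simp add: arrow_list_def)
      moreover have "set (filter (\<lambda>x. arrow_target x = i) arrow_list) = {x. arrow_target x = i}"
        by (simp add: set_arrow_list)
      ultimately show ?thesis by (simp add: sum_list_distinct_conv_sum_set)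
    qed
    finally show ?thesis using zero by simp
  next
    case False
    then have "trace_weight (n + 2) \<theta> (j, as @ x # bar x # bs) = (0 :: 'f)" if "arrow_target x = i" for x
      using w that by (auto simp: trace_weight_def walk_end_append)
    then show ?thesis by (intro sum.neutral) auto
  qed
qed

text \<open>These traces are determined by their values at \<open>c\<^sub>0c\<^sub>2\<close>, \<open>c\<^sub>0c\<^sub>3\<close>, \<open>c\<^sub>2c\<^sub>3\<close> in degree 4, and at the cubic words in
  \<open>c\<^sub>0\<close>, \<open>c\<^sub>2\<close>, \<open>c\<^sub>3\<close> in degree 6: in characteristic 3, \<open>c\<^sub>2c\<^sub>3\<^sup>2 = -1\<close>, \<open>c\<^sub>0c\<^sub>2\<^sup>2 = c\<^sub>0c\<^sub>3\<^sup>2 = c\<^sub>2\<^sup>2c\<^sub>3 = c\<^sub>0c\<^sub>2c\<^sub>3 = c\<^sub>0c\<^sub>3c\<^sub>2 = 1\<close>, and the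
  remaining ones are 0.\<close>

definition theta4 :: "(arrow \<Rightarrow> nat) \<Rightarrow> int" where
  "theta4 m = (if m A0 = 0 \<and> m A2 = 0 \<or> m A0 = 0 \<and> m A3 = 0 \<or> m A2 = 0 \<and> m A3 = 0 then 0 else 1)"

text \<open>A closed path in a tree crosses each edge equally often in both directions, so the
  multiplicities of unstarred arrows suffice as keys. The keys that contain \<open>A1\<close> or
  \<open>A4\<close> repeat the values for \<open>c\<^sub>2^2\<close> and \<open>c\<^sub>3^2\<close>,
  which the relations at the vertices 2 and 4 rewrite as detours to the vertices 1 and 5.\<close>

definition theta6 :: "(arrow \<Rightarrow> nat) \<Rightarrow> int" where
  "theta6 m = (let k = (m A0, m A1, m A2, m A3, m A4) in
     if k \<in> {(0, 0, 1, 2, 0), (0, 0, 1, 1, 1)} then -1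
     else if k \<in> {(1, 0, 0, 2, 0), (1, 0, 0, 1, 1), (0, 0, 2, 1, 0), (0, 1, 1, 1, 0), (1, 0, 2, 0, 0), (1, 1, 1, 0, 0),
       (1, 0, 1, 1, 0)} then 1 else 0)"

lemma trace_check_4: "trace_check 2 2 theta4"
  by code_simp

lemma trace_check_6: "trace_check 4 3 theta6"
  by code_simp

section \<open>Cochains of degree 2 that are not coboundaries\<close>

lemma sum_at_0:
  assumes "respects_relations T"
  shows "(\<Sum>i\<in>UNIV. functional T (at_0 y i)) = functional T y"
  by (simp add: UNIV_vertex at_0_def functional_0[OF assms])

lemma gamma4_not_exact:
  assumes "CHAR('f::field) = 2"
  shows "\<not> exact2 (gamma4_val :: vertex \<Rightarrow> 'f preproj)"
proof -
  have T: "respects_relations (trace_weight 4 theta4 :: 'f weight)"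
    using trace_check_respects[of 2 theta4, where ?'f = 'f] trace_check_4 assms by simp
  have "a\<^sub>0\<^sup>* * c\<^sub>3 * a\<^sub>0 = (word ([A0s, A3s, A3] @ [A0]) :: 'f preproj)"
    by (simp add: c\<^sub>3_def mult.assoc)
  then have "functional (trace_weight 4 theta4) (a\<^sub>0\<^sup>* * c\<^sub>3 * a\<^sub>0) = (1 :: 'f)"
    using functional_word[OF T, of V0 "[A0s, A3s, A3]" A0] by (simp add: trace_weight_def theta4_def)
  then show ?thesis by (intro trace_not_exact[OF T]) (simp add: sum_at_0[OF T])
qed

lemma gamma6_not_exact:
  assumes "CHAR('f::field) = 3"
  shows "\<not> exact2 (gamma6_val :: vertex \<Rightarrow> 'f preproj)"
proof -
  have T: "respects_relations (trace_weight 6 theta6 :: 'f weight)"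
    using trace_check_respects[of 4 theta6, where ?'f = 'f] trace_check_6 assms by simp
  have "a\<^sub>0\<^sup>* * c\<^sub>3^2 * a\<^sub>0 = (word ([A0s, A3s, A3, A3s, A3] @ [A0]) :: 'f preproj)"
    by (simp add: c\<^sub>3_def power2_eq_square mult.assoc)
  then have "functional (trace_weight 6 theta6) (a\<^sub>0\<^sup>* * c\<^sub>3^2 * a\<^sub>0) = (1 :: 'f)"
    using functional_word[OF T, of V0 "[A0s, A3s, A3, A3s, A3]" A0] by (simp add: trace_weight_def theta6_def)
  then show ?thesis by (intro trace_not_exact[OF T]) (simp add: sum_at_0[OF T])
qed

text \<open>Every term of a coboundary contains an arrow, so its values are represented in
  \<open>positive_part\<close>, which is disjoint from the representatives of a vertex
  idempotent.\<close>

lemma h_not_exact: "\<not> exact2 (h_val j :: vertex \<Rightarrow> 'f::field preproj)"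
proof
  assume "exact2 (h_val j :: vertex \<Rightarrow> 'f preproj)"
  then obtain \<phi> :: "arrow \<Rightarrow> 'f preproj" where \<phi>: "\<And>i. h_val j i = d1 \<phi> i" unfolding exact2_def by blast
  have "\<forall>x. \<exists>u. \<phi> x = proj u"
  proof
    fix x obtain u where "\<phi> x = proj u" by (rule proj_surj)
    then show "\<exists>u. \<phi> x = proj u" by blast
  qed
  then obtain y where y: "\<And>x. \<phi> x = proj (y x)" by (auto dest: choice)
  have a: "arrow_elem x \<in> positive_part" for x
    by (auto simp: positive_part_iff arrow_elem_def lookup_single when_def)
  have m: "u \<star> arrow_elem x + arrow_elem x' \<star> v \<in> positive_part" for u v x x'
    using a by (intro positive_part_add positive_part_mult) auto
  have neg: "u \<in> positive_part \<Longrightarrow> - u \<in> positive_part" for u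
    using positive_part_scale[of u "-1"] by simp
  have diff: "u \<in> positive_part \<Longrightarrow> v \<in> positive_part \<Longrightarrow> u - v \<in> positive_part" for u v
    using positive_part_add[OF _ neg, of u v] by simp
  have "\<exists>u\<in>positive_part. d1 \<phi> j = proj u"
  proof -
    define \<mu> where "\<mu> x = y x \<star> arrow_elem (bar x) + arrow_elem x \<star> y (bar x)" for x
    have \<mu>: "\<mu> x \<in> positive_part" "\<phi> x * ar (bar x) + ar x * \<phi> (bar x) = proj (\<mu> x)" for x
      unfolding \<mu>_def y proj_add proj_mult by (rule m) (rule refl)
    have "d1 \<phi> j = sigma_eval (\<lambda>x. proj (\<mu> x)) j" unfolding d1_def \<mu>(2) ..
    also have "\<exists>u\<in>positive_part. \<dots> = proj u"
      by (cases j) (auto simp: proj_minus[symmetric] proj_diff[symmetric] proj_add[symmetric] intro!: \<mu>(1) neg diff positive_part_add)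
    finally show ?thesis .
  qed
  then obtain u :: "path \<Rightarrow>\<^sub>0 'f" where u: "u \<in> positive_part" "proj (vertex_elem j) = proj u"
    using \<phi>[of j] by (auto simp: h_val_def)
  then have "vertex_elem j - u \<in> positive_part"
    unfolding proj_eq_iff using relation_ideal_subset_positive_part by blast
  from positive_part_add[OF this u(1)] have "vertex_elem j \<in> (positive_part :: (path \<Rightarrow>\<^sub>0 'f) set)" by simp
  then have "lookup (vertex_elem j :: path \<Rightarrow>\<^sub>0 'f) (trivial_path j) = 0" unfolding positive_part_iff by simp
  then show False by (simp add: vertex_elem_def)
qed

section \<open>The algebra of closed paths at vertex 3\<close>

text \<open>\<open>e\<^sub>3 A e\<^sub>3\<close> has the basis \<open>1, c\<^sub>0, c\<^sub>2, c\<^sub>2c\<^sub>0, c\<^sub>0c\<^sub>2, c\<^sub>2\<^sup>2, c\<^sub>0c\<^sub>2c\<^sub>0, c\<^sub>2\<^sup>2c\<^sub>0, c\<^sub>0c\<^sub>2\<^sup>2, c\<^sub>0c\<^sub>2\<^sup>2c\<^sub>0, c\<^sub>2\<^sup>2c\<^sub>0c\<^sub>2,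
  c\<^sub>0c\<^sub>2\<^sup>2c\<^sub>0c\<^sub>2\<close>, numbered from 0 to 11. The operators below are the left and right multiplications by
  \<open>c\<^sub>0\<close> and \<open>c\<^sub>2\<close> on coordinate vectors.\<close>

definition left0 :: "(nat \<Rightarrow> 'f::field) \<Rightarrow> nat \<Rightarrow> 'f" where
  "left0 g k = (if k = 1 then g 0 else if k = 4 then g 2 else if k = 6 then g 3 else if k = 8 then g 5
     else if k = 9 then g 7 else if k = 11 then g 10 else 0)"

text \<open>The negative entries stem from c2c0c2 = -(c0c2c0 + c2^2c0 + c0c2^2), which is (c0 +
  c2)^3 = c3^3 = 0 expanded with c0^2 = c2^3 = 0.\<close>

definition left2 :: "(nat \<Rightarrow> 'f::field) \<Rightarrow> nat \<Rightarrow> 'f" where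
  "left2 g k = (if k = 2 then g 0 else if k = 3 then g 1 else if k = 5 then g 2 else if k = 7 then g 3 - g 4
     else if k = 6 then - g 4 else if k = 8 then - g 4 else if k = 9 then g 8 - g 6 else if k = 10 then - g 8
     else if k = 11 then g 9 else 0)"

text \<open>Left multiplication by c3 = c0 + c2, the relation at vertex 3; \<open>left3_eq\<close>
  confirms the entries.\<close>

definition left3 :: "(nat \<Rightarrow> 'f::field) \<Rightarrow> nat \<Rightarrow> 'f" where
  "left3 g k = (if k = 1 then g 0 else if k = 2 then g 0 else if k = 3 then g 1 else if k = 4 then g 2
     else if k = 5 then g 2 else if k = 6 then g 3 - g 4 else if k = 7 then g 3 - g 4 else if k = 8 then g 5 - g 4
     else if k = 9 then g 7 + g 8 - g 6 else if k = 10 then - g 8 else if k = 11 then g 9 + g 10 else 0)"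

definition right0 :: "(nat \<Rightarrow> 'f::field) \<Rightarrow> nat \<Rightarrow> 'f" where
  "right0 g k = (if k = 1 then g 0 else if k = 3 then g 2 else if k = 6 then g 4 else if k = 7 then g 5
     else if k = 9 then g 8 else if k = 11 then - g 10 else 0)"

definition right2 :: "(nat \<Rightarrow> 'f::field) \<Rightarrow> nat \<Rightarrow> 'f" where
  "right2 g k = (if k = 2 then g 0 else if k = 4 then g 1 else if k = 5 then g 2 else if k = 7 then - g 3
     else if k = 6 then - g 3 else if k = 8 then g 4 - g 3 else if k = 9 then - g 6 else if k = 10 then g 7
     else if k = 11 then g 9 + g 10 else 0)"

definition unit_vec :: "nat \<Rightarrow> 'f::field" where
  "unit_vec k = (if k = 0 then 1 else 0)"

text \<open>The module \<open>A e\<^sub>3\<close>: its components at the vertices are embedded into the one at vertex 3, where the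
  arrows pointing to vertex 3 become inclusions.\<close>

fun act_arrow :: "arrow \<Rightarrow> (nat \<Rightarrow> 'f::field) \<Rightarrow> nat \<Rightarrow> 'f" where
  "act_arrow A0s g = left0 g"
| "act_arrow A1s g = left2 g"
| "act_arrow A2s g = left2 g"
| "act_arrow A3 g = left3 g"
| "act_arrow A4 g = left3 g"
| "act_arrow _ g = g"

fun act :: "arrow list \<Rightarrow> (nat \<Rightarrow> 'f::field) \<Rightarrow> nat \<Rightarrow> 'f" where
  "act [] g = g"
| "act (a # as) g = act_arrow a (act as g)"

lemma act_append: "act (as @ bs) g = act as (act bs g)"
  by (induction as) simp_all

text \<open>Conditions met by the images of the components, for instance c2a2a1 = 0 by the relations
  at the vertices 2 and 1. At the vertices 0, 1 and 5 the condition is the relation itself; at 2 and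
  4 it ensures the condition at the next vertex, 1 or 5.\<close>

fun in_component :: "vertex \<Rightarrow> (nat \<Rightarrow> 'f::field) \<Rightarrow> bool" where
  "in_component V0 g \<longleftrightarrow> left0 g = (\<lambda>_. 0)"
| "in_component V1 g \<longleftrightarrow> left2 g = (\<lambda>_. 0)"
| "in_component V2 g \<longleftrightarrow> left2 (left2 g) = (\<lambda>_. 0)"
| "in_component V3 g \<longleftrightarrow> True"
| "in_component V4 g \<longleftrightarrow> left3 (left3 g) = (\<lambda>_. 0)"
| "in_component V5 g \<longleftrightarrow> left3 g = (\<lambda>_. 0)"

lemmas op_defs = left0_def left2_def left3_def right0_def right2_def

text \<open>The nilpotency of c0, c2 and c3, needed when an arrow leaves vertex 3 for the vertices
  0, 2 and 4.\<close>

lemma left0_square: "left0 (left0 g) = (\<lambda>_. 0)"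
  and left2_cube: "left2 (left2 (left2 g)) = (\<lambda>_. 0)"
  and left3_cube: "left3 (left3 (left3 g)) = (\<lambda>_. 0)"
  by (rule ext, simp add: op_defs)+

lemma op_zero: "left0 (\<lambda>_. 0) = (\<lambda>_. 0)" "left2 (\<lambda>_. 0) = (\<lambda>_. 0)" "left3 (\<lambda>_. 0) = (\<lambda>_. 0)"
  by (rule ext, simp add: op_defs)+

lemma left3_eq: "left3 g k = left0 g k + left2 g k"
  by (auto simp: op_defs)

lemma act_in_component:
  "in_component (arrow_source a) g \<Longrightarrow> in_component (arrow_target a) (act_arrow a g)"
  using left0_square[of g] left2_cube[of g] left3_cube[of g] by (cases a) (simp_all add: op_zero)

lemma act_walk_in_component: "walk i as \<Longrightarrow> in_component i g \<Longrightarrow> in_component (walk_end i as) (act as g)"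
  by (induction as) (simp_all add: act_in_component)

lemma act_arrow_commute:
  "act_arrow a (right0 g) = right0 (act_arrow a g)" "act_arrow a (right2 g) = right2 (act_arrow a g)"
  by (rule ext, cases a; simp add: op_defs)+

lemma act_commute: "act as (right0 g) = right0 (act as g)" "act as (right2 g) = right2 (act as g)"
  by (induction as) (simp_all add: act_arrow_commute)

lemma act_arrow_linear: "act_arrow a (\<lambda>k. c * g k + d * g' k) = (\<lambda>k. c * act_arrow a g k + d * act_arrow a g' k)"
  by (rule ext, cases a; simp add: op_defs algebra_simps)

lemma act_linear: "act as (\<lambda>k. c * g k + d * g' k) = (\<lambda>k. c * act as g k + d * act as g' k)"
  by (induction as) (simp_all add: act_arrow_linear)

lemma act_zero: "act as (\<lambda>_. 0) = (\<lambda>_. 0)"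
  using act_linear[of as 0 "\<lambda>_. 0" 0 "\<lambda>_. 0"] by simp

lemma act_sum: "finite S \<Longrightarrow> act as (\<lambda>k. \<Sum>x\<in>S. c x * g x k) = (\<lambda>k. \<Sum>x\<in>S. c x * act as (g x) k)"
proof (induction S rule: finite_induct)
  case (insert x S)
  then show ?case using act_linear[of as "c x" "g x" 1 "\<lambda>k. \<Sum>x\<in>S. c x * g x k"] by simp
qed (simp add: act_zero)

lemma act_relation:
  assumes "in_component i g"
  shows "(\<Sum>x | arrow_target x = i. sgn_arrow x * act_arrow x (act_arrow (bar x) g) k) = 0"
proof -
  have "(\<Sum>x | arrow_target x = i. sgn_arrow x * act_arrow x (act_arrow (bar x) g) k)
     = (\<Sum>x\<in>UNIV. if arrow_target x = i then sgn_arrow x * act_arrow x (act_arrow (bar x) g) k else 0)"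
    by (simp add: sum.If_cases)
  also have "\<dots> = 0"
    using assms by (cases i) (simp_all add: arrow_UNIV sgn_arrow_def left3_eq)
  finally show ?thesis .
qed

lemma act_relation_list:
  assumes "walk j bs" "in_component j g"
  shows "(\<Sum>x | arrow_target x = walk_end j bs. sgn_arrow x * act (as @ x # bar x # bs) g k) = 0"
proof -
  let ?i = "walk_end j bs"
  have "(\<Sum>x | arrow_target x = ?i. sgn_arrow x * act (as @ x # bar x # bs) g k) =
      act as (\<lambda>k. \<Sum>x | arrow_target x = ?i. sgn_arrow x * act_arrow x (act_arrow (bar x) (act bs g)) k) k"
    by (subst act_sum) (simp_all add: act_append)
  also have "\<dots> = 0"
    using act_relation[OF act_walk_in_component[OF assms]] by (simp add: act_zero)
  finally show ?thesis .
qed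

section \<open>Coordinates as functionals on A\<close>

definition loop_weight :: "nat \<Rightarrow> 'f::field weight" where
  "loop_weight k = (\<lambda>(i, as). if i = V3 \<and> walk_end i as = V3 then act as unit_vec k else 0)"

lemma loop_weight_respects: "respects_relations (loop_weight k :: 'f::field weight)"
  unfolding respects_relations_def
proof (intro allI impI, elim conjE)
  fix j as bs i assume w: "walk j bs" "walk_end j bs = i" "walk i as"
  show "(\<Sum>x | arrow_target x = i. sgn_arrow x * (loop_weight k (j, as @ x # bar x # bs) :: 'f)) = 0"
  proof (cases "j = V3 \<and> walk_end i as = V3")
    case True
    have "(\<Sum>x | arrow_target x = i. sgn_arrow x * (loop_weight k (j, as @ x # bar x # bs) :: 'f)) =
        (\<Sum>x | arrow_target x = i. sgn_arrow x * act (as @ x # bar x # bs) unit_vec k)"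
      using True by (intro sum.cong refl) (simp add: loop_weight_def walk_end_append)
    then show ?thesis
      using act_relation_list[OF w(1), of unit_vec as k] w(2) True by simp
  next
    case False
    then show ?thesis by (intro sum.neutral) (auto simp: loop_weight_def walk_end_append)
  qed
qed

definition coords :: "'f::field preproj \<Rightarrow> nat \<Rightarrow> 'f" where
  "coords x k = functional (loop_weight k) x"

lemma coords_add: "coords (x + y) = (\<lambda>k. coords x k + coords y k)"
  and coords_diff: "coords (x - y) = (\<lambda>k. coords x k - coords y k)"
  and coords_minus: "coords (- x) = (\<lambda>k. - coords x k)"
  and coords_0: "coords 0 = (\<lambda>_. 0)"
  by (simp_all add: coords_def fun_eq_iff functional_add functional_diff functional_minus functional_0 loop_weight_respects)

lemma coords_proj: "coords (proj x) k = linear_ext (loop_weight k) x"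
  by (simp add: coords_def functional_proj loop_weight_respects)

lemma coords_word: "walk V3 (as @ [a]) \<Longrightarrow> walk_end V3 (as @ [a]) = V3 \<Longrightarrow> coords (word (as @ [a])) = act (as @ [a]) unit_vec"
  by (rule ext) (simp only: coords_def functional_word[OF loop_weight_respects], simp add: loop_weight_def)

lemma linear_ext_left:
  "linear_ext (loop_weight k) (arrow_elem A0 \<star> arrow_elem A0s \<star> x) = left0 (\<lambda>k. linear_ext (loop_weight k) x) k"
  "linear_ext (loop_weight k) (arrow_elem A2 \<star> arrow_elem A2s \<star> x) = left2 (\<lambda>k. linear_ext (loop_weight k) x) k"
proof -
  have "linear_ext (loop_weight k) (arrow_elem A0 \<star> arrow_elem A0s \<star> x) = left0 (\<lambda>k. linear_ext (loop_weight k) x) k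
    \<and> linear_ext (loop_weight k) (arrow_elem A2 \<star> arrow_elem A2s \<star> x) = left2 (\<lambda>k. linear_ext (loop_weight k) x) k"
  proof (induction x rule: path_elem_induct)
    case (single p c)
    obtain i as where p: "Rep_path p = (i, as)" by (cases "Rep_path p")
    show ?case
    proof (cases "target p = V3")
      case True
      then have "walk_end i as = V3" by (simp add: p target.rep_eq)
      with True show ?thesis
        by (simp add: arrow_mult path_mult_single source_two_path linear_ext_single compose.rep_eq two_path_def
            arrow_path.rep_eq p loop_weight_def source_compose)
           (auto simp: op_defs algebra_simps)
    next
      case False
      then have "walk_end i as \<noteq> V3" by (simp add: p target.rep_eq)
      with False show ?thesis
        by (auto simp: arrow_mult path_mult_single source_two_path linear_ext_single p loop_weight_def op_defs)
    qed
  next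
    case (add x y)
    then show ?case
      by (simp add: path_mult_add_right linear_ext_add) (auto simp: op_defs algebra_simps)
  qed (auto simp: op_defs)
  then show "linear_ext (loop_weight k) (arrow_elem A0 \<star> arrow_elem A0s \<star> x) = left0 (\<lambda>k. linear_ext (loop_weight k) x) k"
    "linear_ext (loop_weight k) (arrow_elem A2 \<star> arrow_elem A2s \<star> x) = left2 (\<lambda>k. linear_ext (loop_weight k) x) k"
    by simp_all
qed

lemma unit_vec_right: "left0 unit_vec = right0 unit_vec" "left2 unit_vec = right2 unit_vec"
  by (simp_all add: fun_eq_iff op_defs unit_vec_def)

text \<open>An appended loop acts on \<open>unit_vec\<close> first, where left and right
  multiplication agree; right multiplications then commute with the action of the remaining
  path.\<close>

lemma linear_ext_right:
  "linear_ext (loop_weight k) (x \<star> (arrow_elem A0 \<star> arrow_elem A0s)) = right0 (\<lambda>k. linear_ext (loop_weight k) x) k"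
  "linear_ext (loop_weight k) (x \<star> (arrow_elem A2 \<star> arrow_elem A2s)) = right2 (\<lambda>k. linear_ext (loop_weight k) x) k"
proof -
  have "linear_ext (loop_weight k) (x \<star> (arrow_elem A0 \<star> arrow_elem A0s)) = right0 (\<lambda>k. linear_ext (loop_weight k) x) k
    \<and> linear_ext (loop_weight k) (x \<star> (arrow_elem A2 \<star> arrow_elem A2s)) = right2 (\<lambda>k. linear_ext (loop_weight k) x) k"
  proof (induction x rule: path_elem_induct)
    case (single p c)
    obtain i as where p: "Rep_path p = (i, as)" by (cases "Rep_path p")
    have w: "walk i as" using Rep_path[of p] p by simp
    show ?case
    proof (cases "source p = V3")
      case True
      then have i: "i = V3" by (simp add: p source.rep_eq)
      have "walk_end V3 (as @ [A0, A0s]) = walk_end V3 as" "walk_end V3 (as @ [A2, A2s]) = walk_end V3 as"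
        by (simp_all add: walk_end_append)
      with True i show ?thesis
        by (simp add: arrow_mult path_mult_single target_two_path linear_ext_single compose.rep_eq two_path_def
            arrow_path.rep_eq p loop_weight_def target_compose act_append unit_vec_right act_commute)
           (auto simp: op_defs algebra_simps)
    next
      case False
      then have "i \<noteq> V3" by (simp add: p source.rep_eq)
      with False show ?thesis
        by (auto simp: arrow_mult path_mult_single target_two_path linear_ext_single p loop_weight_def op_defs)
    qed
  next
    case (add x y)
    then show ?case
      by (simp add: path_mult_add_left linear_ext_add) (auto simp: op_defs algebra_simps)
  qed (auto simp: op_defs)
  then show "linear_ext (loop_weight k) (x \<star> (arrow_elem A0 \<star> arrow_elem A0s)) = right0 (\<lambda>k. linear_ext (loop_weight k) x) k"
    "linear_ext (loop_weight k) (x \<star> (arrow_elem A2 \<star> arrow_elem A2s)) = right2 (\<lambda>k. linear_ext (loop_weight k) x) k"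
    by simp_all
qed

lemma coords_mult:
  "coords (a\<^sub>0 * a\<^sub>0\<^sup>* * x) = left0 (coords x)" "coords (a\<^sub>2 * a\<^sub>2\<^sup>* * x) = left2 (coords x)"
  "coords (x * (a\<^sub>0 * a\<^sub>0\<^sup>*)) = right0 (coords x)" "coords (x * (a\<^sub>2 * a\<^sub>2\<^sup>*)) = right2 (coords x)"
proof -
  obtain y where x: "x = proj y" by (rule proj_surj)
  have c: "coords (proj y) = (\<lambda>k. linear_ext (loop_weight k) y)" for y :: "path \<Rightarrow>\<^sub>0 'a"
    by (rule ext) (rule coords_proj)
  show "coords (a\<^sub>0 * a\<^sub>0\<^sup>* * x) = left0 (coords x)" "coords (a\<^sub>2 * a\<^sub>2\<^sup>* * x) = left2 (coords x)"
    "coords (x * (a\<^sub>0 * a\<^sub>0\<^sup>*)) = right0 (coords x)" "coords (x * (a\<^sub>2 * a\<^sub>2\<^sup>*)) = right2 (coords x)"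
    unfolding x proj_mult[symmetric] c by (rule ext, simp only: linear_ext_left linear_ext_right)+
qed

text \<open>A nontrivial closed path at vertex 0 has \<open>A0s\<close> at its left end, so the
  coordinates have the form \<open>left0 (right0 g)\<close>. Entry 11 of this is entry 10 of
  \<open>right0 g\<close>, which is zero.\<close>

lemma coords_loop_0: "coords (a\<^sub>0 * x * a\<^sub>0\<^sup>*) 11 = 0"
proof -
  have "linear_ext (loop_weight 11) (arrow_elem A0 \<star> y \<star> arrow_elem A0s) = (0 :: 'a)" for y :: "path \<Rightarrow>\<^sub>0 'a"
  proof (induction y rule: path_elem_induct)
    case (single p c)
    obtain i as where p: "Rep_path p = (i, as)" by (cases "Rep_path p")
    show ?case
    proof (cases "source p = V0 \<and> target p = V0")
      case True
      then have i: "i = V0" "walk_end V0 as = V0" by (auto simp: p source.rep_eq target.rep_eq)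
      have w: "walk V0 as" using Rep_path[of p] p i by simp
      have "act as (left0 unit_vec) 11 = (0 :: 'a)"
      proof (cases as)
        case Nil then show ?thesis by (simp add: op_defs unit_vec_def)
      next
        case (Cons a bs)
        with i have "a = A0s" by (cases a) simp_all
        with Cons show ?thesis by (simp add: unit_vec_right act_commute) (simp add: op_defs)
      qed
      then have "loop_weight 11 (V3, A0 # as @ [A0s]) = (0 :: 'a)"
        by (simp add: loop_weight_def act_append)
      with True i show ?thesis
        by (simp add: arrow_elem_def path_mult_single linear_ext_single compose.rep_eq arrow_path.rep_eq p source_compose)
    next
      case False
      then show ?thesis by (auto simp: arrow_elem_def path_mult_single source_compose)
    qed
  qed (simp_all add: path_mult_add_left path_mult_add_right linear_ext_add)
  moreover obtain y where x: "x = proj y" by (rule proj_surj)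
  ultimately show ?thesis unfolding x proj_mult[symmetric] coords_proj by blast
qed

section \<open>Cochains of degree 1 that are not coboundaries\<close>

lemma coords_words:
  "coords (a\<^sub>0 * a\<^sub>0\<^sup>*) = left0 unit_vec" "coords (a\<^sub>2 * a\<^sub>2\<^sup>*) = left2 unit_vec"
  using coords_word[of "[A0]" A0s] coords_word[of "[A2]" A2s] by simp_all

text \<open>Commutators with the loops c0 and c2 only involve the component of \<open>z\<close> at
  vertex 3, and \<open>g\<close> consists of its coordinates. The third equation uses the arrow
  \<open>a\<^sub>0\<close> alone: the component of \<open>z\<close> at vertex 0 enters between
  \<open>a\<^sub>0\<close> and its reverse, where coordinate 11 does not see it.\<close>

lemma exact1_coords:
  assumes "exact1 \<phi>"
  obtains g where
    "\<And>k. right0 g k - left0 g k = coords (\<phi> A0 * a\<^sub>0\<^sup>* + a\<^sub>0 * \<phi> A0s) k"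
    "\<And>k. right2 g k - left2 g k = coords (\<phi> A2 * a\<^sub>2\<^sup>* + a\<^sub>2 * \<phi> A2s) k"
    "right0 g 11 = coords (\<phi> A0 * a\<^sub>0\<^sup>*) 11"
proof -
  obtain z where z: "\<And>x. \<phi> x = z * ar x - ar x * z" using assms unfolding exact1_def by blast
  have comm: "\<phi> x * ar (bar x) + ar x * \<phi> (bar x) = z * (ar x * ar (bar x)) - ar x * ar (bar x) * z" for x
    by (simp add: z algebra_simps)
  show thesis
  proof (rule that[of "coords z"])
    show "right0 (coords z) k - left0 (coords z) k = coords (\<phi> A0 * a\<^sub>0\<^sup>* + a\<^sub>0 * \<phi> A0s) k" for k
      using comm[of A0] by (simp add: coords_diff coords_mult)
    show "right2 (coords z) k - left2 (coords z) k = coords (\<phi> A2 * a\<^sub>2\<^sup>* + a\<^sub>2 * \<phi> A2s) k" for k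
      using comm[of A2] by (simp add: coords_diff coords_mult)
    have "z * (a\<^sub>0 * a\<^sub>0\<^sup>*) = \<phi> A0 * a\<^sub>0\<^sup>* + a\<^sub>0 * z * a\<^sub>0\<^sup>*"
      by (simp add: z algebra_simps)
    then have "right0 (coords z) = coords (\<phi> A0 * a\<^sub>0\<^sup>* + a\<^sub>0 * z * a\<^sub>0\<^sup>*)"
      unfolding coords_mult(3)[symmetric] by simp
    then show "right0 (coords z) 11 = coords (\<phi> A0 * a\<^sub>0\<^sup>*) 11"
      by (simp add: coords_add coords_loop_0)
  qed
qed

lemma coords_zeta:
  assumes "exact1 (zeta_val z)"
  obtains g where
    "\<And>k. right0 g k - left0 g k = coords (a\<^sub>0 * z * a\<^sub>0\<^sup>*) k"
    "\<And>k. right2 g k - left2 g k = coords (a\<^sub>2 * z * a\<^sub>2\<^sup>*) k"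
    "right0 g 11 = coords (a\<^sub>0 * z * a\<^sub>0\<^sup>*) 11"
  by (rule exact1_coords[OF assms], rule that) (simp_all add: zeta_val_def)

text \<open>The coordinate at c0 of a commutator with c0 is zero, whereas the prescribed value is c0
  itself.\<close>

lemma zeta0_not_exact: "\<not> exact1 (zeta_val z\<^sub>0 :: arrow \<Rightarrow> 'f::field preproj)"
proof
  assume "exact1 (zeta_val z\<^sub>0 :: arrow \<Rightarrow> 'f preproj)"
  then obtain g :: "nat \<Rightarrow> 'f" where "right0 g 1 - left0 g 1 = coords (a\<^sub>0 * z\<^sub>0 * a\<^sub>0\<^sup>*) 1"
    by (rule coords_zeta) blast
  then show False
    by (simp add: z\<^sub>0_def coords_words) (simp add: op_defs unit_vec_def)
qed

lemma arrow_z_products: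
  "a\<^sub>0 * z\<^sub>6 * a\<^sub>0\<^sup>* = 0" "a\<^sub>2 * z\<^sub>6 * a\<^sub>2\<^sup>* = word ([A0, A0s, A2, A1, A1s, A2s, A0] @ [A0s])"
  "a\<^sub>0 * z\<^sub>8 * a\<^sub>0\<^sup>* = 0" "a\<^sub>2 * z\<^sub>8 * a\<^sub>2\<^sup>* = - word ([A0, A0s, A2, A1, A1s, A2s, A0, A0s, A2] @ [A2s])"
  by (simp_all add: normal_forms path_simps algebra_simps)

lemma coords_socle:
  "coords (word ([A0, A0s, A2, A1, A1s, A2s, A0] @ [A0s])) = (\<lambda>k. if k = 9 then 1 else 0 :: 'f::field)"
  "coords (word ([A0, A0s, A2, A1, A1s, A2s, A0, A0s, A2] @ [A2s])) = (\<lambda>k. if k = 11 then 1 else 0 :: 'f)"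
  by (rule ext, subst coords_word, simp, simp, simp add: op_defs unit_vec_def)+

lemma zeta6_not_exact:
  assumes "CHAR('f::field) \<noteq> 2"
  shows "\<not> exact1 (zeta_val z\<^sub>6 :: arrow \<Rightarrow> 'f preproj)"
proof
  assume "exact1 (zeta_val z\<^sub>6 :: arrow \<Rightarrow> 'f preproj)"
  then obtain g :: "nat \<Rightarrow> 'f" where g:
    "\<And>k. right0 g k - left0 g k = coords (a\<^sub>0 * z\<^sub>6 * a\<^sub>0\<^sup>*) k" "\<And>k. right2 g k - left2 g k = coords (a\<^sub>2 * z\<^sub>6 * a\<^sub>2\<^sup>*) k"
    by (rule coords_zeta) blast
  \<comment> \<open>The three equations give \<open>g 7 = g 8 = - 1\<close> and
    \<open>g 7 + g 8 = 0\<close>, hence 2 = 0.\<close>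
  have "g 8 = g 7" using g(1)[of 9] by (simp only: arrow_z_products coords_0) (simp add: op_defs)
  moreover have "- g 8 = 1" using g(2)[of 9] by (simp only: arrow_z_products coords_socle) (simp add: op_defs)
  moreover have "g 7 = - g 8"
    using g(2)[of 10] by (simp only: arrow_z_products coords_socle) (simp add: op_defs eq_neg_iff_add_eq_0)
  ultimately have "1 + 1 = (0 :: 'f)" by (metis add.right_inverse minus_minus)
  then have "CHAR('f) dvd 2" using of_nat_eq_0_iff_char_dvd[of 2, where ?'a = 'f] by simp
  then have "CHAR('f) \<le> 2" by (rule dvd_imp_le) simp
  moreover have "CHAR('f) \<noteq> 1" by (metis of_nat_1 of_nat_CHAR one_neq_zero)
  moreover have "CHAR('f) \<noteq> 0" using \<open>CHAR('f) dvd 2\<close> by (metis dvd_0_left zero_neq_numeral)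
  ultimately show False using assms by linarith
qed

text \<open>At coordinate 11 the commutator with c0 yields only that twice \<open>g 10\<close> is
  zero, which is void in characteristic 2. The third equation of \<open>coords_zeta\<close> gives
  \<open>g 10 = 0\<close> in every characteristic.\<close>

lemma zeta8_not_exact: "\<not> exact1 (zeta_val z\<^sub>8 :: arrow \<Rightarrow> 'f::field preproj)"
proof
  assume "exact1 (zeta_val z\<^sub>8 :: arrow \<Rightarrow> 'f preproj)"
  then obtain g :: "nat \<Rightarrow> 'f" where g:
    "\<And>k. right2 g k - left2 g k = coords (a\<^sub>2 * z\<^sub>8 * a\<^sub>2\<^sup>*) k" "right0 g 11 = coords (a\<^sub>0 * z\<^sub>8 * a\<^sub>0\<^sup>*) 11"
    by (rule coords_zeta) blast
  have "g 10 = 0" using g(2) by (simp only: arrow_z_products coords_0) (simp add: op_defs)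
  moreover have "g 10 = - 1"
    using g(1)[of 11] by (simp only: arrow_z_products coords_minus coords_socle) (simp add: op_defs)
  ultimately show False by simp
qed

text \<open>The first equation is the cocycle condition at vertex 3, where \<open>rho5_val\<close>
  vanishes on \<open>A3\<close> and \<open>A3s\<close>.\<close>

lemma rho5_products:
  assumes "CHAR('f::field) = 3"
  shows "rho5_val A0 * a\<^sub>0\<^sup>* + a\<^sub>0 * rho5_val A0s = - (rho5_val A2 * a\<^sub>2\<^sup>* + a\<^sub>2 * rho5_val A2s :: 'f preproj)"
    and "rho5_val A0 * a\<^sub>0\<^sup>* + a\<^sub>0 * rho5_val A0s = (word ([A2, A1, A1s, A2s, A0] @ [A0s])
      - word ([A0, A0s, A2, A2s, A0] @ [A0s]) - word ([A0, A0s, A2, A1, A1s] @ [A2s]) :: 'f preproj)"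
  by (simp_all add: rho5_val_def normalize char_3[OF assms])

text \<open>At coordinate 6 the commutators with c0 and with c2 are both \<open>g 4 - g 3\<close>,
  while the values required of them are opposite and nonzero.\<close>

lemma rho5_not_exact:
  assumes "CHAR('f::field) = 3"
  shows "\<not> exact1 (rho5_val :: arrow \<Rightarrow> 'f preproj)"
proof
  assume "exact1 (rho5_val :: arrow \<Rightarrow> 'f preproj)"
  then obtain g :: "nat \<Rightarrow> 'f" where g:
    "\<And>k. right0 g k - left0 g k = coords (rho5_val A0 * a\<^sub>0\<^sup>* + a\<^sub>0 * rho5_val A0s) k"
    "\<And>k. right2 g k - left2 g k = coords (rho5_val A2 * a\<^sub>2\<^sup>* + a\<^sub>2 * rho5_val A2s) k"
    by (rule exact1_coords) blast
  have v: "coords (rho5_val A0 * a\<^sub>0\<^sup>* + a\<^sub>0 * rho5_val A0s) 6 = (- 1 :: 'f)"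
    unfolding rho5_products(2)[OF assms] coords_diff
    by (subst (1 2 3) coords_word) (simp_all add: op_defs unit_vec_def)
  have "g 4 - g 3 = - 1" using g(1)[of 6] v by (simp add: op_defs)
  moreover have "g 4 - g 3 = 1"
    using g(2)[of 6] v unfolding rho5_products(1)[OF assms] coords_minus by (simp add: op_defs)
  ultimately have "1 + 1 = (0 :: 'f)" by (metis add.right_inverse)
  then have "CHAR('f) dvd 2" using of_nat_eq_0_iff_char_dvd[of 2, where ?'a = 'f] by simp
  then show False using assms by simp
qed

text \<open>\<open>\<pi>\<^sub>3\<close> is a loop at vertex 3 with nonzero coordinates;
  \<open>z\<^sub>6\<close> and \<open>z\<^sub>8\<close> are detected after multiplication by
  \<open>a\<^sub>2\<close> and \<open>a\<^sub>2\<^sup>*\<close> on the two sides.\<close>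

lemma central_nonzero: "z\<^sub>6 \<noteq> (0 :: 'f::field preproj)" "z\<^sub>8 \<noteq> (0 :: 'f preproj)" "\<pi>\<^sub>3 \<noteq> (0 :: 'f preproj)"
proof -
  have eq: "\<pi>\<^sub>3 = (- word ([A0, A0s, A2, A1, A1s, A2s, A0, A0s, A2] @ [A2s]) :: 'f preproj)"
    by (simp add: pi3_normal)
  have "coords \<pi>\<^sub>3 11 = (- 1 :: 'f)" unfolding eq coords_minus coords_socle by simp
  then show "\<pi>\<^sub>3 \<noteq> (0 :: 'f preproj)" by (auto simp: coords_0)
  show "z\<^sub>6 \<noteq> (0 :: 'f preproj)"
  proof
    assume "z\<^sub>6 = (0 :: 'f preproj)"
    then have "coords (word ([A0, A0s, A2, A1, A1s, A2s, A0] @ [A0s])) 9 = (0 :: 'f)"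
      unfolding arrow_z_products(2)[symmetric] by (simp add: coords_0)
    then show False by (simp only: coords_socle) simp
  qed
  show "z\<^sub>8 \<noteq> (0 :: 'f preproj)"
  proof
    assume "z\<^sub>8 = (0 :: 'f preproj)"
    then have "coords (- word ([A0, A0s, A2, A1, A1s, A2s, A0, A0s, A2] @ [A2s])) 11 = (0 :: 'f)"
      unfolding arrow_z_products(4)[symmetric] by (simp add: coords_0)
    then show False by (simp only: coords_minus coords_socle) simp
  qed
qed

text \<open>The socle \<open>\<pi>\<^sub>0\<close> of \<open>A e\<^sub>0\<close> acts as zero on \<open>A e\<^sub>3\<close>. It is detected by the closed path
  \<open>a\<^sub>0 p\<close> at vertex 3 obtained from \<open>a\<^sub>0\<^sup>* p\<close>.\<close>

definition socle_weight :: "'f::field weight" where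
  "socle_weight = (\<lambda>(i, as). if i = V0 \<and> walk_end i as = V0 \<and> as \<noteq> [] then act (tl as) (left0 unit_vec) 11 else 0)"

lemma act_closed_0:
  assumes "walk_end V0 as = V0"
  shows "act as (left0 unit_vec) 11 = (0 :: 'f::field)"
proof (cases as)
  case Nil then show ?thesis by (simp add: op_defs unit_vec_def)
next
  case (Cons a bs)
  with assms have "a = A0s" by (cases a) simp_all
  with Cons show ?thesis by (simp add: unit_vec_right act_commute) (simp add: op_defs)
qed

lemma socle_weight_respects: "respects_relations (socle_weight :: 'f::field weight)"
  unfolding respects_relations_def
proof (intro allI impI, elim conjE)
  fix j as bs i assume w: "walk j bs" "walk_end j bs = i" "walk i as"
  show "(\<Sum>x | arrow_target x = i. sgn_arrow x * (socle_weight (j, as @ x # bar x # bs) :: 'f)) = 0"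
  proof (cases "j = V0 \<and> walk_end i as = V0")
    case True
    show ?thesis
    proof (cases as)
      \<comment> \<open>With nothing on its left the relation itself contains the dropped letter, so
        \<open>act_relation_list\<close> does not apply. What remains is \<open>A0\<close> before a
        closed path at vertex 0, with coordinate 11 zero by \<open>act_closed_0\<close>.\<close>
      case Nil
      with True have i: "i = V0" by simp
      have "(socle_weight (j, as @ x # bar x # bs) :: 'f) = 0" if "arrow_target x = i" for x
      proof -
        have "x = A0s" using that i by (cases x) simp_all
        then show ?thesis using Nil True i w act_closed_0[of bs, where ?'f = 'f] by (simp add: socle_weight_def)
      qed
      then show ?thesis by (intro sum.neutral) auto
    next
      case (Cons a as')
      have "(\<Sum>x | arrow_target x = i. sgn_arrow x * (socle_weight (j, as @ x # bar x # bs) :: 'f)) =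
          (\<Sum>x | arrow_target x = i. sgn_arrow x * act (as' @ x # bar x # bs) (left0 unit_vec) 11)"
        using True Cons by (intro sum.cong refl) (simp add: socle_weight_def)
      moreover have "in_component j (left0 unit_vec :: nat \<Rightarrow> 'f)" using True by (simp add: left0_square)
      ultimately show ?thesis
        using act_relation_list[OF w(1), of "left0 unit_vec :: nat \<Rightarrow> 'f" as' 11] w(2) by simp
    qed
  next
    case False
    then show ?thesis by (intro sum.neutral) (auto simp: socle_weight_def walk_end_append)
  qed
qed

lemma pi0_nonzero: "\<pi>\<^sub>0 \<noteq> (0 :: 'f::field preproj)"
proof
  assume "\<pi>\<^sub>0 = (0 :: 'f preproj)"
  then have "word ([A0s, A2, A1, A1s, A2s, A0, A0s, A2, A2s] @ [A0]) = (0 :: 'f preproj)"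
    by (simp add: pi0_normal)
  then have "(socle_weight (V0, [A0s, A2, A1, A1s, A2s, A0, A0s, A2, A2s] @ [A0]) :: 'f) = 0"
    using functional_word[OF socle_weight_respects, of V0 "[A0s, A2, A1, A1s, A2s, A0, A0s, A2, A2s]" A0, where ?'a = 'f]
    by (simp add: functional_0[OF socle_weight_respects])
  then show False by (simp add: socle_weight_def op_defs unit_vec_def)
qed

section \<open>Products of the basis elements\<close>

lemma cup_central_central:
  assumes y: "central y" and z: "central z"
  shows "central_class y \<smile>\<^bsub>0,0\<^esub> central_class z = central_class (y * z)"
proof -
  note c = const_cocycle[OF y] const_cocycle[OF z]
  have "cup_cochain 0 0 (const_cochain y) (const_cochain z) = (\<lambda>w. y * const_cochain z w)"
    unfolding cup_0_left[OF cocycle_cochain[OF c(1)] cocycle_cochain[OF c(2)]] by simp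
  also have "\<dots> = const_cochain (y * z)"
    by (rule ext) (simp add: const_cochain_def central_left_commute[OF y, of "proj _"])
  finally show ?thesis
    unfolding central_class_eq cup_cls[OF c] by simp
qed

lemma cup_central_1:
  assumes z: "central z" and \<phi>: "arrow_typed \<phi>" "\<And>i. d1 \<phi> i = 0"
  shows "central_class z \<smile>\<^bsub>0,1\<^esub> cls 1 (W1.extend \<phi>) = cls 1 (W1.extend (\<lambda>x. z * \<phi> x))"
proof -
  note c = const_cocycle[OF z] extend_1_cocycle[OF \<phi>]
  have "cup_cochain 0 1 (const_cochain z) (W1.extend \<phi>) = (\<lambda>w. z * W1.extend \<phi> w)"
    unfolding cup_0_left[OF cocycle_cochain[OF c(1)] cocycle_cochain[OF c(2)]] by simp
  also have "\<dots> = W1.extend (\<lambda>x. z * \<phi> x)"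
    by (rule ext) (simp add: W1.extend_def sum_distrib_left scalar_left_commute[of z])
  finally show ?thesis unfolding central_class_eq cup_cls[OF c] by simp
qed

lemma cup_central_2:
  assumes z: "central z" and \<psi>: "vertex_typed \<psi>"
  shows "central_class z \<smile>\<^bsub>0,2\<^esub> cls 2 (W2.extend \<psi>) = cls 2 (W2.extend (\<lambda>i. z * \<psi> i))"
proof -
  note c = const_cocycle[OF z] extend_2_cocycle[OF \<psi>]
  have "cup_cochain 0 2 (const_cochain z) (W2.extend \<psi>) = (\<lambda>w. z * W2.extend \<psi> w)"
    unfolding cup_0_left[OF cocycle_cochain[OF c(1)] cocycle_cochain[OF c(2)]] by simp
  also have "\<dots> = W2.extend (\<lambda>i. z * \<psi> i)"
    by (rule ext) (simp add: W2.extend_def sum_distrib_left scalar_left_commute[of z])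
  finally show ?thesis unfolding central_class_eq cup_cls[OF c] by (simp only: add_0)
qed

lemma cup_extend_1_1:
  assumes \<phi>: "arrow_typed \<phi>" "\<And>i. d1 \<phi> i = 0" and \<psi>: "arrow_typed \<psi>" "\<And>i. d1 \<psi> i = 0"
  shows "cls 1 (W1.extend \<phi>) \<smile>\<^bsub>1,1\<^esub> cls 1 (W1.extend \<psi>) = cls 2 (W2.extend (cup11 \<phi> \<psi>))"
proof -
  note c = extend_1_cocycle[OF \<phi>] extend_1_cocycle[OF \<psi>]
  show ?thesis
    unfolding cup_cls[OF c] cup_1_1[OF cocycle_cochain[OF c(1)] cocycle_cochain[OF c(2)]] W1.extend_b one_add_one ..
qed

lemma cls_1_eqI:
  assumes "arrow_typed \<phi>" "\<And>i. d1 \<phi> i = 0" "arrow_typed \<psi>" "\<And>i. d1 \<psi> i = 0" "exact1 (\<lambda>x. \<phi> x - \<psi> x)"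
  shows "cls 1 (W1.extend \<phi>) = cls 1 (W1.extend \<psi>)"
proof -
  have "(\<lambda>w. W1.extend \<phi> w - W1.extend \<psi> w) \<in> coboundaries 1"
    unfolding coboundaries_1 W1.extend_b
    using assms cochain_diff[OF W1_extend_cochain W1_extend_cochain] by (simp add: exact1_def)
  then show ?thesis using cls_eq_iff[OF extend_1_cocycle extend_1_cocycle] assms by blast
qed

lemma cls_2_eqI:
  assumes "vertex_typed \<psi>" "vertex_typed \<psi>'" "exact2 (\<lambda>i. \<psi> i - \<psi>' i)"
  shows "cls 2 (W2.extend \<psi>) = cls 2 (W2.extend \<psi>')"
proof -
  have "(\<lambda>w. W2.extend \<psi> w - W2.extend \<psi>' w) \<in> coboundaries 2"
    unfolding coboundaries_2 W2.extend_b
    using assms cochain_diff[OF W2_extend_cochain W2_extend_cochain] by (simp add: exact2_def)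
  then show ?thesis using cls_eq_iff[OF extend_2_cocycle extend_2_cocycle] assms by blast
qed

lemma cls_1_zero_iff:
  assumes "arrow_typed \<phi>" "\<And>i. d1 \<phi> i = 0"
  shows "cls 1 (W1.extend \<phi>) = HK_zero 1 \<longleftrightarrow> exact1 \<phi>"
  using cls_eq_zero_iff[OF extend_1_cocycle[OF assms]] W1_extend_cochain[OF assms(1)]
  by (simp add: coboundaries_1 W1.extend_b exact1_def)

lemma cls_2_zero_iff:
  assumes "vertex_typed \<psi>"
  shows "cls 2 (W2.extend \<psi>) = HK_zero 2 \<longleftrightarrow> exact2 \<psi>"
  using cls_eq_zero_iff[OF extend_2_cocycle[OF assms]] W2_extend_cochain[OF assms]
  by (simp add: coboundaries_2 W2.extend_b exact2_def)

lemma central_class_zero_iff: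
  assumes "central z"
  shows "central_class z = HK_zero 0 \<longleftrightarrow> z = 0"
proof -
  have "const_cochain z = (\<lambda>_. 0) \<longleftrightarrow> z = 0"
  proof
    assume "const_cochain z = (\<lambda>_. 0)"
    then have "const_cochain z path_one = 0" by simp
    then show "z = 0" by simp
  qed (simp add: const_cochain_def fun_eq_iff)
  then show ?thesis
    unfolding central_class_eq using cls_eq_zero_iff[OF const_cocycle[OF assms]] by (simp add: coboundaries_0)
qed

lemma typed_central_mult:
  assumes "central z"
  shows "arrow_typed \<phi> \<Longrightarrow> arrow_typed (\<lambda>x. z * \<phi> x)" "vertex_typed \<psi> \<Longrightarrow> vertex_typed (\<lambda>i. z * \<psi> i)"
proof -
  show "arrow_typed \<phi> \<Longrightarrow> arrow_typed (\<lambda>x. z * \<phi> x)"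
    by (rule arrow_typed_commute_mult(1)) (simp_all add: centralD[OF assms])
  show "vertex_typed \<psi> \<Longrightarrow> vertex_typed (\<lambda>i. z * \<psi> i)"
    unfolding vertex_typed_def using central_left_commute[OF assms] by (simp add: mult.assoc)
qed

lemma d1_central_mult:
  assumes "central z" "\<And>i. d1 \<phi> i = 0"
  shows "d1 (\<lambda>x. z * \<phi> x) i = 0"
proof -
  have "d1 (\<lambda>x. z * \<phi> x) i = z * d1 \<phi> i"
    unfolding d1_def sigma_eval_mult_left[symmetric]
    by (simp add: distrib_left mult.assoc central_left_commute[OF assms(1), of "ar _"])
  then show ?thesis by (simp add: assms(2))
qed

lemma central_mult_zeta_val: "central z \<Longrightarrow> z * zeta_val y x = zeta_val (z * y) x"
  by (simp add: zeta_val_def central_left_commute)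

lemma exact1_zero: "exact1 (\<lambda>x. 0)"
  unfolding exact1_def by (rule exI[of _ 0]) simp

lemma HK_basis_0: "HK_basis 0 = central_class ` {z\<^sub>0, z\<^sub>6, z\<^sub>8, \<pi>\<^sub>0, \<pi>\<^sub>3}"
  by (simp add: HK_basis_def)

lemma HK_basis_1_cases:
  assumes "X \<in> (HK_basis 1 :: 'f::field cochain set set)"
  obtains z where "z \<in> {z\<^sub>0, z\<^sub>6, z\<^sub>8}" "X = cls 1 (\<zeta> z)"
  | "CHAR('f) = 2" "X = cls 1 \<rho>\<^sub>3" | "CHAR('f) = 3" "X = cls 1 \<rho>\<^sub>5"
  using assms unfolding HK_basis_def by (auto split: if_splits)

lemma HK_basis_2_cases:
  assumes "X \<in> (HK_basis 2 :: 'f::field cochain set set)"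
  obtains j where "X = cls 2 (h j)"
  | "CHAR('f) = 2" "X = cls 2 \<gamma>\<^sub>4" | "CHAR('f) = 3" "X = cls 2 \<gamma>\<^sub>6"
  using assms unfolding HK_basis_def by (auto split: if_splits)

lemma HK_basis_ge_3: "p \<ge> 3 \<Longrightarrow> HK_basis p = {}"
  by (simp add: HK_basis_def)

lemma central_basis: "z \<in> {z\<^sub>0, z\<^sub>6, z\<^sub>8, \<pi>\<^sub>0, \<pi>\<^sub>3} \<Longrightarrow> central z"
  using central_elements by auto

lemma HK_basis_subset: "HK_basis p \<subseteq> (HK p :: 'f::field cochain set set)"
proof
  fix X :: "'f cochain set" assume X: "X \<in> HK_basis p"
  show "X \<in> HK p"
  proof (cases rule: degree_cases[of p])
    case 1
    then obtain z where "central z" "X = central_class z"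
      using X central_basis by (auto simp: HK_basis_0)
    then show ?thesis unfolding 1 by (simp add: central_class_eq cls_HK const_cocycle)
  next
    case 2
    from X[unfolded 2] have "X \<in> HK 1"
    proof (cases rule: HK_basis_1_cases)
      case (1 z)
      then have z: "central z" using central_basis by auto
      show ?thesis unfolding 1(2) zeta_eq[OF z] by (intro cls_HK extend_1_cocycle zeta_val_typed d1_zeta z)
    next
      case 2 then show ?thesis by (simp add: rho_eq cls_HK extend_1_cocycle rho_typed d1_rho3)
    next
      case 3 then show ?thesis by (simp add: rho_eq cls_HK extend_1_cocycle rho_typed d1_rho5)
    qed
    then show ?thesis using 2 by simp
  next
    case 3
    from X[unfolded 3] have "X \<in> HK 2"
      by (cases rule: HK_basis_2_cases)
         (simp_all add: h_eq gamma_eq cls_HK extend_2_cocycle h_val_typed gamma_typed)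
    then show ?thesis using 3 by simp
  next
    case 4
    then show ?thesis using X by (simp add: HK_basis_ge_3)
  qed
qed

section \<open>The listed identities\<close>

lemma cup_z0:
  assumes "X \<in> HK p" shows "central_class z\<^sub>0 \<smile>\<^bsub>0,p\<^esub> X = X"
proof -
  obtain f where f: "f \<in> cocycles p" "X = cls p f" using assms by (rule HK_cases)
  note c = const_cocycle[OF central_elements(1)]
  have "cup_cochain 0 p (const_cochain z\<^sub>0) f = f"
    unfolding cup_0_left[OF cocycle_cochain[OF c] cocycle_cochain[OF f(1)]] by (simp add: z\<^sub>0_def)
  then show ?thesis unfolding f(2) central_class_eq cup_cls[OF c f(1)] by simp
qed

lemma cup_z_zeta0:
  assumes "z \<in> {z\<^sub>0, z\<^sub>6, z\<^sub>8}"
  shows "central_class z \<smile>\<^bsub>0,1\<^esub> cls 1 (\<zeta> z\<^sub>0) = cls 1 (\<zeta> z)"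
proof -
  have z: "central z" using assms central_basis by auto
  note z0 = central_elements(1)
  have "(\<lambda>x. z * zeta_val z\<^sub>0 x) = zeta_val z"
    by (rule ext) (simp add: central_mult_zeta_val[OF z], simp add: z\<^sub>0_def)
  then show ?thesis
    unfolding zeta_eq[OF z] zeta_eq[OF z0] cup_central_1[OF z zeta_val_typed[OF z0] d1_zeta[OF z0]] by simp
qed

lemma z6_h_gamma6:
  assumes "CHAR('f::field) = 3"
  shows "i \<in> {V1, V4} \<Longrightarrow> central_class z\<^sub>6 \<smile>\<^bsub>0,2\<^esub> cls 2 (h i) = cls 2 (\<gamma>\<^sub>6 :: 'f cochain)"
    and "i \<in> {V2, V5} \<Longrightarrow> central_class z\<^sub>6 \<smile>\<^bsub>0,2\<^esub> cls 2 (h i) = cls 2 (- \<gamma>\<^sub>6 :: 'f cochain)"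
proof -
  note z = central_elements(2)
  note typed = typed_central_mult(2)[OF z h_val_typed] gamma_typed(2)
  show "central_class z\<^sub>6 \<smile>\<^bsub>0,2\<^esub> cls 2 (h i) = cls 2 (\<gamma>\<^sub>6 :: 'f cochain)" if "i \<in> {V1, V4}"
    unfolding h_eq gamma_eq cup_central_2[OF z h_val_typed]
    by (rule cls_2_eqI[OF typed]) (use that z6_h1 z6_h4 in auto)
  have minus: "- \<gamma>\<^sub>6 = W2.extend (\<lambda>i. - gamma6_val i :: 'f preproj)"
    unfolding gamma_eq by (rule ext) (simp add: W2.extend_def sum_negf)
  show "central_class z\<^sub>6 \<smile>\<^bsub>0,2\<^esub> cls 2 (h i) = cls 2 (- \<gamma>\<^sub>6 :: 'f cochain)" if "i \<in> {V2, V5}"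
    unfolding h_eq minus cup_central_2[OF z h_val_typed]
    by (rule cls_2_eqI[OF typed(1) vertex_typed_minus[OF typed(2)]]) (use that z6_h2 z6_h5 in auto)
qed

lemma char_2_products:
  assumes char: "CHAR('f::field) = 2"
  shows "central_class z\<^sub>6 \<smile>\<^bsub>0,1\<^esub> cls 1 \<rho>\<^sub>3 = cls 1 (\<zeta> z\<^sub>8 :: 'f cochain)"
    and "cls 1 (\<zeta> z\<^sub>0) \<smile>\<^bsub>1,1\<^esub> cls 1 \<rho>\<^sub>3 = cls 2 (\<gamma>\<^sub>4 :: 'f cochain)"
proof -
  note z = central_elements
  note rho3 = rho_typed(1) d1_rho3[OF char]
  show "central_class z\<^sub>6 \<smile>\<^bsub>0,1\<^esub> cls 1 \<rho>\<^sub>3 = cls 1 (\<zeta> z\<^sub>8 :: 'f cochain)"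
    unfolding rho_eq zeta_eq[OF z(3)] cup_central_1[OF z(2) rho3]
    by (intro cls_1_eqI typed_central_mult(1)[OF z(2)] rho3 d1_central_mult[OF z(2)] zeta_val_typed d1_zeta z
        z6_rho3[OF char])
  show "cls 1 (\<zeta> z\<^sub>0) \<smile>\<^bsub>1,1\<^esub> cls 1 \<rho>\<^sub>3 = cls 2 (\<gamma>\<^sub>4 :: 'f cochain)"
    unfolding rho_eq gamma_eq zeta_eq[OF z(1)] cup_extend_1_1[OF zeta_val_typed[OF z(1)] d1_zeta[OF z(1)] rho3]
    by (intro cls_2_eqI vertex_typed_cup11 zeta_val_typed z rho3(1) gamma_typed zeta0_rho3[OF char])
qed

section \<open>Vanishing of the products that are not listed\<close>

lemma cup_ge_3_zero:
  assumes "X \<in> HK p" "Y \<in> HK q" "p + q \<ge> 3"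
  shows "X \<smile>\<^bsub>p,q\<^esub> Y = HK_zero (p + q)"
proof -
  obtain f where f: "f \<in> cocycles p" "X = cls p f" using assms(1) by (rule HK_cases)
  obtain g where g: "g \<in> cocycles q" "Y = cls q g" using assms(2) by (rule HK_cases)
  show ?thesis
    unfolding f(2) g(2) cup_cls[OF f(1) g(1)] HK_zero_def
      cup_ge_3[OF cocycle_cochain[OF f(1)] cocycle_cochain[OF g(1)] assms(3)] ..
qed

lemma z8_z6: "z\<^sub>8 * z\<^sub>6 = 0"
  by (simp only: centralD[OF central_elements(3)] z_products)

lemma unlisted_0_0:
  assumes "y \<in> {z\<^sub>6, z\<^sub>8, \<pi>\<^sub>0, \<pi>\<^sub>3}" "z \<in> {z\<^sub>6, z\<^sub>8, \<pi>\<^sub>0, \<pi>\<^sub>3}"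
  shows "central_class y \<smile>\<^bsub>0,0\<^esub> central_class z = HK_zero 0"
proof -
  have c: "central y" "central z" using assms central_basis by auto
  have "y * z = 0"
  proof (cases "y \<in> {\<pi>\<^sub>0, \<pi>\<^sub>3} \<or> z \<in> {\<pi>\<^sub>0, \<pi>\<^sub>3}")
    case True
    then show ?thesis
      using pi_z_products[of y z] pi_z_products[of z y] assms centralD[OF c(1), of z] by auto
  next
    case False
    then show ?thesis
      using assms by (auto simp: z_products z8_z6)
  qed
  then show ?thesis
    unfolding cup_central_central[OF c] by (simp add: central_class_zero_iff central_def)
qed

lemma d1_zero: "d1 (\<lambda>x. 0) i = 0"
  by (cases i) (simp_all add: d1_def)

lemma cls_1_extend_zero: "cls 1 (W1.extend (\<lambda>x. 0)) = HK_zero 1"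
  by (subst cls_1_zero_iff) (simp_all add: arrow_typed_def d1_zero exact1_zero)

lemma unlisted_0_1_zeta:
  assumes y: "y \<in> {z\<^sub>6, z\<^sub>8, \<pi>\<^sub>0, \<pi>\<^sub>3}" and w: "w \<in> {z\<^sub>0, z\<^sub>6, z\<^sub>8}" and "y \<in> {z\<^sub>6, z\<^sub>8} \<Longrightarrow> w \<noteq> z\<^sub>0"
  shows "central_class y \<smile>\<^bsub>0,1\<^esub> cls 1 (\<zeta> w) = HK_zero 1"
proof -
  have c: "central y" "central w" using y w central_basis by auto
  have "y * zeta_val w x = 0" for x
  proof (cases "y \<in> {\<pi>\<^sub>0, \<pi>\<^sub>3}")
    case True
    then have "y * (ar x * w) = 0" by (auto simp: mult.assoc[symmetric] pi_products)
    then show ?thesis by (simp add: zeta_val_def)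
  next
    case False
    then have "y * w = 0"
      using assms by (auto simp: z_products z8_z6)
    then show ?thesis by (simp add: central_mult_zeta_val[OF c(1)]) (simp add: zeta_val_def)
  qed
  then have "(\<lambda>x. y * zeta_val w x) = (\<lambda>x. 0)" by (rule ext)
  then show ?thesis
    unfolding zeta_eq[OF c(2)] cup_central_1[OF c(1) zeta_val_typed[OF c(2)] d1_zeta[OF c(2)]]
    by (simp only: cls_1_extend_zero)
qed

lemma unlisted_0_1_rho:
  fixes y :: "'f::field preproj"
  assumes y: "y \<in> {z\<^sub>6, z\<^sub>8, \<pi>\<^sub>0, \<pi>\<^sub>3}"
  shows "CHAR('f) = 2 \<Longrightarrow> y \<noteq> z\<^sub>6 \<Longrightarrow> central_class y \<smile>\<^bsub>0,1\<^esub> cls 1 \<rho>\<^sub>3 = HK_zero 1"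
    and "CHAR('f) = 3 \<Longrightarrow> central_class y \<smile>\<^bsub>0,1\<^esub> cls 1 \<rho>\<^sub>5 = HK_zero 1"
proof -
  have c: "central y" using y central_basis by auto
  show "central_class y \<smile>\<^bsub>0,1\<^esub> cls 1 \<rho>\<^sub>3 = HK_zero 1" if char: "CHAR('f) = 2" and "y \<noteq> z\<^sub>6"
  proof -
    have "(\<lambda>x. y * rho3_val x) = (\<lambda>x. 0)" using that(2) y by (auto simp: central_rho)
    then show ?thesis
      unfolding rho_eq cup_central_1[OF c rho_typed(1) d1_rho3[OF char]] by (simp only: cls_1_extend_zero)
  qed
  show "central_class y \<smile>\<^bsub>0,1\<^esub> cls 1 \<rho>\<^sub>5 = HK_zero 1" if char: "CHAR('f) = 3"
  proof -
    have "(\<lambda>x. y * rho5_val x) = (\<lambda>x. 0)" using y by (auto simp: central_rho)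
    then show ?thesis
      unfolding rho_eq cup_central_1[OF c rho_typed(2) d1_rho5[OF char]] by (simp only: cls_1_extend_zero)
  qed
qed

lemma unlisted_0_2_h:
  fixes y :: "'f::field preproj"
  assumes y: "y \<in> {z\<^sub>6, z\<^sub>8, \<pi>\<^sub>0, \<pi>\<^sub>3}" and "y = z\<^sub>6 \<Longrightarrow> CHAR('f) = 3 \<Longrightarrow> j \<notin> {V1, V2, V4, V5}"
  shows "central_class y \<smile>\<^bsub>0,2\<^esub> cls 2 (h j) = HK_zero 2"
proof -
  have c: "central y" using y central_basis by auto
  have "exact2 (\<lambda>i. y * h_val j i)"
  proof (cases "y = z\<^sub>6")
    case True
    show ?thesis
    proof (cases "CHAR('f) = 3")
      case char: True
      then have "j = V0 \<or> j = V3" using assms(2) True by (cases j) auto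
      then show ?thesis using z6_h0 z6_h3 True by auto
    qed (simp add: z6_h_exact True)
  qed (use y z8_h_exact pi0_h_exact pi3_h_exact in auto)
  then show ?thesis
    unfolding h_eq cup_central_2[OF c h_val_typed] by (simp add: cls_2_zero_iff typed_central_mult(2)[OF c h_val_typed])
qed

lemma unlisted_0_2_gamma:
  assumes y: "y \<in> {z\<^sub>6, z\<^sub>8, \<pi>\<^sub>0, \<pi>\<^sub>3}"
  shows "central_class y \<smile>\<^bsub>0,2\<^esub> cls 2 \<gamma>\<^sub>4 = HK_zero 2" "central_class y \<smile>\<^bsub>0,2\<^esub> cls 2 \<gamma>\<^sub>6 = HK_zero 2"
proof -
  have c: "central y" using y central_basis by auto
  show "central_class y \<smile>\<^bsub>0,2\<^esub> cls 2 \<gamma>\<^sub>4 = HK_zero 2" "central_class y \<smile>\<^bsub>0,2\<^esub> cls 2 \<gamma>\<^sub>6 = HK_zero 2"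
    unfolding gamma_eq cup_central_2[OF c gamma_typed(1)] cup_central_2[OF c gamma_typed(2)] central_gamma[OF y]
    by (simp_all add: cls_2_zero_iff vertex_typed_def exact2_zero)
qed

lemma cls_2_cup11_zero:
  "arrow_typed \<phi> \<Longrightarrow> arrow_typed \<psi> \<Longrightarrow> exact2 (cup11 \<phi> \<psi>) \<Longrightarrow> cls 2 (W2.extend (cup11 \<phi> \<psi>)) = HK_zero 2"
  by (simp add: cls_2_zero_iff vertex_typed_cup11)

lemma cup_zeta_zeta_zero:
  assumes "central y" "central z"
  shows "cls 1 (\<zeta> y) \<smile>\<^bsub>1,1\<^esub> cls 1 (\<zeta> z) = HK_zero 2"
  unfolding zeta_eq[OF assms(1)] zeta_eq[OF assms(2)]
    cup_extend_1_1[OF zeta_val_typed[OF assms(1)] d1_zeta[OF assms(1)] zeta_val_typed[OF assms(2)] d1_zeta[OF assms(2)]]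
  by (intro cls_2_cup11_zero zeta_val_typed assms) (simp add: cup_zeta_zeta[abs_def] exact2_zero)

lemma unlisted_zeta_rho:
  fixes z :: "'f::field preproj"
  assumes z: "z \<in> {z\<^sub>0, z\<^sub>6, z\<^sub>8}"
  shows "CHAR('f) = 2 \<Longrightarrow> z \<noteq> z\<^sub>0 \<Longrightarrow> cls 1 (\<zeta> z) \<smile>\<^bsub>1,1\<^esub> cls 1 \<rho>\<^sub>3 = HK_zero 2"
    and "CHAR('f) = 3 \<Longrightarrow> cls 1 (\<zeta> z) \<smile>\<^bsub>1,1\<^esub> cls 1 \<rho>\<^sub>5 = HK_zero 2"
proof -
  have c: "central z" using z central_basis by auto
  have zero: "exact2 \<psi>" if "\<And>i. \<psi> i = 0" for \<psi> :: "vertex \<Rightarrow> 'f preproj"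
    using exact2_zero that by (simp add: exact2_def)
  show "cls 1 (\<zeta> z) \<smile>\<^bsub>1,1\<^esub> cls 1 \<rho>\<^sub>3 = HK_zero 2" if char: "CHAR('f) = 2" and "z \<noteq> z\<^sub>0"
  proof -
    have "exact2 (cup11 (zeta_val z) rho3_val)"
      using z that(2) zeta6_rho3[OF char] zero[OF cup_zeta_rho_zero(1)] by auto
    then show ?thesis
      unfolding rho_eq zeta_eq[OF c] cup_extend_1_1[OF zeta_val_typed[OF c] d1_zeta[OF c] rho_typed(1) d1_rho3[OF char]]
      by (rule cls_2_cup11_zero[OF zeta_val_typed[OF c] rho_typed(1)])
  qed
  show "cls 1 (\<zeta> z) \<smile>\<^bsub>1,1\<^esub> cls 1 \<rho>\<^sub>5 = HK_zero 2" if char: "CHAR('f) = 3"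
  proof -
    have "exact2 (cup11 (zeta_val z) rho5_val)"
      using z zeta0_rho5[OF char] zero[OF cup_zeta_rho_zero(2)] zero[OF cup_zeta_rho_zero(3)] by auto
    then show ?thesis
      unfolding rho_eq zeta_eq[OF c] cup_extend_1_1[OF zeta_val_typed[OF c] d1_zeta[OF c] rho_typed(2) d1_rho5[OF char]]
      by (rule cls_2_cup11_zero[OF zeta_val_typed[OF c] rho_typed(2)])
  qed
qed

lemma rho_rho_zero:
  "CHAR('f::field) = 2 \<Longrightarrow> cls 1 \<rho>\<^sub>3 \<smile>\<^bsub>1,1\<^esub> cls 1 \<rho>\<^sub>3 = (HK_zero 2 :: 'f cochain set)"
  "CHAR('f) = 3 \<Longrightarrow> cls 1 \<rho>\<^sub>5 \<smile>\<^bsub>1,1\<^esub> cls 1 \<rho>\<^sub>5 = (HK_zero 2 :: 'f cochain set)"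
proof -
  assume char: "CHAR('f) = 2"
  show "cls 1 \<rho>\<^sub>3 \<smile>\<^bsub>1,1\<^esub> cls 1 \<rho>\<^sub>3 = (HK_zero 2 :: 'f cochain set)"
    unfolding rho_eq cup_extend_1_1[OF rho_typed(1) d1_rho3[OF char] rho_typed(1) d1_rho3[OF char]]
    by (rule cls_2_cup11_zero[OF rho_typed(1) rho_typed(1) rho3_rho3[OF char]])
next
  assume char: "CHAR('f) = 3"
  show "cls 1 \<rho>\<^sub>5 \<smile>\<^bsub>1,1\<^esub> cls 1 \<rho>\<^sub>5 = (HK_zero 2 :: 'f cochain set)"
    unfolding rho_eq cup_extend_1_1[OF rho_typed(2) d1_rho5[OF char] rho_typed(2) d1_rho5[OF char]]
    by (rule cls_2_cup11_zero[OF rho_typed(2) rho_typed(2) rho5_rho5[OF char]])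
qed

lemma signed_zero: "signed n (HK_zero p) = HK_zero p"
  unfolding HK_zero_def signed_cls[OF zero_cocycle] by simp

lemma listedI:
  "X \<in> HK_basis p \<Longrightarrow> ((0, central_class z\<^sub>0), (p, X)) \<in> listed"
  "z \<in> {z\<^sub>0, z\<^sub>6, z\<^sub>8} \<Longrightarrow> ((0, central_class z), (1, cls 1 (\<zeta> z\<^sub>0))) \<in> listed"
  by (auto simp: listed_def)

lemma listed_char:
  "CHAR('f::field) = 3 \<Longrightarrow> i \<in> {V1, V2, V4, V5} \<Longrightarrow> ((0, central_class z\<^sub>6), (2, cls 2 (h i :: 'f cochain))) \<in> listed"
  "CHAR('f) = 2 \<Longrightarrow> ((0, central_class z\<^sub>6), (1, cls 1 (\<rho>\<^sub>3 :: 'f cochain))) \<in> listed"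
  "CHAR('f) = 2 \<Longrightarrow> ((1, cls 1 (\<zeta> z\<^sub>0)), (1, cls 1 (\<rho>\<^sub>3 :: 'f cochain))) \<in> listed"
  by (auto simp: listed_def)

text \<open>\<open>listed\<close> contains classes, not names: whichever names the case distinction
  produces for \<open>X\<close> and \<open>Y\<close>, they cannot be those of a listed pair.\<close>

lemma unlisted_zero_le:
  fixes X Y :: "'f::field cochain set"
  assumes X: "X \<in> HK_basis p" and Y: "Y \<in> HK_basis q" and pq: "p \<le> q"
    and nl: "((p, X), (q, Y)) \<notin> listed" "((q, Y), (p, X)) \<notin> listed"
  shows "X \<smile>\<^bsub>p,q\<^esub> Y = HK_zero (p + q)"
proof -
  have "q < 3" using Y HK_basis_ge_3[of q] by (cases "q \<ge> 3") auto
  then consider "p = 0" "q = 0" | "p = 0" "q = 1" | "p = 0" "q = 2" | "p = 1" "q = 1" | "p + q \<ge> 3"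
    using pq by linarith
  then show ?thesis
  proof cases
    case 1
    then obtain y z where y: "y \<in> {z\<^sub>0, z\<^sub>6, z\<^sub>8, \<pi>\<^sub>0, \<pi>\<^sub>3}" "X = central_class y"
      and z: "z \<in> {z\<^sub>0, z\<^sub>6, z\<^sub>8, \<pi>\<^sub>0, \<pi>\<^sub>3}" "Y = central_class z"
      using X Y by (auto simp: HK_basis_0)
    have "y \<noteq> z\<^sub>0" using listedI(1)[OF Y] nl(1) 1 y(2) by auto
    moreover have "z \<noteq> z\<^sub>0" using listedI(1)[OF X] nl(2) 1 z(2) by auto
    ultimately show ?thesis using unlisted_0_0[of y z] y z 1 by auto
  next
    case 2
    then obtain y where y: "y \<in> {z\<^sub>0, z\<^sub>6, z\<^sub>8, \<pi>\<^sub>0, \<pi>\<^sub>3}" "X = central_class y"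
      using X by (auto simp: HK_basis_0)
    have "y \<noteq> z\<^sub>0" using listedI(1)[OF Y] nl(1) 2 y(2) by auto
    then have y': "y \<in> {z\<^sub>6, z\<^sub>8, \<pi>\<^sub>0, \<pi>\<^sub>3}" using y(1) by auto
    from Y[unfolded 2] have "central_class y \<smile>\<^bsub>0,1\<^esub> Y = HK_zero 1"
    proof (cases rule: HK_basis_1_cases)
      case (1 w)
      have "w \<noteq> z\<^sub>0" if "y \<in> {z\<^sub>6, z\<^sub>8}"
        using nl(1) listedI(2)[of y] that 1 2 y(2) by auto
      then show ?thesis unfolding 1(2) by (rule unlisted_0_1_zeta[OF y' 1(1)])
    next
      case rho3: 2
      have "y \<noteq> z\<^sub>6" using nl(1) listed_char(2) rho3 2 y(2) by auto
      then show ?thesis using unlisted_0_1_rho(1)[OF y' rho3(1)] rho3(2) by simp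
    next
      case 3
      then show ?thesis using unlisted_0_1_rho(2)[OF y'] by simp
    qed
    then show ?thesis using 2 y(2) by simp
  next
    case 3
    then obtain y where y: "y \<in> {z\<^sub>0, z\<^sub>6, z\<^sub>8, \<pi>\<^sub>0, \<pi>\<^sub>3}" "X = central_class y"
      using X by (auto simp: HK_basis_0)
    have "y \<noteq> z\<^sub>0" using listedI(1)[OF Y] nl(1) 3 y(2) by auto
    then have y': "y \<in> {z\<^sub>6, z\<^sub>8, \<pi>\<^sub>0, \<pi>\<^sub>3}" using y(1) by auto
    from Y[unfolded 3] have "central_class y \<smile>\<^bsub>0,2\<^esub> Y = HK_zero 2"
    proof (cases rule: HK_basis_2_cases)
      case (1 j)
      have "j \<notin> {V1, V2, V4, V5}" if "y = z\<^sub>6" "CHAR('f) = 3"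
        using nl(1) listed_char(1)[OF that(2), of j] that 1 3 y(2) by auto
      then show ?thesis unfolding 1 by (rule unlisted_0_2_h[OF y'])
    qed (simp_all add: unlisted_0_2_gamma[OF y'])
    then show ?thesis unfolding 3 y(2) by (simp only: add_0)
  next
    case 4
    have XY: "X \<in> HK 1" "Y \<in> HK 1" using X Y HK_basis_subset 4 by auto
    \<comment> \<open>The products of \<open>\<zeta> z\<close> with \<open>\<rho>\<^sub>3\<close>
      and \<open>\<rho>\<^sub>5\<close> are available in this order only; exchanging the factors
      costs a sign, which does not affect the zero class.\<close>
    have comm: "X \<smile>\<^bsub>1,1\<^esub> Y = HK_zero 2" if "Y \<smile>\<^bsub>1,1\<^esub> X = HK_zero 2"
      unfolding cup_graded_commutative[OF XY] that by (rule signed_zero)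
    have central: "z \<in> {z\<^sub>0, z\<^sub>6, z\<^sub>8} \<Longrightarrow> central z" for z :: "'f preproj" using central_basis by auto
    from X[unfolded 4] have "X \<smile>\<^bsub>1,1\<^esub> Y = HK_zero 2"
    proof (cases rule: HK_basis_1_cases)
      case z: (1 z)
      from Y[unfolded 4] show ?thesis
      proof (cases rule: HK_basis_1_cases)
        case (1 w)
        then show ?thesis using z cup_zeta_zeta_zero central by auto
      next
        case 2
        then have "z \<noteq> z\<^sub>0" using nl(1) listed_char(3) z 4 by auto
        then show ?thesis using unlisted_zeta_rho(1)[OF z(1) 2(1)] 2 z by simp
      next
        case 3
        then show ?thesis using unlisted_zeta_rho(2)[OF z(1) 3(1)] z by simp
      qed
    next
      case rho3: 2
      from Y[unfolded 4] show ?thesis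
      proof (cases rule: HK_basis_1_cases)
        case (1 w)
        then have "w \<noteq> z\<^sub>0" using nl(2) listed_char(3) rho3 4 by auto
        then show ?thesis using unlisted_zeta_rho(1)[OF 1(1) rho3(1)] 1 rho3 comm by simp
      next
        case 2
        then show ?thesis using rho3 rho_rho_zero(1) by simp
      qed (use rho3 in simp)
    next
      case rho5: 3
      from Y[unfolded 4] show ?thesis
      proof (cases rule: HK_basis_1_cases)
        case (1 w)
        then show ?thesis using unlisted_zeta_rho(2)[OF 1(1) rho5(1)] rho5 comm by simp
      next
        case 3
        then show ?thesis using rho5 rho_rho_zero(2) by simp
      qed (use rho5 in simp)
    qed
    then show ?thesis using 4 by (simp add: one_add_one)
  next
    case 5
    then show ?thesis using cup_ge_3_zero X Y HK_basis_subset by blast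
  qed
qed

lemma unlisted_zero:
  fixes X Y :: "'f::field cochain set"
  assumes X: "X \<in> HK_basis p" and Y: "Y \<in> HK_basis q"
    and nl: "((p, X), (q, Y)) \<notin> listed" "((q, Y), (p, X)) \<notin> listed"
  shows "X \<smile>\<^bsub>p,q\<^esub> Y = HK_zero (p + q)"
proof (cases "p \<le> q")
  case True
  then show ?thesis using unlisted_zero_le X Y nl by blast
next
  case False
  then have "Y \<smile>\<^bsub>q,p\<^esub> X = HK_zero (q + p)" using unlisted_zero_le[OF Y X] nl by simp
  moreover have "X \<in> HK p" "Y \<in> HK q" using X Y HK_basis_subset by auto
  ultimately show ?thesis
    using cup_graded_commutative[of X p Y q] by (simp add: signed_zero add.commute)
qed

section \<open>Nonvanishing of the basis classes and of the listed products\<close>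

lemma zeta_class_nonzero:
  assumes "z \<in> {z\<^sub>0, z\<^sub>6, z\<^sub>8 :: 'f::field preproj}" "z = z\<^sub>6 \<Longrightarrow> CHAR('f) \<noteq> 2"
  shows "cls 1 (\<zeta> z) \<noteq> HK_zero 1"
proof -
  have z: "central z" using assms(1) central_basis by auto
  have "\<not> exact1 (zeta_val z)"
    using assms zeta0_not_exact zeta6_not_exact zeta8_not_exact by auto
  then show ?thesis
    unfolding zeta_eq[OF z] using cls_1_zero_iff[OF zeta_val_typed[OF z] d1_zeta[OF z]] by simp
qed

lemma zeta8_class_nonzero: "cls 1 (\<zeta> z\<^sub>8 :: 'f::field cochain) \<noteq> HK_zero 1"
  unfolding zeta_eq[OF central_elements(3)] cls_1_zero_iff[OF zeta_val_typed d1_zeta, OF central_elements(3) central_elements(3)]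
  by (rule zeta8_not_exact)

lemma gamma_class_nonzero:
  "CHAR('f::field) = 2 \<Longrightarrow> cls 2 (\<gamma>\<^sub>4 :: 'f cochain) \<noteq> HK_zero 2"
  "CHAR('f) = 3 \<Longrightarrow> cls 2 (\<gamma>\<^sub>6 :: 'f cochain) \<noteq> HK_zero 2"
  "CHAR('f) = 3 \<Longrightarrow> cls 2 (- \<gamma>\<^sub>6 :: 'f cochain) \<noteq> HK_zero 2"
proof -
  show "CHAR('f) = 2 \<Longrightarrow> cls 2 (\<gamma>\<^sub>4 :: 'f cochain) \<noteq> HK_zero 2"
    unfolding gamma_eq cls_2_zero_iff[OF gamma_typed(1)] by (rule gamma4_not_exact)
  assume char: "CHAR('f) = 3"
  show "cls 2 (\<gamma>\<^sub>6 :: 'f cochain) \<noteq> HK_zero 2"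
    unfolding gamma_eq cls_2_zero_iff[OF gamma_typed(2)] by (rule gamma6_not_exact[OF char])
  have minus: "- \<gamma>\<^sub>6 = W2.extend (\<lambda>i. - gamma6_val i :: 'f preproj)"
    unfolding gamma_eq by (rule ext) (simp add: W2.extend_def sum_negf)
  show "cls 2 (- \<gamma>\<^sub>6 :: 'f cochain) \<noteq> HK_zero 2"
    unfolding minus cls_2_zero_iff[OF vertex_typed_minus[OF gamma_typed(2)]]
    using gamma6_not_exact[OF char] exact2_minus by fastforce
qed

text \<open>If the class were zero, so would be its product with \<open>z\<^sub>6\<close>; but this
  product is the class of \<open>\<zeta> z\<^sub>8\<close>.\<close>

lemma rho3_class_nonzero:
  assumes char: "CHAR('f::field) = 2"
  shows "cls 1 (\<rho>\<^sub>3 :: 'f cochain) \<noteq> HK_zero 1"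
proof
  assume zero: "cls 1 (\<rho>\<^sub>3 :: 'f cochain) = HK_zero 1"
  have "cls 1 (\<rho>\<^sub>3 :: 'f cochain) = cls 1 (W1.extend (\<lambda>x. 0))"
    unfolding zero cls_1_extend_zero ..
  then have "cls 1 (\<zeta> z\<^sub>8 :: 'f cochain) = central_class z\<^sub>6 \<smile>\<^bsub>0,1\<^esub> cls 1 (W1.extend (\<lambda>x. 0))"
    using char_2_products(1)[OF char] by simp
  also have "\<dots> = HK_zero 1"
    by (subst cup_central_1[OF central_elements(2)]) (simp_all add: arrow_typed_def d1_zero cls_1_extend_zero)
  finally show False using zeta8_class_nonzero by blast
qed

lemma rho5_class_nonzero:
  assumes char: "CHAR('f::field) = 3"
  shows "cls 1 (\<rho>\<^sub>5 :: 'f cochain) \<noteq> HK_zero 1"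
  unfolding rho_eq cls_1_zero_iff[OF rho_typed(2) d1_rho5[OF char]] by (rule rho5_not_exact[OF char])

lemma HK_basis_nonzero:
  fixes X :: "'f::field cochain set"
  assumes X: "X \<in> HK_basis p" and "CHAR('f) = 2 \<Longrightarrow> p = 1 \<Longrightarrow> X \<noteq> cls 1 (\<zeta> z\<^sub>6)"
  shows "X \<noteq> HK_zero p"
proof (cases rule: degree_cases[of p])
  case 1
  then obtain z where z: "z \<in> {z\<^sub>0, z\<^sub>6, z\<^sub>8, \<pi>\<^sub>0, \<pi>\<^sub>3}" "X = central_class z"
    using X by (auto simp: HK_basis_0)
  have "z \<noteq> 0" using z(1) central_nonzero pi0_nonzero by (auto simp: z\<^sub>0_def)
  then show ?thesis unfolding 1 z(2) using central_class_zero_iff[OF central_basis[OF z(1)]] by simp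
next
  case 2
  from X[unfolded 2] have "X \<noteq> HK_zero 1"
  proof (cases rule: HK_basis_1_cases)
    case (1 z)
    have "CHAR('f) \<noteq> 2" if z: "z = z\<^sub>6"
    proof
      assume "CHAR('f) = 2"
      from assms(2)[OF this 2] show False by (simp add: 1(2) z)
    qed
    then show ?thesis unfolding 1(2) by (rule zeta_class_nonzero[OF 1(1)])
  qed (simp_all add: rho3_class_nonzero rho5_class_nonzero)
  then show ?thesis using 2 by simp
next
  case 3
  from X[unfolded 3] have "X \<noteq> HK_zero 2"
  proof (cases rule: HK_basis_2_cases)
    case (1 j)
    then show ?thesis by (simp add: h_eq cls_2_zero_iff[OF h_val_typed] h_not_exact)
  qed (simp_all add: gamma_class_nonzero)
  then show ?thesis using 3 by simp
qed (use X HK_basis_ge_3 in auto)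

text \<open>The two excluded pairs are those with product the class of
  \<open>\<zeta> z\<^sub>6\<close>, which is zero in characteristic 2.\<close>

lemma listed_nonzero:
  fixes X Y :: "'f::field cochain set"
  assumes "((p, X), (q, Y)) \<in> listed"
    and ex: "CHAR('f) = 2 \<longrightarrow> ((p, X), (q, Y)) \<notin>
           {((0, central_class z\<^sub>0), (1, cls 1 (\<zeta> z\<^sub>6))), ((0, central_class z\<^sub>6), (1, cls 1 (\<zeta> z\<^sub>0)))}"
  shows "X \<smile>\<^bsub>p,q\<^esub> Y \<noteq> HK_zero (p + q)"
proof -
  consider "p = 0" "X = central_class z\<^sub>0" "Y \<in> HK_basis q"
    | z where "p = 0" "X = central_class z" "q = 1" "Y = cls 1 (\<zeta> z\<^sub>0)" "z \<in> {z\<^sub>0, z\<^sub>6, z\<^sub>8}"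
    | i where "CHAR('f) = 3" "p = 0" "X = central_class z\<^sub>6" "q = 2" "Y = cls 2 (h i)" "i \<in> {V1, V2, V4, V5}"
    | "CHAR('f) = 2" "p = 0" "X = central_class z\<^sub>6" "q = 1" "Y = cls 1 \<rho>\<^sub>3"
    | "CHAR('f) = 2" "p = 1" "X = cls 1 (\<zeta> z\<^sub>0)" "q = 1" "Y = cls 1 \<rho>\<^sub>3"
    using assms(1) unfolding listed_def by (auto split: if_splits)
  then show ?thesis
  proof cases
    case 1
    then have "X \<smile>\<^bsub>p,q\<^esub> Y = Y" using cup_z0 HK_basis_subset by blast
    moreover have "Y \<noteq> HK_zero q" by (rule HK_basis_nonzero[OF 1(3)]) (use 1 ex in auto)
    ultimately show ?thesis using 1 by simp
  next
    case (2 z)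
    have "cls 1 (\<zeta> z) \<noteq> HK_zero 1" by (rule zeta_class_nonzero[OF 2(5)]) (use 2 ex in auto)
    then show ?thesis using 2 cup_z_zeta0[OF 2(5)] by simp
  next
    case (3 i)
    have "central_class z\<^sub>6 \<smile>\<^bsub>0,2\<^esub> cls 2 (h i) \<in> {cls 2 \<gamma>\<^sub>6, cls 2 (- \<gamma>\<^sub>6 :: 'f cochain)}"
      using z6_h_gamma6[OF 3(1), of i] 3(6) by auto
    then show ?thesis
      using gamma_class_nonzero(2,3)[OF 3(1)] unfolding 3(2-5) add_0 by auto
  next
    case 4
    show ?thesis unfolding 4(2-5) add_0 char_2_products(1)[OF 4(1)] by (rule zeta8_class_nonzero)
  next
    case 5
    show ?thesis
      unfolding 5(2-5) one_add_one char_2_products(2)[OF 5(1)] by (rule gamma_class_nonzero(1)[OF 5(1)])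
  qed
qed

theorem proposition6p14:
  shows
    "(\<forall>p. HK_basis p \<subseteq> (HK p :: 'f::field cochain set set)) \<and>
     (\<forall>p q. \<forall>X\<in>HK p. \<forall>Y\<in>(HK q :: 'f cochain set set).
        X \<smile>\<^bsub>p,q\<^esub> Y = signed (p * q) (Y \<smile>\<^bsub>q,p\<^esub> X)) \<and>
     (\<forall>p. \<forall>X\<in>(HK p :: 'f cochain set set). central_class z\<^sub>0 \<smile>\<^bsub>0,p\<^esub> X = X) \<and>
     (\<forall>z\<in>{z\<^sub>0, z\<^sub>6, z\<^sub>8 :: 'f preproj}.
        central_class z \<smile>\<^bsub>0,1\<^esub> cls 1 (\<zeta> z\<^sub>0) = cls 1 (\<zeta> z)) \<and>
     (CHAR('f) = 3 \<longrightarrow>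
        (\<forall>i\<in>{V1, V4}. central_class z\<^sub>6 \<smile>\<^bsub>0,2\<^esub> cls 2 (h i) = cls 2 (\<gamma>\<^sub>6 :: 'f cochain)) \<and>
        (\<forall>i\<in>{V2, V5}. central_class z\<^sub>6 \<smile>\<^bsub>0,2\<^esub> cls 2 (h i) = cls 2 (- \<gamma>\<^sub>6 :: 'f cochain))) \<and>
     (CHAR('f) = 2 \<longrightarrow>
        central_class z\<^sub>6 \<smile>\<^bsub>0,1\<^esub> cls 1 \<rho>\<^sub>3 = cls 1 (\<zeta> z\<^sub>8 :: 'f cochain) \<and>
        cls 1 (\<zeta> z\<^sub>0) \<smile>\<^bsub>1,1\<^esub> cls 1 \<rho>\<^sub>3 = cls 2 (\<gamma>\<^sub>4 :: 'f cochain)) \<and>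
     (\<forall>p q. \<forall>X\<in>HK_basis p. \<forall>Y\<in>(HK_basis q :: 'f cochain set set).
        ((p, X), (q, Y)) \<notin> listed \<and> ((q, Y), (p, X)) \<notin> listed \<longrightarrow>
          X \<smile>\<^bsub>p,q\<^esub> Y = HK_zero (p + q)) \<and>
     (\<forall>p q. \<forall>X Y :: 'f cochain set.
        ((p, X), (q, Y)) \<in> listed \<and>
        (CHAR('f) = 2 \<longrightarrow> ((p, X), (q, Y)) \<notin>
           {((0, central_class z\<^sub>0), (1, cls 1 (\<zeta> z\<^sub>6))), ((0, central_class z\<^sub>6), (1, cls 1 (\<zeta> z\<^sub>0)))}) \<longrightarrow>
          X \<smile>\<^bsub>p,q\<^esub> Y \<noteq> HK_zero (p + q))"
proof (intro conjI allI ballI impI)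
  fix p q and X Y :: "'f cochain set"
  assume "X \<in> HK_basis p" "Y \<in> HK_basis q" "((p, X), (q, Y)) \<notin> listed \<and> ((q, Y), (p, X)) \<notin> listed"
  then show "X \<smile>\<^bsub>p,q\<^esub> Y = HK_zero (p + q)" using unlisted_zero by blast
next
  fix p q and X Y :: "'f cochain set"
  assume *: "((p, X), (q, Y)) \<in> listed \<and>
        (CHAR('f) = 2 \<longrightarrow> ((p, X), (q, Y)) \<notin>
           {((0, central_class z\<^sub>0), (1, cls 1 (\<zeta> z\<^sub>6))), ((0, central_class z\<^sub>6), (1, cls 1 (\<zeta> z\<^sub>0)))})"
  show "X \<smile>\<^bsub>p,q\<^esub> Y \<noteq> HK_zero (p + q)"
    by (rule listed_nonzero[OF *[THEN conjunct1] *[THEN conjunct2]])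
qed (rule HK_basis_subset cup_graded_commutative cup_z0 cup_z_zeta0 z6_h_gamma6 char_2_products; assumption)+

end
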